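(* Let $\Gamma=(X,\mathcal E)$ be the Coxeter graph (the distance-regular graph with $28$ vertices and intersection array $\{3,2,2,1;1,1,1,2\}$); the spectrum of its adjacency matrix $A$ is $3^12^8(-1+\sqrt2)^6(-1)^7(-1-\sqrt2)^6$. Let $x\in X$ and $T=T(x)$. Order the three vertices of $\Gamma_1(x)$ arbitrarily. Order $\Gamma_2(x)$ as $y_1,\dots,y_6$ so that each of the pairs $\{y_1,y_2\},\{y_3,y_4\},\{y_5,y_6\}$ has a common neighbor in $\Gamma_1(x)$, the vertices $y_1,y_4,y_6$ are pairwise at distance 3, and the vertices $y_2,y_3,y_5$ are pairwise at distance 3. Order $\Gamma_3(x)$ as $z_1,\dots,z_{12}$ so that $z_{2j-1},z_{2j}$ are the neighbors of $y_j$ in $\Gamma_3(x)$ for $1\le j\le6$, and so that with $S=\{z_2,z_3,z_5,z_8,z_{10},z_{11}\}$ every edge inside $\Gamma_3(x)$ joins a vertex in $S$ to a vertex not in $S$, while for each vertex of $\Gamma_4(x)$ its two neighbors in $\Gamma_3(x)$ are both in $S$ or both not in $S$. Then the standard module $V=\mathbb C^X$ is an orthogonal direct sum of irreducible $T$-modules $V=W_0\oplus W_{1,a}\oplus W_{1,b}\oplus W_{2,a}\oplus W_{2,b}\oplus W_{2,c}\oplus W_{3,a}\oplus W_{3,b}$, where two summands are isomorphic if and only if they have the same type in the following list, and the data are as listed. Each listed basis is a pure basis of the module. For each summand other than $W_0$, the seed vector $\nu$ spans $E_r^*W$ (so $\dim E_r^*W=1$), where $r$ is the endpoint of the summand $W$,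 and is given by its essential part. Type I ($W_0$): endpoint 0, multiplicity 1, dimension 5, diameter 4, shape $(1,1,1,1,1)$; basis $e_0^*,\dots,e_4^*$; matrix representing $A$: $\begin{pmatrix}0&3&0&0&0\\1&0&2&0&0\\0&1&0&2&0\\0&0&1&1&1\\0&0&0&2&1\end{pmatrix}$, with eigenvalues $3,2,-1+\sqrt2,-1,-1-\sqrt2$. Type II ($W_{1,a},W_{1,b}$): endpoint 1, multiplicity 2, dimension 5, diameter 3, shape $(1,1,2,1)$; basis $\nu,A\nu,E_3^*A^2\nu,E_3^*A^3\nu,E_4^*A^3\nu$ (with $A\nu=E_2^*A\nu$), where $\nu=[1,-1,0]$ for $W_{1,a}$ and $\nu=[1,1,-2]$ for $W_{1,b}$; matrix representing $A$: $\begin{pmatrix}0&2&0&0&0\\1&0&2&-1&0\\0&1&0&1&0\\0&0&1&0&-1\\0&0&1&-2&1\end{pmatrix}$, with eigenvalues $2,2,-1+\sqrt2,-1,-1-\sqrt2$. Type III ($W_{2,a}$): endpoint 2, multiplicity 1, dimension 2, diameter 1, shape $(1,1)$; basis $\nu,A\nu$ (with $A\nu=E_3^*A\nu$), where $\nu=[1,-1,-1,1,-1,1]$; matrix representing $A$: $\begin{pmatrix}0&2\\1&1\end{pmatrix}$, with eigenvalues $2,-1$. Type IV ($W_{2,b},W_{2,c}$): endpoint 2, multiplicity 2, dimension 4, diameter 2, shape $(1,2,1)$; basis $\nu,A\nu,E_3^*A^2\nu,E_4^*A^2\nu$ (with $A\nu=E_3^*A\nu$), where $\nu=[1,-1,0,0,1,-1]$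 for $W_{2,b}$ and $\nu=[1,-1,2,-2,-1,1]$ for $W_{2,c}$; matrix representing $A$: $\begin{pmatrix}0&2&-1&0\\1&0&1&2\\0&1&0&1\\0&1&0&-1\end{pmatrix}$, with eigenvalues $2,-1+\sqrt2,-1,-1-\sqrt2$. Type V ($W_{3,a}$): endpoint 3, multiplicity 1, dimension 1, diameter 0, shape $(1)$; basis $\nu$, where $\nu=[-1,1,-1,1,-1,1,-1,1,1,-1,1,-1]$; matrix representing $A$: $\begin{pmatrix}-1\end{pmatrix}$, with eigenvalue $-1$. Type VI ($W_{3,b}$): endpoint 3, multiplicity 1, dimension 2, diameter 1, shape $(1,1)$; basis $\nu,E_4^*A\nu$, where $\nu=[-1,1,1,-1,1,-1,-1,1,-1,1,1,-1]$; matrix representing $A$: $\begin{pmatrix}-1&2\\1&-1\end{pmatrix}$, with eigenvalues $-1+\sqrt2,-1-\sqrt2$. Moreover $\dim T=5^2+5^2+2^2+4^2+1^2+2^2=75$.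
   Context: Let $\Gamma=(X,\mathcal E)$ be a finite undirected connected graph without loops or multiple edges, with path-length distance $d$ and diameter $D\ge1$; put $\Gamma_i(x)=\{y\in X:d(x,y)=i\}$. $\Gamma$ is distance-regular if for all $0\le h,i,j\le D$ the number $p^h_{i,j}=|\Gamma_i(y)\cap\Gamma_j(z)|$ is the same for all $y,z\in X$ with $d(y,z)=h$. Its intersection array is $\{b_0,\dots,b_{D-1};c_1,\dots,c_D\}$ with $b_i=p^i_{1,i+1}$, $c_i=p^i_{1,i-1}$. $A\in\mathrm{Mat}_X(\mathbb C)$ is the adjacency matrix; in its spectrum, exponents denote multiplicities. The standard module $V=\mathbb C^X$ (column vectors) carries the Hermitian inner product $\langle u,v\rangle=u^t\bar v$. Fix a base vertex $x\in X$. For $0\le i\le D$, $E_i^*=E_i^*(x)$ is the diagonal matrix with $(y,y)$-entry $1$ if $d(x,y)=i$ and $0$ otherwise, and $e_i^*\in V$ is the vector with $y$-entry $1$ if $d(x,y)=i$ and $0$ otherwise. The Terwilliger algebra $T=T(x)$ is the subalgebra of $\mathrm{Mat}_X(\mathbb C)$ generated by $A$ and $E_0^*,\dots,E_D^*$. A $T$-module is a subspace $W\subseteq V$ with $BW\subseteq W$ for all $B\in T$; it is irreducible if $W\ne0$ and it properly contains no nonzero $T$-module. Isomorphisms of $T$-modules are vector space isomorphisms commuting with every $B\in T$. The endpoint of $W$ is $r=\min\{i:E_i^*W\ne0\}$; the diameter of an irreducible $W$ is $\delta=|\{i:E_i^*W\ne0\}|-1$, and its shape is $(\dim E_r^*W,\dots,\dim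 E_{r+\delta}^*W)$. The multiplicity of an irreducible module is the number of summands isomorphic to it in an orthogonal decomposition of $V$ into irreducible $T$-modules. A nonzero vector is pure with support $i$ if it lies in $E_i^*V$; its essential part is the row vector of its coordinates at the vertices of $\Gamma_i(x)$, in the chosen order (all its other coordinates are $0$). A pure basis of an irreducible $T$-module is an ordered basis of pure vectors with weakly increasing supports. The matrix $B$ representing $A$ with respect to a basis $v_1,\dots,v_\ell$ is given by $Av_j=\sum_iB_{ij}v_i$. *)

theory Defs
  imports "Jordan_Normal_Form.Char_Poly" "HOL-Analysis.Analysis"
begin

(* "$" is kept for the components of vectors in complex^'v; Jordan_Normal_Form is used only for
   the small matrices that represent A on a module, because their sizes vary. *)
no_notation Matrix.vec_index (infixl "$" 100)

section \<open>Distance-regular graphs\<close>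

text \<open>The vertex set is a finite type and a graph is its adjacency relation.\<close>

type_synonym 'v graph = "'v \<Rightarrow> 'v \<Rightarrow> bool"

definition simple_connected_graph :: "'v::finite graph \<Rightarrow> bool" where
  "simple_connected_graph adj \<longleftrightarrow> symp adj \<and> irreflp adj \<and> (\<forall>y z. adj\<^sup>*\<^sup>* y z)"

definition gdist :: "'v::finite graph \<Rightarrow> 'v \<Rightarrow> 'v \<Rightarrow> nat" where
  "gdist adj y z = (LEAST n. (adj ^^ n) y z)"

definition gdiam :: "'v::finite graph \<Rightarrow> nat" where
  "gdiam adj = Max {gdist adj y z | y z. True}"

definition Gam :: "'v::finite graph \<Rightarrow> nat \<Rightarrow> 'v \<Rightarrow> 'v set" where
  "Gam adj i y = {z. gdist adj y z = i}"

definition distance_regular :: "'v::finite graph \<Rightarrow> bool" where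
  "distance_regular adj \<longleftrightarrow> simple_connected_graph adj \<and> 1 \<le> gdiam adj \<and>
    (\<forall>h \<le> gdiam adj. \<forall>i \<le> gdiam adj. \<forall>j \<le> gdiam adj. \<exists>p. \<forall>y z. gdist adj y z = h \<longrightarrow>
       card (Gam adj i y \<inter> Gam adj j z) = p)"

text \<open>Only meaningful for distance-regular graphs and \<open>h, i, j \<le> gdiam adj\<close>.\<close>

definition intersection_number :: "'v::finite graph \<Rightarrow> nat \<Rightarrow> nat \<Rightarrow> nat \<Rightarrow> nat" where
  "intersection_number adj h i j =
    (THE p. \<forall>y z. gdist adj y z = h \<longrightarrow> card (Gam adj i y \<inter> Gam adj j z) = p)"

definition intersection_array :: "'v::finite graph \<Rightarrow> nat list \<times> nat list" where
  "intersection_array adj =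
    (map (\<lambda>i. intersection_number adj i 1 (i + 1)) [0..<gdiam adj],
     map (\<lambda>i. intersection_number adj i 1 (i - 1)) [1..<Suc (gdiam adj)])"

definition coxeter_graph :: "'v::finite graph \<Rightarrow> bool" where
  "coxeter_graph adj \<longleftrightarrow> distance_regular adj \<and> CARD('v) = 28 \<and>
     intersection_array adj = ([3, 2, 2, 1], [1, 1, 1, 2])"

section \<open>The Terwilliger algebra\<close>

definition adjacency_matrix :: "'v::finite graph \<Rightarrow> complex^'v^'v" where
  "adjacency_matrix adj = (\<chi> y z. if adj y z then 1 else 0)"

definition Estar :: "'v::finite graph \<Rightarrow> 'v \<Rightarrow> nat \<Rightarrow> complex^'v^'v" where
  "Estar adj x i = (\<chi> y z. if y = z \<and> gdist adj x y = i then 1 else 0)"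

definition estar :: "'v::finite graph \<Rightarrow> 'v \<Rightarrow> nat \<Rightarrow> complex^'v" where
  "estar adj x i = (\<chi> y. if gdist adj x y = i then 1 else 0)"

definition matrix_scale :: "complex \<Rightarrow> complex^'n^'m \<Rightarrow> complex^'n^'m" where
  "matrix_scale c M = (\<chi> i j. c * M $ i $ j)"

global_interpretation cmat: vector_space "matrix_scale :: complex \<Rightarrow> complex^'n^'m \<Rightarrow> complex^'n^'m"
  by unfold_locales (simp_all add: matrix_scale_def vec_eq_iff algebra_simps)

definition matrix_subalgebra :: "(complex^'v^'v) set \<Rightarrow> bool" where
  "matrix_subalgebra S \<longleftrightarrow>
    cmat.subspace S \<and> Finite_Cartesian_Product.mat 1 \<in> S \<and> (\<forall>M\<in>S. \<forall>N\<in>S. M ** N \<in> S)"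

definition terwilliger_algebra :: "'v::finite graph \<Rightarrow> 'v \<Rightarrow> (complex^'v^'v) set" where
  "terwilliger_algebra adj x =
    matrix_subalgebra hull (insert (adjacency_matrix adj) {Estar adj x i | i. i \<le> gdiam adj})"

section \<open>Modules\<close>

definition is_module :: "(complex^'v^'v) set \<Rightarrow> (complex^'v) set \<Rightarrow> bool" where
  "is_module T W \<longleftrightarrow> vec.subspace W \<and> (\<forall>B\<in>T. \<forall>w\<in>W. B *v w \<in> W)"

definition irreducible_module :: "(complex^'v^'v) set \<Rightarrow> (complex^'v) set \<Rightarrow> bool" where
  "irreducible_module T W \<longleftrightarrow>
    is_module T W \<and> W \<noteq> {0} \<and> \<not> (\<exists>U. is_module T U \<and> U \<noteq> {0} \<and> U \<subset> W)"

definition isomorphic_modules ::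
    "(complex^'v^'v) set \<Rightarrow> (complex^'v) set \<Rightarrow> (complex^'v) set \<Rightarrow> bool" where
  "isomorphic_modules T U W \<longleftrightarrow> (\<exists>\<phi> :: complex^'v \<Rightarrow> complex^'v. bij_betw \<phi> U W \<and>
     (\<forall>u\<in>U. \<forall>v\<in>U. \<phi> (u + v) = \<phi> u + \<phi> v) \<and>
     (\<forall>c. \<forall>u\<in>U. \<phi> (c *s u) = c *s \<phi> u) \<and>
     (\<forall>B\<in>T. \<forall>u\<in>U. \<phi> (B *v u) = B *v \<phi> u))"

definition herm :: "complex^'v \<Rightarrow> complex^'v \<Rightarrow> complex" where
  "herm u v = (\<Sum>y\<in>UNIV. u $ y * cnj (v $ y))"

text \<open>The whole space is the orthogonal direct sum of the listed subspaces.\<close>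

definition orthogonal_direct_sum :: "(complex^'v) set list \<Rightarrow> bool" where
  "orthogonal_direct_sum Ws \<longleftrightarrow>
    (\<forall>W\<in>set Ws. vec.subspace W) \<and>
    (\<forall>j<length Ws. \<forall>k<length Ws. j \<noteq> k \<longrightarrow> (\<forall>u\<in>Ws ! j. \<forall>w\<in>Ws ! k. herm u w = 0)) \<and>
    (\<forall>v. \<exists>!f. f \<in> (\<Pi>\<^sub>E k\<in>{..<length Ws}. Ws ! k) \<and> v = (\<Sum>k<length Ws. f k))"

definition irreducible_decomposition ::
    "(complex^'v^'v) set \<Rightarrow> (complex^'v) set list \<Rightarrow> bool" where
  "irreducible_decomposition T Ws \<longleftrightarrow>
    (\<forall>W\<in>set Ws. irreducible_module T W) \<and> orthogonal_direct_sum Ws"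

text \<open>The definite description makes every value statement include the independence of the
  chosen decomposition.\<close>

definition module_multiplicity :: "(complex^'v^'v) set \<Rightarrow> (complex^'v) set \<Rightarrow> nat" where
  "module_multiplicity T W = (THE m. \<exists>Ws. irreducible_decomposition T Ws \<and>
     m = card {k. k < length Ws \<and> isomorphic_modules T (Ws ! k) W})"

definition module_support :: "'v::finite graph \<Rightarrow> 'v \<Rightarrow> (complex^'v) set \<Rightarrow> nat set" where
  "module_support adj x W = {i. i \<le> gdiam adj \<and> (*v) (Estar adj x i) ` W \<noteq> {0}}"

definition endpoint :: "'v::finite graph \<Rightarrow> 'v \<Rightarrow> (complex^'v) set \<Rightarrow> nat" where
  "endpoint adj x W = Min (module_support adj x W)"

definition module_diameter :: "'v::finite graph \<Rightarrow> 'v \<Rightarrow> (complex^'v) set \<Rightarrow> nat" where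
  "module_diameter adj x W = card (module_support adj x W) - 1"

definition shape :: "'v::finite graph \<Rightarrow> 'v \<Rightarrow> (complex^'v) set \<Rightarrow> nat list" where
  "shape adj x W = map (\<lambda>i. vec.dim ((*v) (Estar adj x i) ` W))
     [endpoint adj x W ..< endpoint adj x W + module_diameter adj x W + 1]"

section \<open>Pure bases and representing matrices\<close>

definition pure_with_support :: "'v::finite graph \<Rightarrow> 'v \<Rightarrow> nat \<Rightarrow> complex^'v \<Rightarrow> bool" where
  "pure_with_support adj x i v \<longleftrightarrow> v \<noteq> 0 \<and> v \<in> range ((*v) (Estar adj x i))"

definition basis_of :: "(complex^'v) set \<Rightarrow> (complex^'v) list \<Rightarrow> bool" where
  "basis_of W bs \<longleftrightarrow> distinct bs \<and> vec.independent (set bs) \<and> vec.span (set bs) = W"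

definition pure_basis ::
    "'v::finite graph \<Rightarrow> 'v \<Rightarrow> (complex^'v) set \<Rightarrow> (complex^'v) list \<Rightarrow> bool" where
  "pure_basis adj x W bs \<longleftrightarrow> basis_of W bs \<and>
    (\<exists>sups. list_all2 (pure_with_support adj x) sups bs \<and> sorted sups)"

definition represents ::
    "complex^'v^'v \<Rightarrow> (complex^'v) list \<Rightarrow> complex Matrix.mat \<Rightarrow> bool" where
  "represents A bs B \<longleftrightarrow> B \<in> carrier_mat (length bs) (length bs) \<and>
    (\<forall>j<length bs. A *v (bs ! j) = (\<Sum>i<length bs. (B $$ (i, j)) *s (bs ! i)))"

text \<open>Eigenvalues listed with algebraic multiplicity.\<close>

definition eigenvalue_list :: "complex Matrix.mat \<Rightarrow> complex list \<Rightarrow> bool" where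
  "eigenvalue_list B es \<longleftrightarrow> char_poly B = (\<Prod>e\<leftarrow>es. [:- e, 1:])"

definition eigenspace :: "complex^'v^'v \<Rightarrow> complex \<Rightarrow> (complex^'v) set" where
  "eigenspace M \<theta> = {v. M *v v = \<theta> *s v}"

definition summand_data ::
    "'v::finite graph \<Rightarrow> 'v \<Rightarrow> (complex^'v) set \<Rightarrow> nat \<Rightarrow> nat \<Rightarrow> nat \<Rightarrow> nat \<Rightarrow> nat list \<Rightarrow>
     (complex^'v) list \<Rightarrow> complex list list \<Rightarrow> complex list \<Rightarrow> bool" where
  "summand_data adj x W r m d \<delta> sh bs Brows es \<longleftrightarrow>
     endpoint adj x W = r \<and>
     module_multiplicity (terwilliger_algebra adj x) W = m \<and>
     vec.dim W = d \<and>
     module_diameter adj x W = \<delta> \<and>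
     shape adj x W = sh \<and>
     pure_basis adj x W bs \<and>
     represents (adjacency_matrix adj) bs (mat_of_rows_list d Brows) \<and>
     eigenvalue_list (mat_of_rows_list d Brows) es"

text \<open>\<open>ord 1, \<dots>, ord n\<close> is the chosen order of the vertices at distance \<open>i\<close> from \<open>x\<close>;
  \<open>cs\<close> is the essential part of \<open>\<nu>\<close>.\<close>

definition seed ::
    "'v::finite graph \<Rightarrow> 'v \<Rightarrow> (complex^'v) set \<Rightarrow> nat \<Rightarrow> (nat \<Rightarrow> 'v) \<Rightarrow> nat \<Rightarrow> complex^'v \<Rightarrow>
     complex list \<Rightarrow> bool" where
  "seed adj x W i ord n \<nu> cs \<longleftrightarrow>
     pure_with_support adj x i \<nu> \<and> map (\<lambda>j. \<nu> $ ord j) [1..<Suc n] = cs \<and>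
     endpoint adj x W = i \<and>
     vec.span {\<nu>} = (*v) (Estar adj x i) ` W \<and> vec.dim ((*v) (Estar adj x i) ` W) = 1"

section \<open>Vertex orderings for the Coxeter graph\<close>

definition order1 :: "'v::finite graph \<Rightarrow> 'v \<Rightarrow> (nat \<Rightarrow> 'v) \<Rightarrow> bool" where
  "order1 adj x u \<longleftrightarrow> bij_betw u {1..3} (Gam adj 1 x)"

definition order2 :: "'v::finite graph \<Rightarrow> 'v \<Rightarrow> (nat \<Rightarrow> 'v) \<Rightarrow> bool" where
  "order2 adj x y \<longleftrightarrow> bij_betw y {1..6} (Gam adj 2 x) \<and>
     (\<forall>(i, j) \<in> {(1, 2), (3, 4), (5, 6)}. \<exists>w \<in> Gam adj 1 x. adj w (y i) \<and> adj w (y j)) \<and>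
     (\<forall>i \<in> {1, 4, 6}. \<forall>j \<in> {1, 4, 6}. i \<noteq> j \<longrightarrow> gdist adj (y i) (y j) = 3) \<and>
     (\<forall>i \<in> {2, 3, 5}. \<forall>j \<in> {2, 3, 5}. i \<noteq> j \<longrightarrow> gdist adj (y i) (y j) = 3)"

definition order3 :: "'v::finite graph \<Rightarrow> 'v \<Rightarrow> (nat \<Rightarrow> 'v) \<Rightarrow> (nat \<Rightarrow> 'v) \<Rightarrow> bool" where
  "order3 adj x y z \<longleftrightarrow> bij_betw z {1..12} (Gam adj 3 x) \<and>
     (\<forall>j \<in> {1..6}. {z (2 * j - 1), z (2 * j)} = {w \<in> Gam adj 3 x. adj (y j) w}) \<and>
     (let S = z ` {2, 3, 5, 8, 10, 11} in
        (\<forall>v \<in> Gam adj 3 x. \<forall>w \<in> Gam adj 3 x. adj v w \<longrightarrow> (v \<in> S \<longleftrightarrow> w \<notin> S)) \<and>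
        (\<forall>t \<in> Gam adj 4 x. {w \<in> Gam adj 3 x. adj t w} \<subseteq> S \<or> {w \<in> Gam adj 3 x. adj t w} \<inter> S = {}))"

end

theory Submission
  imports Defs
begin

text \<open>
  Every path of length 3 in a graph with this intersection array lies in exactly one heptagon, because
  \<open>c\<^sub>3 = a\<^sub>3 = 1\<close>. Following heptagons through a base vertex reconstructs the graph: the edges among the
  vertices at distance 3 close up to two 9-cycles through the vertices at distance 2, and the girth then forces
  how the vertices at distance 4 are attached. In the resulting coordinates \<open>A\<close> acts on the vectors obtained
  from a seed by the stated small matrices. For each type there are words in \<open>A\<close> and the \<open>E\<^sub>i\<^sup>*\<close> that produce
  the basis from the seed, and dual words that recover the seed from each basis vector and annihilate all other
  types. These give matrix units of \<open>T\<close>, from which irreducibility, the multiplicities in an arbitrary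
  decomposition, the orthogonality and the dimension of \<open>T\<close> all follow.
\<close>

section \<open>Linear algebra\<close>

text \<open>The intersection array gives only local counts, whereas the listed matrices need every
  adjacency. The delicate point of the reconstruction is the closing of a 9-cycle: two heptagons
  through the base vertex enter the third branch at vertices that might differ, and counts of
  distances from a vertex of Gamma_2(x) exclude this.

  The conditions on the z_j fix them only up to interchanging both vertices in all six pairs at
  once, which replaces S by its complement. The seed of type VI is 1 on S and -1 on the rest of
  Gamma_3(x), and the seed of type V differs from it by a sign on the children of y_2, y_3, y_5.
  Both merely change sign under the interchange, so their spans are well defined.

  The image of the projection of a type is the span of its seeds. Any decomposition of V cuts this
  span into orthogonal lines, one for each summand of that type, which is why the multiplicity is
  the number of listed seeds. The count 5 + 10 + 2 + 8 + 1 + 2 = 28 shows that the listed modules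
  exhaust V.\<close>

lemma herm_add_left: "herm (u + v) w = herm u w + herm v w"
  by (simp add: herm_def algebra_simps sum.distrib)

lemma herm_scale_left: "herm (c *s u) w = c * herm u w"
  by (simp add: herm_def algebra_simps sum_distrib_left)

lemma herm_add_right: "herm u (v + w) = herm u v + herm u w"
  by (simp add: herm_def algebra_simps sum.distrib)

lemma herm_scale_right: "herm u (c *s v) = cnj c * herm u v"
  by (simp add: herm_def algebra_simps sum_distrib_left)

lemma herm_zero_left [simp]: "herm 0 u = 0" and herm_zero_right [simp]: "herm u 0 = 0"
  by (simp_all add: herm_def)

lemma herm_sum_left: "herm (sum f K) w = (\<Sum>k\<in>K. herm (f k) w)"
  by (induction K rule: infinite_finite_induct) (simp_all add: herm_add_left)

lemma herm_sum_right: "herm u (sum f K) = (\<Sum>k\<in>K. herm u (f k))"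
  by (induction K rule: infinite_finite_induct) (simp_all add: herm_add_right)

lemma herm_self_eq_0_iff [simp]: "herm u u = 0 \<longleftrightarrow> u = 0"
proof -
  have "herm u u = complex_of_real (\<Sum>y\<in>UNIV. (cmod (u $ y))\<^sup>2)"
    unfolding herm_def of_real_sum by (rule sum.cong[OF refl]) (simp only: complex_norm_square)
  also have "\<dots> = 0 \<longleftrightarrow> (\<forall>y\<in>UNIV. (cmod (u $ y))\<^sup>2 = 0)"
    unfolding of_real_eq_0_iff by (rule sum_nonneg_eq_0_iff) simp_all
  finally show ?thesis by (simp add: vec_eq_iff)
qed

lemma mult_vec_sum: "(M :: complex^'n^'m) *v (sum f K) = (\<Sum>k\<in>K. M *v f k)"
  by (induction K rule: infinite_finite_induct) (simp_all add: matrix_vector_right_distrib)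

lemma matrix_scale_mult_vec: "matrix_scale c M *v u = c *s (M *v u)"
  by (simp add: matrix_scale_def matrix_vector_mult_def vec_eq_iff sum_distrib_left mult.assoc)

lemma matrix_eqI: "(\<And>u. (M :: complex^'n^'m) *v u = N *v u) \<Longrightarrow> M = N"
  by (simp add: matrix_eq)

text \<open>Applying \<open>L i\<close> to a vanishing combination isolates its i-th coefficient.
  The setting is an abstract vector space because the lemma serves both for vectors and for the
  matrices of T in \<open>dim_algebra\<close>.\<close>

lemma (in vector_space) independent_of_functionals:
  assumes fin: "finite I"
    and add: "\<And>i u v. L i (u + v) = L i u + L i v"
    and scale: "\<And>i c u. L i (scale c u) = c * L i u"
    and off: "\<And>i j. i \<in> I \<Longrightarrow> j \<in> I \<Longrightarrow> i \<noteq> j \<Longrightarrow> L i (b j) = 0"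
    and diag: "\<And>i. i \<in> I \<Longrightarrow> L i (b i) \<noteq> 0"
  shows "inj_on b I" "independent (b ` I)"
proof -
  show inj: "inj_on b I"
    using off diag by (metis inj_onI)
  have L0: "L i 0 = 0" for i
    using scale[of i 0 0] by simp
  have Lsum: "L i (sum f K) = (\<Sum>k\<in>K. L i (f k))" for i f and K :: "'d set"
    by (induction K rule: infinite_finite_induct) (simp_all add: add L0)
  show "independent (b ` I)"
  proof (rule independent_if_scalars_zero)
    show "finite (b ` I)" using fin by simp
    fix f u assume *: "(\<Sum>v\<in>b ` I. scale (f v) v) = 0" and "u \<in> b ` I"
    then obtain i where i: "i \<in> I" "u = b i" by blast
    have "0 = L i (\<Sum>j\<in>I. scale (f (b j)) (b j))"
      using * by (simp add: sum.reindex[OF inj] L0)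
    also have "\<dots> = (\<Sum>j\<in>I. if j = i then f u * L i u else 0)"
      unfolding Lsum by (rule sum.cong[OF refl]) (use i off in \<open>auto simp: scale\<close>)
    also have "\<dots> = f u * L i u" using fin i by simp
    finally show "f u = 0" using diag i by simp
  qed
qed

lemma spanning_of_independent:
  fixes b :: "'i \<Rightarrow> complex^'v"
  assumes "inj_on b I" "vec.independent (b ` I)" "card I = CARD('v)"
  shows "vec.span (b ` I) = UNIV"
proof -
  have "finite (b ` I)" using assms(2) vec.finiteI_independent by blast
  then show ?thesis
    using vec.card_eq_dim[of "b ` I" UNIV] assms
    by (auto simp: card_cart_basis card_image simp flip: top.extremum_unique)
qed

lemma eigenspace_subspace: "vec.subspace (eigenspace M \<theta>)"
  by (rule vec.subspaceI)
     (simp_all add: eigenspace_def matrix_vector_right_distrib vector_scalar_commute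
        vec.scale_right_distrib vector_smult_assoc mult.commute)

text \<open>In the eigenbasis, \<open>M\<close> minus \<open>t\<close> multiplies the i-th
  coordinate by \<open>\<theta> i - t\<close>, so an eigenvector for \<open>t\<close> involves only
  basis vectors whose eigenvalue is \<open>t\<close>.\<close>

lemma dim_eigenspace_of_eigenbasis:
  fixes M :: "complex^'v^'v" and b :: "'i \<Rightarrow> complex^'v"
  assumes fin: "finite I" and inj: "inj_on b I" and ind: "vec.independent (b ` I)"
    and card: "card I = CARD('v)" and eig: "\<And>i. i \<in> I \<Longrightarrow> M *v b i = \<theta> i *s b i"
  shows "vec.dim (eigenspace M t) = card {i\<in>I. \<theta> i = t}"
proof -
  let ?J = "{i\<in>I. \<theta> i = t}"
  have "eigenspace M t = vec.span (b ` ?J)"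
  proof
    show "vec.span (b ` ?J) \<subseteq> eigenspace M t"
      by (rule vec.span_minimal) (auto simp: eigenspace_subspace, auto simp: eigenspace_def eig vector_scalar_commute vector_smult_assoc mult.commute)
    show "eigenspace M t \<subseteq> vec.span (b ` ?J)"
    proof
      fix u assume u: "u \<in> eigenspace M t"
      have "u \<in> vec.span (b ` I)"
        using spanning_of_independent[OF inj ind card] by simp
      then obtain f where f: "u = (\<Sum>v\<in>b ` I. f v *s v)"
        using fin by (auto simp: vec.span_finite)
      have "0 = M *v u - t *s u" using u by (simp add: eigenspace_def)
      also have "\<dots> = (\<Sum>i\<in>I. f (b i) *s (M *v b i) - (t * f (b i)) *s b i)"
        by (simp add: f sum.reindex[OF inj] mult_vec_sum vector_scalar_commute sum_subtractf
            vec.scale_sum_right vector_smult_assoc)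
      also have "\<dots> = (\<Sum>i\<in>I. (f (b i) * (\<theta> i - t)) *s b i)"
        by (rule sum.cong[OF refl]) (simp add: eig vec_eq_iff algebra_simps)
      \<comment> \<open>Independence concerns coefficients indexed by vectors;
        \<open>the_inv_into\<close> recovers the index from the vector.\<close>
      also have "\<dots> = (\<Sum>v\<in>b ` I. (f v * (\<theta> (the_inv_into I b v) - t)) *s v)"
        by (simp add: sum.reindex[OF inj] the_inv_into_f_f[OF inj])
      finally have zero: "f (b i) * (\<theta> i - t) = 0" if "i \<in> I" for i
        using vec.independentD[OF ind _ order_refl, of "\<lambda>v. f v * (\<theta> (the_inv_into I b v) - t)" "b i"]
          fin that by (simp add: the_inv_into_f_f[OF inj])
      have "u = (\<Sum>i\<in>I. f (b i) *s b i)"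
        by (simp add: f sum.reindex[OF inj])
      also have "\<dots> = (\<Sum>i\<in>?J. f (b i) *s b i)"
        by (rule sum.mono_neutral_right) (use fin zero in auto)
      also have "\<dots> \<in> vec.span (b ` ?J)"
        by (intro vec.span_sum vec.span_scale vec.span_base) auto
      finally show "u \<in> vec.span (b ` ?J)" .
    qed
  qed
  moreover have "vec.independent (b ` ?J)"
    by (rule vec.independent_mono[OF ind]) auto
  moreover have "inj_on b ?J" by (rule inj_on_subset[OF inj]) auto
  ultimately show ?thesis
    by (simp add: vec.dim_eq_card_independent card_image)
qed

text \<open>Spanning gives existence. For uniqueness, pairing the difference of two expansions with
  its own j-th component leaves only the norm of that component.\<close>

lemma orthogonal_direct_sumI:
  fixes Ws :: "(complex^'v) set list"
  assumes sub: "\<And>W. W \<in> set Ws \<Longrightarrow> vec.subspace W"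
    and orth: "\<And>j k u w. j < length Ws \<Longrightarrow> k < length Ws \<Longrightarrow> j \<noteq> k \<Longrightarrow> u \<in> Ws ! j \<Longrightarrow> w \<in> Ws ! k \<Longrightarrow> herm u w = 0"
    and span: "vec.span (\<Union> (set Ws)) = UNIV"
  shows "orthogonal_direct_sum Ws"
  unfolding orthogonal_direct_sum_def
proof (intro conjI ballI allI impI)
  let ?n = "length Ws"
  have sub': "vec.subspace (Ws ! k)" if "k < ?n" for k using sub that by simp
  fix v
  show "\<exists>!f. f \<in> (\<Pi>\<^sub>E k\<in>{..<?n}. Ws ! k) \<and> v = (\<Sum>k<?n. f k)"
  proof (rule ex_ex1I)
    have "v \<in> vec.span (\<Union> (set Ws))" using span by simp
    then have "\<exists>f. (\<forall>k<?n. f k \<in> Ws ! k) \<and> v = (\<Sum>k<?n. f k)"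
    proof (induction rule: vec.span_induct_alt)
      case base
      show ?case by (rule exI[of _ "\<lambda>_. 0"]) (simp add: sub' vec.subspace_0)
    next
      case (step c x y)
      then obtain f where f: "\<forall>k<?n. f k \<in> Ws ! k" "y = (\<Sum>k<?n. f k)" by blast
      from step obtain j where j: "j < ?n" "x \<in> Ws ! j" by (auto simp: in_set_conv_nth)
      show ?case
      proof (intro exI conjI allI impI)
        show "(f(j := c *s x + f j)) k \<in> Ws ! k" if "k < ?n" for k
          using f j that by (auto intro: vec.subspace_add[OF sub'] vec.subspace_scale[OF sub'])
        have "(\<Sum>k<?n. (f(j := c *s x + f j)) k) = (\<Sum>k<?n. (if k = j then c *s x else 0) + f k)"
          by (rule sum.cong) auto
        then show "c *s x + y = (\<Sum>k<?n. (f(j := c *s x + f j)) k)"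
          using f j by (simp add: sum.distrib)
      qed
    qed
    then obtain f where f: "\<forall>k<?n. f k \<in> Ws ! k" "v = (\<Sum>k<?n. f k)" by blast
    \<comment> \<open>Restriction makes the family extensional, without which uniqueness in the
      product of functions would fail.\<close>
    show "\<exists>f. f \<in> (\<Pi>\<^sub>E k\<in>{..<?n}. Ws ! k) \<and> v = (\<Sum>k<?n. f k)"
      by (rule exI[of _ "restrict f {..<?n}"]) (use f in auto)
  next
    fix f g assume f: "f \<in> (\<Pi>\<^sub>E k\<in>{..<?n}. Ws ! k) \<and> v = (\<Sum>k<?n. f k)"
      and g: "g \<in> (\<Pi>\<^sub>E k\<in>{..<?n}. Ws ! k) \<and> v = (\<Sum>k<?n. g k)"
    have "f j = g j" if j: "j < ?n" for j
    proof -
      let ?h = "\<lambda>k. f k - g k"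
      have h: "?h k \<in> Ws ! k" if "k < ?n" for k
        using f g that by (auto intro!: vec.subspace_diff[OF sub'])
      have "(\<Sum>k<?n. ?h k) = 0" using f g by (simp add: sum_subtractf)
      then have "0 = herm (?h j) (\<Sum>k<?n. ?h k)" by simp
      also have "\<dots> = (\<Sum>k<?n. if k = j then herm (?h j) (?h j) else 0)"
        unfolding herm_sum_right
        by (rule sum.cong[OF refl]) (use j h orth in auto)
      finally have "herm (?h j) (?h j) = 0" using j by simp
      then show ?thesis by simp
    qed
    then show "f = g" using f g by (intro PiE_ext[of f "{..<?n}" _ g]) auto
  qed
qed (use sub orth in auto)

lemma sum_mult_vec: "(sum f K :: complex^'n^'m) *v u = (\<Sum>k\<in>K. f k *v u)"
  by (induction K rule: infinite_finite_induct) (simp_all add: matrix_vector_mult_add_rdistrib)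

section \<open>Matrix algebras and their modules\<close>

lemma matrix_subalgebra_hull: "matrix_subalgebra (matrix_subalgebra hull G)"
  by (rule hull_in) (auto simp: matrix_subalgebra_def intro: cmat.subspace_Inter)

lemma is_moduleD:
  assumes "is_module T W"
  shows "vec.subspace W" "\<And>M u. M \<in> T \<Longrightarrow> u \<in> W \<Longrightarrow> M *v u \<in> W"
  using assms by (auto simp: is_module_def)

lemma isomorphic_modules_sym:
  assumes "isomorphic_modules T U W" "is_module T U"
  shows "isomorphic_modules T W U"
proof -
  obtain \<phi> where \<phi>: "bij_betw \<phi> U W" "\<And>u v. u \<in> U \<Longrightarrow> v \<in> U \<Longrightarrow> \<phi> (u + v) = \<phi> u + \<phi> v"
    "\<And>c u. u \<in> U \<Longrightarrow> \<phi> (c *s u) = c *s \<phi> u"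
    "\<And>M u. M \<in> T \<Longrightarrow> u \<in> U \<Longrightarrow> \<phi> (M *v u) = M *v \<phi> u"
    using assms unfolding isomorphic_modules_def by blast
  let ?\<psi> = "inv_into U \<phi>"
  note sub = is_moduleD[OF assms(2)]
  have inv: "?\<psi> w \<in> U" "\<phi> (?\<psi> w) = w" if "w \<in> W" for w
    using \<phi>(1) that by (auto simp: bij_betw_def inv_into_into f_inv_into_f)
  have eq: "?\<psi> (\<phi> u) = u" if "u \<in> U" for u
    using \<phi>(1) that by (auto simp: bij_betw_def inv_into_f_f)
  have "bij_betw ?\<psi> W U" using \<phi>(1) by (rule bij_betw_inv_into)
  moreover have "?\<psi> (v + w) = ?\<psi> v + ?\<psi> w" if "v \<in> W" "w \<in> W" for v w
    using \<phi>(2)[OF inv(1) inv(1), OF that] eq[of "?\<psi> v + ?\<psi> w"] inv that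
      vec.subspace_add[OF sub(1)] by simp
  moreover have "?\<psi> (c *s w) = c *s ?\<psi> w" if "w \<in> W" for c w
    using \<phi>(3)[OF inv(1), OF that, of c] eq[of "c *s ?\<psi> w"] inv that vec.subspace_scale[OF sub(1)] by simp
  moreover have "?\<psi> (M *v w) = M *v ?\<psi> w" if "w \<in> W" "M \<in> T" for M w
    using \<phi>(4)[OF that(2) inv(1), OF that(1)] eq[of "M *v ?\<psi> w"] inv that sub(2) by simp
  ultimately show ?thesis unfolding isomorphic_modules_def by blast
qed

text \<open>
  A multiplicity-blind description of \<open>V\<close> as a module: there are \<open>N\<close> types, the irreducible
  modules of type \<open>k\<close> are generated by the nonzero vectors \<open>s\<close> in the span of the seeds \<open>ss k\<close>,
  each has the basis \<open>w *v s\<close> for \<open>w\<close> in \<open>ws k\<close>, and the elements of \<open>vs k\<close> act on these bases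
  as dual words. The matrices \<open>ws k ! i ** vs k ! j\<close> are then matrix units of the algebra.
\<close>

locale seed_system =
  fixes G :: "(complex^'v::finite^'v) set" and T :: "(complex^'v^'v) set" and N :: nat
    and ws vs :: "nat \<Rightarrow> (complex^'v^'v) list" and ss :: "nat \<Rightarrow> (complex^'v) list"
  assumes T: "T = matrix_subalgebra hull G"
    and gen_symm: "M \<in> G \<Longrightarrow> herm (M *v u) w = herm u (M *v w)"
    and words: "k < N \<Longrightarrow> set (ws k) \<subseteq> T" "k < N \<Longrightarrow> set (vs k) \<subseteq> T"
    and lengths: "k < N \<Longrightarrow> length (vs k) = length (ws k)"
    and ws_0: "k < N \<Longrightarrow> ws k \<noteq> []" "k < N \<Longrightarrow> ws k ! 0 = Finite_Cartesian_Product.mat 1"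
    and dual: "k < N \<Longrightarrow> l < N \<Longrightarrow> i < length (ws k) \<Longrightarrow> j < length (ws l) \<Longrightarrow> s \<in> vec.span (set (ss l)) \<Longrightarrow>
       (vs k ! i) *v ((ws l ! j) *v s) = (if k = l \<and> i = j then s else 0)"
    and gen_closed: "M \<in> G \<Longrightarrow> k < N \<Longrightarrow>
       \<exists>c. \<forall>i<length (ws k). \<forall>s\<in>vec.span (set (ss k)).
         M *v ((ws k ! i) *v s) = (\<Sum>j<length (ws k). c j i *s ((ws k ! j) *v s))"
    and proj_symm: "k < N \<Longrightarrow> herm ((vs k ! 0) *v u) w = herm u ((vs k ! 0) *v w)"
    and seeds: "k < N \<Longrightarrow> a < length (ss k) \<Longrightarrow> ss k ! a \<noteq> 0"
      "k < N \<Longrightarrow> ss k \<noteq> []"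
      "k < N \<Longrightarrow> a < length (ss k) \<Longrightarrow> b < length (ss k) \<Longrightarrow> a \<noteq> b \<Longrightarrow> herm (ss k ! a) (ss k ! b) = 0"
    and total: "(\<Sum>k<N. length (ws k) * length (ss k)) = CARD('v)"
begin

abbreviation d :: "nat \<Rightarrow> nat" where "d k \<equiv> length (ws k)"
abbreviation S :: "nat \<Rightarrow> (complex^'v) set" where "S k \<equiv> vec.span (set (ss k))"

definition W :: "nat \<Rightarrow> complex^'v \<Rightarrow> (complex^'v) set" where
  "W k s = vec.span ((\<lambda>w. w *v s) ` set (ws k))"

lemma subalgebra: "matrix_subalgebra T"
  unfolding T by (rule matrix_subalgebra_hull)

lemma T_closed:
  "M \<in> T \<Longrightarrow> M' \<in> T \<Longrightarrow> M ** M' \<in> T" "Finite_Cartesian_Product.mat 1 \<in> T" "cmat.subspace T"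
  using subalgebra by (auto simp: matrix_subalgebra_def)

lemma T_induct:
  assumes "M \<in> T" "\<And>M. M \<in> G \<Longrightarrow> Q M" "matrix_subalgebra {M. Q M}"
  shows "Q M"
  using hull_minimal[of G "{M. Q M}" matrix_subalgebra] assms T by auto

lemma ws_T: "k < N \<Longrightarrow> i < d k \<Longrightarrow> ws k ! i \<in> T"
  and vs_T: "k < N \<Longrightarrow> i < d k \<Longrightarrow> vs k ! i \<in> T"
  using words lengths nth_mem by (metis subsetD)+

lemma d_pos: "k < N \<Longrightarrow> 0 < d k"
  using ws_0 by auto

text \<open>The coefficients are the same for all seeds of a type. This property survives sums,
  scalars and products (which multiply the coefficient matrices), so it passes from the generators
  to T. The uniformity is what makes modules of one type isomorphic.\<close>

lemma closed:
  assumes "M \<in> T" "k < N"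
  shows "\<exists>c. \<forall>i<d k. \<forall>s\<in>S k. M *v ((ws k ! i) *v s) = (\<Sum>j<d k. c j i *s ((ws k ! j) *v s))"
proof -
  let ?Q = "\<lambda>M c. \<forall>i<d k. \<forall>s\<in>S k. M *v ((ws k ! i) *v s) = (\<Sum>j<d k. c j i *s ((ws k ! j) *v s))"
  show ?thesis
    using assms(1)
  proof (rule T_induct)
    show "\<exists>c. ?Q M c" if "M \<in> G" for M using gen_closed that assms(2) by blast
    show "matrix_subalgebra {M. \<exists>c. ?Q M c}"
      unfolding matrix_subalgebra_def
    proof (intro conjI ballI cmat.subspaceI)
      show "0 \<in> {M. \<exists>c. ?Q M c}"
        by (auto intro!: exI[of _ "\<lambda>_ _. 0"])
      show "Finite_Cartesian_Product.mat 1 \<in> {M. \<exists>c. ?Q M c}"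
        by (auto intro!: exI[of _ "\<lambda>j i. if j = i then 1 else 0"] simp: if_distrib if_distribR cong: if_cong)
      fix M M' assume "M \<in> {M. \<exists>c. ?Q M c}" and "M' \<in> {M. \<exists>c. ?Q M c}"
      then obtain c c' where c: "?Q M c" "?Q M' c'" by blast
      show "M + M' \<in> {M. \<exists>c. ?Q M c}"
        using c by (auto intro!: exI[of _ "\<lambda>j i. c j i + c' j i"]
            simp: matrix_vector_mult_add_rdistrib vec.scale_left_distrib sum.distrib)
      have "?Q (M ** M') (\<lambda>j i. \<Sum>l<d k. c' l i * c j l)"
      proof (intro allI impI ballI)
        fix i s assume i: "i < d k" and s: "s \<in> S k"
        have "M ** M' *v (ws k ! i *v s) = M *v (\<Sum>l<d k. c' l i *s (ws k ! l *v s))"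
          using c i s by (simp flip: matrix_vector_mul_assoc)
        also have "\<dots> = (\<Sum>l<d k. \<Sum>j<d k. (c' l i * c j l) *s (ws k ! j *v s))"
          unfolding mult_vec_sum
          by (rule sum.cong[OF refl]) (use c s in \<open>simp add: vector_scalar_commute vec.scale_sum_right vector_smult_assoc\<close>)
        also have "\<dots> = (\<Sum>j<d k. (\<Sum>l<d k. c' l i * c j l) *s (ws k ! j *v s))"
          by (subst sum.swap) (simp add: vec.scale_sum_left)
        finally show "M ** M' *v (ws k ! i *v s) = (\<Sum>j<d k. (\<Sum>l<d k. c' l i * c j l) *s (ws k ! j *v s))" .
      qed
      then show "M ** M' \<in> {M. \<exists>c. ?Q M c}" by (intro CollectI exI)
    next
      fix x M assume "M \<in> {M. \<exists>c. ?Q M c}"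
      then obtain c where c: "?Q M c" by blast
      then show "matrix_scale x M \<in> {M. \<exists>c. ?Q M c}"
        by (auto intro!: exI[of _ "\<lambda>j i. x * c j i"]
            simp: matrix_scale_mult_vec vec.scale_sum_right vector_smult_assoc)
    qed
  qed
qed

text \<open>The generators are self-adjoint, and the adjoint of a product is the product of the
  adjoints in reverse order; hence T is closed under adjoints.\<close>

lemma adjoint_exists:
  assumes "M \<in> T"
  obtains M' where "M' \<in> T" "\<And>u w. herm (M *v u) w = herm u (M' *v w)"
proof -
  let ?Q = "\<lambda>M. \<exists>M'\<in>T. \<forall>u w. herm (M *v u) w = herm u (M' *v w)"
  have "?Q M"
    using assms
  proof (rule T_induct)
    show "?Q M" if "M \<in> G" for M
      using gen_symm[OF that] hull_subset[of G matrix_subalgebra] that T by blast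
    show "matrix_subalgebra {M. ?Q M}"
      unfolding matrix_subalgebra_def
    proof (intro conjI ballI cmat.subspaceI)
      show "0 \<in> {M. ?Q M}"
        using T_closed(3) cmat.subspace_0 by (auto intro!: bexI[of _ 0])
      show "Finite_Cartesian_Product.mat 1 \<in> {M. ?Q M}"
        using T_closed(2) by (auto intro!: bexI[of _ "Finite_Cartesian_Product.mat 1"])
      fix M N assume "M \<in> {M. ?Q M}" and "N \<in> {M. ?Q M}"
      then obtain M' N' where *: "M' \<in> T" "N' \<in> T" "\<And>u w. herm (M *v u) w = herm u (M' *v w)"
        "\<And>u w. herm (N *v u) w = herm u (N' *v w)" by auto
      show "M + N \<in> {M. ?Q M}"
        using * T_closed(3) cmat.subspace_add
        by (auto intro!: bexI[of _ "M' + N'"] simp: matrix_vector_mult_add_rdistrib herm_add_left herm_add_right)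
      show "M ** N \<in> {M. ?Q M}"
        using * T_closed(1)
        by (auto intro!: bexI[of _ "N' ** M'"] simp flip: matrix_vector_mul_assoc)
    next
      fix x M assume "M \<in> {M. ?Q M}"
      then obtain M' where *: "M' \<in> T" "\<And>u w. herm (M *v u) w = herm u (M' *v w)" by auto
      then show "matrix_scale x M \<in> {M. ?Q M}"
        using T_closed(3) cmat.subspace_scale
        by (auto intro!: bexI[of _ "matrix_scale (cnj x) M'"]
            simp: matrix_scale_mult_vec herm_scale_left herm_scale_right)
    qed
  qed
  then show ?thesis using that by blast
qed

lemma W_eq: "W k s = {u. \<exists>c. u = (\<Sum>i<d k. c i *s ((ws k ! i) *v s))}" (is "_ = ?R")
proof
  show "W k s \<subseteq> ?R"
    unfolding W_def
  proof (rule vec.span_minimal)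
    show "(\<lambda>w. w *v s) ` set (ws k) \<subseteq> ?R"
    proof clarify
      fix w assume "w \<in> set (ws k)"
      then obtain j where "j < d k" "w = ws k ! j" by (auto simp: in_set_conv_nth)
      then show "\<exists>c. w *v s = (\<Sum>i<d k. c i *s (ws k ! i *v s))"
        by (auto intro!: exI[of _ "\<lambda>i. if i = j then 1 else 0"] simp: if_distrib if_distribR cong: if_cong)
    qed
    show "vec.subspace ?R"
    proof (rule vec.subspaceI)
      show "0 \<in> ?R" by (auto intro!: exI[of _ "\<lambda>_. 0"])
      show "u + v \<in> ?R" if uv: "u \<in> ?R" "v \<in> ?R" for u v
      proof -
        obtain c c' where "u = (\<Sum>i<d k. c i *s ((ws k ! i) *v s))" "v = (\<Sum>i<d k. c' i *s ((ws k ! i) *v s))"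
          using uv by blast
        then have "u + v = (\<Sum>i<d k. (c i + c' i) *s ((ws k ! i) *v s))"
          by (simp add: vec.scale_left_distrib sum.distrib)
        then show ?thesis by (intro CollectI exI)
      qed
      show "x *s u \<in> ?R" if u: "u \<in> ?R" for x u
      proof -
        obtain c where "u = (\<Sum>i<d k. c i *s ((ws k ! i) *v s))" using u by blast
        then have "x *s u = (\<Sum>i<d k. (x * c i) *s ((ws k ! i) *v s))"
          by (simp add: vec.scale_sum_right vector_smult_assoc)
        then show ?thesis by (intro CollectI exI)
      qed
    qed
  qed
  show "?R \<subseteq> W k s"
    unfolding W_def by (auto intro!: vec.span_sum vec.span_scale intro: vec.span_base)
qed

lemma W_subspace: "vec.subspace (W k s)"
  by (simp add: W_def)

lemma word_in_W: "i < d k \<Longrightarrow> (ws k ! i) *v s \<in> W k s"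
  unfolding W_def by (auto intro: vec.span_base)

lemma seed_in_W: "k < N \<Longrightarrow> s \<in> W k s"
  using word_in_W[OF d_pos, of k s] ws_0(2)[of k] by simp

lemma W_module:
  assumes "k < N" "s \<in> S k"
  shows "is_module T (W k s)"
  unfolding is_module_def
proof (intro conjI ballI W_subspace)
  fix M u assume "M \<in> T" "u \<in> W k s"
  then obtain c where c: "u = (\<Sum>i<d k. c i *s ((ws k ! i) *v s))" by (auto simp: W_eq)
  obtain e where "\<And>i s. i < d k \<Longrightarrow> s \<in> S k \<Longrightarrow>
     M *v ((ws k ! i) *v s) = (\<Sum>j<d k. e j i *s ((ws k ! j) *v s))"
    using closed[OF \<open>M \<in> T\<close> assms(1)] by blast
  then have "M *v ((ws k ! i) *v s) \<in> W k s" if "i < d k" for i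
    using assms that by (auto simp: W_eq)
  then show "M *v u \<in> W k s"
    unfolding c mult_vec_sum vector_scalar_commute
    by (auto intro!: vec.subspace_sum vec.subspace_scale W_subspace)
qed

text \<open>This makes the dual words coordinate functionals that themselves belong to T, so that
  submodules and homomorphisms can be tested coordinate by coordinate.\<close>

lemma dual_sum:
  assumes "k < N" "l < N" "i < d k" "s \<in> S l"
  shows "(vs k ! i) *v (\<Sum>j<d l. c j *s ((ws l ! j) *v s)) = (if k = l then c i *s s else 0)"
proof -
  have "(vs k ! i) *v (\<Sum>j<d l. c j *s ((ws l ! j) *v s)) = (\<Sum>j<d l. if k = l \<and> i = j then c j *s s else 0)"
    unfolding mult_vec_sum vector_scalar_commute
    by (rule sum.cong[OF refl]) (use assms dual in auto)
  then show ?thesis using assms by (cases "k = l") auto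
qed

lemma dual_W:
  assumes "k < N" "l < N" "i < d k" "s \<in> S l" "u \<in> W l s"
  shows "\<exists>c. (vs k ! i) *v u = (if k = l then c *s s else 0)"
  using assms dual_sum[of k l i s] by (auto simp: W_eq)

lemma S_module:
  assumes "is_module T U" "s \<in> U" "k < N"
  shows "W k s \<subseteq> U"
  unfolding W_def
  by (rule vec.span_minimal) (use assms words(1) is_moduleD[OF assms(1)] in auto)

text \<open>A nonzero vector of a submodule has a nonzero coordinate; the dual word for it turns the
  vector into a nonzero multiple of the seed, and the seed generates the whole module.\<close>

lemma W_irreducible:
  assumes k: "k < N" and s: "s \<in> S k" "s \<noteq> 0"
  shows "irreducible_module T (W k s)"
  unfolding irreducible_module_def
proof (intro conjI W_module k s(1) notI)
  show False if "W k s = {0}" using that seed_in_W[OF k, of s] s by simp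
  assume "\<exists>U. is_module T U \<and> U \<noteq> {0} \<and> U \<subset> W k s"
  then obtain U where U: "is_module T U" "U \<noteq> {0}" "U \<subset> W k s" by blast
  then obtain u where u: "u \<in> U" "u \<noteq> 0"
    using vec.subspace_0[OF is_moduleD(1)[OF U(1)]] by blast
  then obtain c where c: "u = (\<Sum>i<d k. c i *s ((ws k ! i) *v s))" using U by (auto simp: W_eq)
  have "\<exists>i<d k. c i \<noteq> 0"
  proof (rule ccontr)
    assume "\<not> ?thesis"
    then have "u = 0" unfolding c by (intro sum.neutral) auto
    then show False using u by simp
  qed
  then obtain i where i: "i < d k" "c i \<noteq> 0" by blast
  have "c i *s s \<in> U"
    using is_moduleD(2)[OF U(1) vs_T[OF k i(1)] u(1)] dual_sum[OF k k i(1) s(1), of c] by (simp add: c)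
  then have "s \<in> U"
    using vec.subspace_scale[OF is_moduleD(1)[OF U(1)], of "c i *s s" "inverse (c i)"] i
    by (simp add: vector_smult_assoc)
  then show False using S_module[OF U(1) _ k] U(3) by blast
qed

text \<open>The isomorphism transfers coordinates from the basis grown from \<open>s\<close> to the
  one grown from \<open>s'\<close>. It commutes with T because \<open>closed\<close> gives one
  coefficient matrix for both seeds.\<close>

lemma W_isomorphic:
  assumes k: "k < N" and s: "s \<in> S k" "s \<noteq> 0" and s': "s' \<in> S k" "s' \<noteq> 0"
  shows "isomorphic_modules T (W k s) (W k s')"
proof -
  \<comment> \<open>The definite description is the i-th coordinate of \<open>u\<close> relative to
    \<open>s\<close>; it is unique because \<open>s\<close> is nonzero.\<close>
  let ?\<phi> = "\<lambda>t u. \<Sum>i<d k. (THE c. (vs k ! i) *v u = c *s s) *s ((ws k ! i) *v t)"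
  have coeff: "(THE c. (vs k ! i) *v (\<Sum>j<d k. a j *s ((ws k ! j) *v s)) = c *s s) = a i"
    if "i < d k" for i a
    using dual_sum[OF k k that s(1), of a] s(2) by (auto simp: vector_mul_rcancel)
  define \<phi> where "\<phi> = ?\<phi> s'"
  have \<phi>: "\<phi> (\<Sum>j<d k. a j *s ((ws k ! j) *v s)) = (\<Sum>j<d k. a j *s ((ws k ! j) *v s'))" for a
    unfolding \<phi>_def by (rule sum.cong[OF refl]) (simp add: coeff)
  have inj: "inj_on \<phi> (W k s)"
  proof (rule inj_onI)
    fix u v assume "u \<in> W k s" "v \<in> W k s" and eq: "\<phi> u = \<phi> v"
    then obtain a b where ab: "u = (\<Sum>j<d k. a j *s ((ws k ! j) *v s))" "v = (\<Sum>j<d k. b j *s ((ws k ! j) *v s))"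
      by (auto simp: W_eq)
    have "a i = b i" if i: "i < d k" for i
    proof -
      have "a i *s s' = b i *s s'"
        using arg_cong[OF eq[unfolded ab \<phi>], of "\<lambda>u. (vs k ! i) *v u"]
        by (simp add: dual_sum[OF k k i s'(1)])
      then show ?thesis using s'(2) by (simp add: vector_mul_rcancel)
    qed
    then show "u = v" by (simp add: ab)
  qed
  have surj: "\<phi> ` W k s = W k s'"
  proof (rule Set.set_eqI)
    fix v
    have "v \<in> \<phi> ` W k s \<longleftrightarrow> (\<exists>a. v = \<phi> (\<Sum>j<d k. a j *s ((ws k ! j) *v s)))"
      by (auto simp: W_eq)
    then show "v \<in> \<phi> ` W k s \<longleftrightarrow> v \<in> W k s'" by (simp add: \<phi> W_eq)
  qed
  have add: "\<phi> (u + v) = \<phi> u + \<phi> v" if uv: "u \<in> W k s" "v \<in> W k s" for u v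
  proof -
    obtain a b where ab: "u = (\<Sum>j<d k. a j *s ((ws k ! j) *v s))" "v = (\<Sum>j<d k. b j *s ((ws k ! j) *v s))"
      using uv by (auto simp: W_eq)
    have "u + v = (\<Sum>j<d k. (a j + b j) *s ((ws k ! j) *v s))"
      by (simp add: ab vec.scale_left_distrib sum.distrib)
    then show ?thesis by (simp only: \<phi>) (simp add: ab \<phi> vec.scale_left_distrib sum.distrib)
  qed
  have scale: "\<phi> (c *s u) = c *s \<phi> u" if u: "u \<in> W k s" for c u
  proof -
    obtain a where a: "u = (\<Sum>j<d k. a j *s ((ws k ! j) *v s))" using u by (auto simp: W_eq)
    have "c *s u = (\<Sum>j<d k. (c * a j) *s ((ws k ! j) *v s))"
      by (simp add: a vec.scale_sum_right vector_smult_assoc)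
    then show ?thesis by (simp only: \<phi>) (simp add: a \<phi> vec.scale_sum_right vector_smult_assoc)
  qed
  have mult: "\<phi> (M *v u) = M *v \<phi> u" if u: "u \<in> W k s" and M: "M \<in> T" for M u
  proof -
    obtain a where a: "u = (\<Sum>j<d k. a j *s ((ws k ! j) *v s))" using u by (auto simp: W_eq)
    obtain e where e: "\<And>i s. i < d k \<Longrightarrow> s \<in> S k \<Longrightarrow>
       M *v ((ws k ! i) *v s) = (\<Sum>j<d k. e j i *s ((ws k ! j) *v s))"
      using closed[OF M k] by blast
    have *: "M *v (\<Sum>j<d k. a j *s ((ws k ! j) *v t)) = (\<Sum>j<d k. (\<Sum>i<d k. a i * e j i) *s ((ws k ! j) *v t))"
      if "t \<in> S k" for t
    proof -
      have "M *v (\<Sum>j<d k. a j *s ((ws k ! j) *v t)) = (\<Sum>i<d k. \<Sum>j<d k. (a i * e j i) *s ((ws k ! j) *v t))"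
        unfolding mult_vec_sum vector_scalar_commute
        by (rule sum.cong[OF refl]) (use e that in \<open>simp add: vec.scale_sum_right vector_smult_assoc\<close>)
      then show ?thesis by (subst (asm) sum.swap) (simp add: vec.scale_sum_left)
    qed
    show ?thesis unfolding a \<phi> *[OF s(1)] *[OF s'(1)] ..
  qed
  show ?thesis
    unfolding isomorphic_modules_def bij_betw_def
    using inj surj add scale mult by (intro exI[of _ \<phi>]) auto
qed

lemma proj_seed:
  assumes "k < N" "l < N" "s \<in> S l"
  shows "(vs k ! 0) *v s = (if k = l then s else 0)"
  using dual[OF assms(1,2) d_pos d_pos assms(3)] assms ws_0(2)[OF assms(2)] by simp

text \<open>An isomorphism commutes with \<open>vs k ! 0\<close>, which fixes the seed, so the image
  of the seed is fixed too. Having a nonzero fixed vector of \<open>vs k ! 0\<close> thus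
  distinguishes type \<open>k\<close> from the other types.\<close>

lemma proj_of_isomorphic:
  assumes "isomorphic_modules T (W k s) U" "k < N" "s \<in> S k" "s \<noteq> 0"
  obtains u where "u \<in> U" "u \<noteq> 0" "(vs k ! 0) *v u = u"
proof -
  obtain \<phi> where \<phi>: "bij_betw \<phi> (W k s) U" "\<And>c u. u \<in> W k s \<Longrightarrow> \<phi> (c *s u) = c *s \<phi> u"
    "\<And>M u. M \<in> T \<Longrightarrow> u \<in> W k s \<Longrightarrow> \<phi> (M *v u) = M *v \<phi> u"
    using assms(1) unfolding isomorphic_modules_def by blast
  note s = seed_in_W[OF assms(2), of s]
  have "\<phi> 0 = 0" using \<phi>(2)[OF s, of 0] by simp
  moreover have "0 \<in> W k s" by (rule vec.subspace_0[OF W_subspace])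
  ultimately have "\<phi> s \<noteq> 0"
    using \<phi>(1) s assms(4) by (metis bij_betw_iff_bijections)
  moreover have "(vs k ! 0) *v \<phi> s = \<phi> s"
    using \<phi>(3)[OF vs_T[OF assms(2) d_pos[OF assms(2)]] s] proj_seed assms by simp
  moreover have "\<phi> s \<in> U" using \<phi>(1) s by (auto simp: bij_betw_def)
  ultimately show ?thesis using that by blast
qed

lemma W_not_isomorphic:
  assumes "k < N" "l < N" "k \<noteq> l" "s \<in> S k" "s \<noteq> 0" "s' \<in> S l"
  shows "\<not> isomorphic_modules T (W k s) (W l s')"
proof
  assume "isomorphic_modules T (W k s) (W l s')"
  then obtain u where "u \<in> W l s'" "u \<noteq> 0" "(vs k ! 0) *v u = u"
    using proj_of_isomorphic assms by blast
  then show False using dual_W[of k l 0 s' u] assms d_pos by auto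
qed

text \<open>A word moves to the other argument as its adjoint, which stays in T. Inserting the
  self-adjoint \<open>vs k ! 0\<close>, which fixes \<open>s\<close>, leaves the inner product of
  \<open>s\<close> with a multiple of \<open>s'\<close>, or with 0 if the types differ.\<close>

lemma W_orthogonal:
  assumes "k < N" "l < N" "s \<in> S k" "s' \<in> S l" "k \<noteq> l \<or> herm s s' = 0" "u \<in> W k s" "w \<in> W l s'"
  shows "herm u w = 0"
proof -
  have "herm (ws k ! i *v s) w = 0" if i: "i < d k" for i
  proof -
    obtain M where M: "M \<in> T" "\<And>u w. herm ((ws k ! i) *v u) w = herm u (M *v w)"
      using adjoint_exists[OF ws_T] assms(1) i by blast
    have "M *v w \<in> W l s'" using is_moduleD(2)[OF W_module] M(1) assms by blast
    then obtain c where c: "(vs k ! 0) *v (M *v w) = (if k = l then c *s s' else 0)"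
      using dual_W[of k l 0 s'] assms d_pos by blast
    have "herm (ws k ! i *v s) w = herm ((vs k ! 0) *v s) (M *v w)"
      using M(2) proj_seed assms by simp
    also have "\<dots> = herm s (if k = l then c *s s' else 0)"
      using proj_symm[OF assms(1)] c by simp
    finally show ?thesis using assms(5) by (auto simp: herm_scale_right)
  qed
  moreover obtain c where "u = (\<Sum>i<d k. c i *s ((ws k ! i) *v s))" using assms by (auto simp: W_eq)
  ultimately show ?thesis by (simp add: herm_sum_left herm_scale_left)
qed

text \<open>The three components are the type, the position of the word and the number of the
  seed.\<close>

definition indices :: "(nat \<times> nat \<times> nat) set" where
  "indices = (SIGMA k:{..<N}. {..<d k} \<times> {..<length (ss k)})"

lemma finite_indices: "finite indices"
  by (simp add: indices_def)

lemma card_indices: "card indices = CARD('v)"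
  using total by (simp add: indices_def)

lemma seed_S: "a < length (ss k) \<Longrightarrow> ss k ! a \<in> S k"
  by (simp add: vec.span_base)

text \<open>The functional of an index applies the dual word and pairs the result with the seed;
  orthogonality of the seeds makes this family biorthogonal to the basis. The count
  \<open>total\<close> turns independence into spanning.\<close>

lemma basis_vectors:
  defines "b \<equiv> \<lambda>(k, i, a). (ws k ! i) *v (ss k ! a)"
  shows "inj_on b indices" "vec.independent (b ` indices)" "vec.span (b ` indices) = UNIV"
proof -
  define L where "L = (\<lambda>(k, i, a) u. herm ((vs k ! i) *v u) (ss k ! a))"
  note thms = vec.independent_of_functionals[where b = b and L = L, OF finite_indices]
  have "L p (u + v) = L p u + L p v" for p u v
    by (simp add: L_def split_beta matrix_vector_right_distrib herm_add_left)
  moreover have "L p (c *s u) = c * L p u" for p c u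
    by (simp add: L_def split_beta vector_scalar_commute herm_scale_left)
  moreover have "L p (b q) = 0" if pq: "p \<in> indices" "q \<in> indices" "p \<noteq> q" for p q
  proof -
    obtain k i a l j b where "p = (k, i, a)" "q = (l, j, b)" by (metis prod_cases3)
    then show ?thesis
      using pq seeds(3)[of k b a] by (auto simp: L_def b_def indices_def dual seed_S)
  qed
  moreover have "L p (b p) \<noteq> 0" if "p \<in> indices" for p
    using that seeds(1) by (auto simp: L_def b_def indices_def dual seed_S)
  ultimately show "inj_on b indices" "vec.independent (b ` indices)"
    using thms by blast+
  then show "vec.span (b ` indices) = UNIV"
    using spanning_of_independent card_indices by blast
qed

text \<open>Serves as an induction principle: a linear property of all vectors has to be checked
  only on words applied to seeds.\<close>

lemma word_span:
  assumes "\<And>k i s. k < N \<Longrightarrow> i < d k \<Longrightarrow> s \<in> S k \<Longrightarrow> (ws k ! i) *v s \<in> X" "vec.subspace X"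
  shows "X = UNIV"
proof -
  have "vec.span ((\<lambda>(k, i, a). (ws k ! i) *v (ss k ! a)) ` indices) \<subseteq> X"
    by (rule vec.span_minimal) (use assms seed_S in \<open>auto simp: indices_def\<close>)
  then show ?thesis using basis_vectors(3) by auto
qed

text \<open>On each vector of the basis a dual word returns a seed or 0. Together with
  \<open>proj_seed\<close>, the image of \<open>vs k ! 0\<close> is exactly
  \<open>S k\<close>.\<close>

lemma dual_in_S:
  assumes "k < N" "i < d k"
  shows "(vs k ! i) *v u \<in> S k"
proof -
  have "{u. (vs k ! i) *v u \<in> S k} = UNIV"
  proof (rule word_span)
    show "vec.subspace {u. (vs k ! i) *v u \<in> S k}"
      by (rule vec.subspaceI)
         (auto simp: matrix_vector_right_distrib vector_scalar_commute vec.span_add vec.span_scale vec.span_zero)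
  qed (use assms dual vec.span_zero in auto)
  then show ?thesis by blast
qed

text \<open>The products \<open>ws k ! i ** vs k ! i\<close> are the diagonal matrix units, and
  their sum is the identity.\<close>

lemma resolution: "(\<Sum>k<N. \<Sum>i<d k. ws k ! i *v (vs k ! i *v u)) = u"
proof -
  have "{u. (\<Sum>k<N. \<Sum>i<d k. ws k ! i *v (vs k ! i *v u)) = u} = UNIV" (is "{u. ?F u = u} = _")
  proof (rule word_span)
    show "vec.subspace {u. ?F u = u}"
      by (rule vec.subspaceI)
         (auto simp: matrix_vector_right_distrib vector_scalar_commute sum.distrib simp flip: vec.scale_sum_right)
    fix l j s assume *: "l < N" "j < d l" "s \<in> S l"
    have "?F (ws l ! j *v s) = (\<Sum>k<N. \<Sum>i<d k. if k = l \<and> i = j then ws k ! i *v s else 0)"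
      by (intro sum.cong refl) (use * dual in auto)
    also have "\<dots> = (\<Sum>k<N. if k = l then (\<Sum>i<d k. if i = j then ws k ! i *v s else 0) else 0)"
      by (intro sum.cong refl) auto
    finally show "ws l ! j *v s \<in> {u. ?F u = u}" using * by simp
  qed
  then show ?thesis by blast
qed

text \<open>Each summand isomorphic to \<open>W k s\<close> meets the seed space \<open>S k\<close>
  in one line. These lines are orthogonal and span \<open>S k\<close>, so their number is its
  dimension. Since the decomposition is arbitrary, this gives the uniqueness demanded by the
  definite description in \<open>module_multiplicity\<close>.\<close>

lemma multiplicity_of_decomposition:
  assumes k: "k < N" and s: "s \<in> S k" "s \<noteq> 0" and Ws: "irreducible_decomposition T Ws"
  shows "card {j. j < length Ws \<and> isomorphic_modules T (Ws ! j) (W k s)} = length (ss k)"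
proof -
  let ?P = "vs k ! 0" and ?n = "length Ws"
  let ?J = "{j. j < ?n \<and> isomorphic_modules T (Ws ! j) (W k s)}"
  note P_T = vs_T[OF k d_pos[OF k]]
  note P_S = dual_in_S[OF k d_pos[OF k]]
  have irr: "irreducible_module T (Ws ! j)" "is_module T (Ws ! j)" if "j < ?n" for j
    using Ws that by (auto simp: irreducible_decomposition_def irreducible_module_def)
  have orth: "herm u w = 0" if "i < ?n" "j < ?n" "i \<noteq> j" "u \<in> Ws ! i" "w \<in> Ws ! j" for i j u w
    using Ws that by (auto simp: irreducible_decomposition_def orthogonal_direct_sum_def)
  have eq: "Ws ! j = W k t" if j: "j < ?n" and t: "t \<in> Ws ! j" "t \<in> S k" "t \<noteq> 0" for j t
  proof -
    have "W k t \<subseteq> Ws ! j" by (rule S_module) (use irr j t k in auto)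
    moreover have "W k t \<noteq> {0}" using seed_in_W[OF k, of t] t by auto
    ultimately show ?thesis
      using irr(1)[OF j] W_module[OF k t(2)] unfolding irreducible_module_def by blast
  qed
  have ex: "\<exists>t. t \<in> Ws ! j \<and> t \<in> S k \<and> t \<noteq> 0" if j: "j \<in> ?J" for j
  proof -
    have "isomorphic_modules T (W k s) (Ws ! j)"
      using j irr(2) isomorphic_modules_sym by blast
    then obtain u where u: "u \<in> Ws ! j" "u \<noteq> 0" "?P *v u = u"
      using proj_of_isomorphic k s by blast
    then show ?thesis using P_S[of u] by auto
  qed
  \<comment> \<open>A generator of the line in which the summand meets the seed space.\<close>
  define t where "t j = (SOME t. t \<in> Ws ! j \<and> t \<in> S k \<and> t \<noteq> 0)" for j
  have t: "t j \<in> Ws ! j" "t j \<in> S k" "t j \<noteq> 0" if "j \<in> ?J" for j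
    using someI_ex[OF ex[OF that]] by (auto simp: t_def)
  have fin: "finite ?J" by simp
  have ind: "inj_on t ?J" "vec.independent (t ` ?J)"
  proof -
    have "herm (t j) (t i) = 0" if "i \<in> ?J" "j \<in> ?J" "i \<noteq> j" for i j
      using orth[of j i "t j" "t i"] t(1) that by auto
    then show "inj_on t ?J" "vec.independent (t ` ?J)"
      using vec.independent_of_functionals[where b = t and L = "\<lambda>j u. herm u (t j)", OF fin] t(3)
      by (simp_all add: herm_add_left herm_scale_left)
  qed
  have "vec.span (t ` ?J) = S k"
  proof
    show "vec.span (t ` ?J) \<subseteq> S k" by (rule vec.span_minimal) (use t in auto)
    show "S k \<subseteq> vec.span (t ` ?J)"
    proof
      fix r assume r: "r \<in> S k"
      obtain f where f: "f \<in> (\<Pi>\<^sub>E j\<in>{..<?n}. Ws ! j)" "r = (\<Sum>j<?n. f j)"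
        using Ws unfolding irreducible_decomposition_def orthogonal_direct_sum_def by blast
      \<comment> \<open>The projection fixes \<open>r\<close> and keeps each component of
        \<open>r\<close> inside its summand.\<close>
      have "r = ?P *v r" using proj_seed[OF k k r] by simp
      also have "\<dots> = (\<Sum>j<?n. ?P *v f j)" by (simp add: f mult_vec_sum)
      also have "\<dots> \<in> vec.span (t ` ?J)"
      proof (rule vec.span_sum)
        fix j assume j: "j \<in> {..<?n}"
        then have Pf: "?P *v f j \<in> Ws ! j" using is_moduleD(2)[OF irr(2) P_T] f by auto
        show "?P *v f j \<in> vec.span (t ` ?J)"
        proof (cases "?P *v f j = 0")
          case False
          \<comment> \<open>A nonzero projected component generates its summand, which therefore has
            type \<open>k\<close>; the component is then a multiple of the chosen
            \<open>t j\<close>.\<close>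
          have W: "Ws ! j = W k (?P *v f j)"
            by (rule eq) (use j Pf P_S False in auto)
          then have "j \<in> ?J" using W_isomorphic[OF k P_S False s] j by simp
          then have "Ws ! j = W k (t j)" using eq t j by auto
          moreover have "?P *v (?P *v f j) = ?P *v f j" using proj_seed[OF k k P_S] by simp
          ultimately obtain c where "?P *v f j = c *s t j"
            using dual_W[OF k k d_pos[OF k] t(2)[OF \<open>j \<in> ?J\<close>] Pf[unfolded \<open>Ws ! j = W k (t j)\<close>]] by auto
          then show ?thesis using \<open>j \<in> ?J\<close> by (auto intro: vec.span_scale vec.span_base)
        qed (simp add: vec.span_zero)
      qed
      finally show "r \<in> vec.span (t ` ?J)" .
    qed
  qed
  then have "vec.dim (S k) = card ?J"
    using vec.dim_span_eq_card_independent[OF ind(2)] card_image[OF ind(1)] by simp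
  moreover have "vec.dim (S k) = length (ss k)"
  proof -
    have "inj_on ((!) (ss k)) {..<length (ss k)}" "vec.independent ((!) (ss k) ` {..<length (ss k)})"
      using vec.independent_of_functionals[where b = "(!) (ss k)" and L = "\<lambda>j u. herm u (ss k ! j)" and I = "{..<length (ss k)}"]
        seeds(1,3)[OF k] by (simp_all add: herm_add_left herm_scale_left)
    moreover have "set (ss k) = (!) (ss k) ` {..<length (ss k)}" by (auto simp: in_set_conv_nth)
    ultimately show ?thesis
      using vec.dim_span_eq_card_independent by (metis card_image card_lessThan)
  qed
  ultimately show ?thesis by simp
qed

lemma multiplicity:
  assumes "k < N" "s \<in> S k" "s \<noteq> 0" "irreducible_decomposition T Ws"
  shows "module_multiplicity T (W k s) = length (ss k)"
  unfolding module_multiplicity_def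
  by (rule the_equality) (use assms multiplicity_of_decomposition[OF assms(1-3)] in auto)

text \<open>The products \<open>ws k ! i ** vs k ! j\<close> are matrix units. They are independent
  because \<open>L\<close> reads off a single matrix entry in a single type, and they span because
  multiplying \<open>M\<close> by the resolution of the identity expands it with the coefficients
  from \<open>closed\<close>.\<close>

lemma dim_algebra: "cmat.dim T = (\<Sum>k<N. (d k)\<^sup>2)"
proof -
  define I where "I = (SIGMA k:{..<N}. {..<d k} \<times> {..<d k})"
  define e where "e = (\<lambda>(k, i, j). ws k ! i ** vs k ! j)"
  define L where "L = (\<lambda>(k, i, j) M. herm ((vs k ! i) *v (M *v (ws k ! j *v (ss k ! 0)))) (ss k ! 0))"
  have finI: "finite I" by (simp add: I_def)
  have e_T: "e p \<in> T" if "p \<in> I" for p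
    using that T_closed(1) ws_T vs_T by (auto simp: I_def e_def)
  have seed: "ss k ! 0 \<in> S k" "ss k ! 0 \<noteq> 0" if "k < N" for k
    using that seeds(1,2) seed_S by auto
  have L: "L p (e q) = (if p = q then herm (ss (fst p) ! 0) (ss (fst p) ! 0) else 0)"
    if pq: "p \<in> I" "q \<in> I" for p q
  proof -
    obtain k i j l m n where "p = (k, i, j)" "q = (l, m, n)" by (metis prod_cases3)
    then show ?thesis
      using pq seed by (cases "k = l \<and> j = n") (auto simp: I_def L_def e_def dual simp flip: matrix_vector_mul_assoc)
  qed
  have ind: "inj_on e I" "cmat.independent (e ` I)"
  proof -
    have "L p (M + M') = L p M + L p M'" for p M M'
      by (simp add: L_def split_beta matrix_vector_mult_add_rdistrib matrix_vector_right_distrib herm_add_left)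
    moreover have "L p (matrix_scale c M) = c * L p M" for p c M
      by (simp add: L_def split_beta matrix_scale_mult_vec vector_scalar_commute herm_scale_left)
    moreover have "L p (e p) \<noteq> 0" if "p \<in> I" for p
      using L[OF that that] seed that by (auto simp: I_def)
    ultimately show "inj_on e I" "cmat.independent (e ` I)"
      using cmat.independent_of_functionals[OF finI, of L e] L by simp_all
  qed
  have span: "cmat.span (e ` I) = T"
  proof
    show "cmat.span (e ` I) \<subseteq> T"
      by (rule cmat.span_minimal) (use e_T T_closed(3) in auto)
    show "T \<subseteq> cmat.span (e ` I)"
    proof
      fix M assume M: "M \<in> T"
      define c where "c k = (SOME c. \<forall>i<d k. \<forall>s\<in>S k.
        M *v ((ws k ! i) *v s) = (\<Sum>j<d k. c j i *s ((ws k ! j) *v s)))" for k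
      have c: "M *v ((ws k ! i) *v s) = (\<Sum>j<d k. c k j i *s ((ws k ! j) *v s))"
        if "k < N" "i < d k" "s \<in> S k" for k i s
        using someI_ex[OF closed[OF M that(1)]] that(2,3) unfolding c_def by blast
      have "M = (\<Sum>k<N. \<Sum>i<d k. \<Sum>j<d k. matrix_scale (c k j i) (e (k, j, i)))" (is "M = ?M")
      proof (rule matrix_eqI)
        fix u
        have "M *v u = M *v (\<Sum>k<N. \<Sum>i<d k. ws k ! i *v (vs k ! i *v u))" by (simp add: resolution)
        also have "\<dots> = (\<Sum>k<N. \<Sum>i<d k. \<Sum>j<d k. c k j i *s (e (k, j, i) *v u))"
          unfolding mult_vec_sum
          by (intro sum.cong refl) (use c dual_in_S in \<open>auto simp: e_def simp flip: matrix_vector_mul_assoc\<close>)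
        also have "\<dots> = ?M *v u"
          by (simp add: sum_mult_vec matrix_scale_mult_vec)
        finally show "M *v u = ?M *v u" .
      qed
      also have "\<dots> \<in> cmat.span (e ` I)"
        by (intro cmat.span_sum cmat.span_scale cmat.span_base) (auto simp: I_def)
      finally show "M \<in> cmat.span (e ` I)" .
    qed
  qed
  have "cmat.dim T = card (e ` I)"
    using cmat.dim_span_eq_card_independent[OF ind(2)] span by simp
  also have "\<dots> = card I"
    by (rule card_image[OF ind(1)])
  also have "\<dots> = (\<Sum>k<N. (d k)\<^sup>2)"
    by (simp add: I_def power2_eq_square)
  finally show ?thesis .
qed

end

section \<open>Diagonalization and eigenspaces\<close>

text \<open>The columns of \<open>C\<close> are right eigenvectors and the rows of \<open>D\<close>
  left eigenvectors. Supplying the inverse \<open>D\<close> as a certificate reduces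
  diagonalizability to two matrix products.\<close>

definition diagonalization ::
    "complex list \<Rightarrow> complex Matrix.mat \<Rightarrow> complex Matrix.mat \<Rightarrow> complex Matrix.mat \<Rightarrow> bool" where
  "diagonalization es B C D \<longleftrightarrow> {B, C, D} \<subseteq> carrier_mat (length es) (length es) \<and>
     D * C = 1\<^sub>m (length es) \<and> B * C = C * mat_diag (length es) ((!) es)"

lemma diagonalizationD:
  assumes "diagonalization es B C D" "r < length es"
  shows "i < length es \<Longrightarrow> (\<Sum>j<length es. B $$ (i, j) * C $$ (j, r)) = C $$ (i, r) * es ! r"
    and "q < length es \<Longrightarrow> (\<Sum>j<length es. D $$ (q, j) * C $$ (j, r)) = (if q = r then 1 else 0)"
proof -
  have carrier: "dim_row B = length es" "dim_col B = length es" "dim_row C = length es"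
     "dim_col C = length es" "dim_row D = length es" "dim_col D = length es"
    using assms(1)[unfolded diagonalization_def, THEN conjunct1] by auto
  show "(\<Sum>j<length es. B $$ (i, j) * C $$ (j, r)) = C $$ (i, r) * es ! r" if i: "i < length es"
  proof -
    have "(\<Sum>j<length es. B $$ (i, j) * C $$ (j, r)) = (B * C) $$ (i, r)"
      using carrier assms(2) i by (simp add: scalar_prod_def atLeast0LessThan)
    also have "\<dots> = (C * mat_diag (length es) ((!) es)) $$ (i, r)"
      using assms(1) unfolding diagonalization_def by metis
    also have "\<dots> = C $$ (i, r) * es ! r"
      unfolding mat_diag_mult_right[OF carrier_matI[OF carrier(3,4)]] index_mat(1)[OF i assms(2)] split ..
    finally show ?thesis .
  qed
  show "(\<Sum>j<length es. D $$ (q, j) * C $$ (j, r)) = (if q = r then 1 else 0)" if q: "q < length es"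
  proof -
    have "(\<Sum>j<length es. D $$ (q, j) * C $$ (j, r)) = (D * C) $$ (q, r)"
      using carrier assms(2) q by (simp add: scalar_prod_def atLeast0LessThan)
    also have "\<dots> = 1\<^sub>m (length es) $$ (q, r)"
      using assms(1) unfolding diagonalization_def by metis
    finally show ?thesis using assms(2) q by simp
  qed
qed

lemma eigenvalue_list_of_diagonalization:
  assumes "diagonalization es B C D"
  shows "eigenvalue_list B es"
proof -
  let ?n = "length es"
  let ?E = "mat_diag ?n ((!) es)"
  have car: "B \<in> carrier_mat ?n ?n" "C \<in> carrier_mat ?n ?n" "D \<in> carrier_mat ?n ?n" "?E \<in> carrier_mat ?n ?n"
    using assms[unfolded diagonalization_def, THEN conjunct1] by simp_all
  have eq: "D * C = 1\<^sub>m ?n" "B * C = C * ?E"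
    using assms[unfolded diagonalization_def, THEN conjunct2] by simp_all
  have CD: "C * D = 1\<^sub>m ?n"
    by (rule mat_mult_left_right_inverse[OF car(3,2) eq(1)])
  have "B = B * (C * D)" using car by (simp add: CD)
  also have "\<dots> = B * C * D" by (rule assoc_mult_mat[OF car(1-3), symmetric])
  finally have B: "B = C * ?E * D" unfolding eq(2) .
  have "{B, ?E, C, D} \<subseteq> carrier_mat ?n ?n" using car by (simp only: insert_subset empty_subsetI)
  then have "similar_mat B ?E" using CD eq(1) B by (rule similar_matI)
  then have "char_poly B = char_poly ?E" by (rule char_poly_similar)
  also have "\<dots> = (\<Prod>a\<leftarrow>diag_mat ?E. [:- a, 1:])"
    by (rule char_poly_upper_triangular[OF car(4)]) (auto simp: mat_diag_def)
  also have "diag_mat ?E = es"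
    by (rule nth_equalityI) (simp_all add: diag_mat_def mat_diag_def)
  finally show ?thesis by (simp add: eigenvalue_list_def)
qed

lemma count_list_eq_card: "count_list xs x = card {i. i < length xs \<and> xs ! i = x}"
  by (simp add: count_list_eq_length_filter length_filter_conv_card conj_commute eq_commute)

context seed_system
begin

text \<open>The columns of \<open>C k\<close> combine the words into an eigenbasis of each copy of
  type \<open>k\<close>, and the rows of \<open>D k\<close> certify its independence. Each copy
  contributes the number of occurrences of \<open>\<theta>\<close> in \<open>es k\<close>, and there
  is one copy per listed seed.\<close>

lemma dim_eigenspace:
  assumes diag: "\<And>k. k < N \<Longrightarrow> diagonalization (es k) (B k) (C k) (D k)"
    and len: "\<And>k. k < N \<Longrightarrow> length (es k) = d k"
    and A: "\<And>k i s. k < N \<Longrightarrow> i < d k \<Longrightarrow> s \<in> S k \<Longrightarrow>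
       A *v ((ws k ! i) *v s) = (\<Sum>j<d k. B k $$ (j, i) *s ((ws k ! j) *v s))"
  shows "vec.dim (eigenspace A \<theta>) = (\<Sum>k<N. count_list (es k) \<theta> * length (ss k))"
proof -
  define b where "b = (\<lambda>(k, r, a). \<Sum>i<d k. C k $$ (i, r) *s ((ws k ! i) *v (ss k ! a)))"
  define L where "L = (\<lambda>(k, r, a) u. \<Sum>i<d k. D k $$ (r, i) * herm ((vs k ! i) *v u) (ss k ! a))"
  define \<theta>s where "\<theta>s = (\<lambda>(k, r, a :: nat). es k ! r)"
  have Lb: "L (k, r, a) (b (l, q, c)) = (if k = l \<and> r = q then herm (ss l ! c) (ss k ! a) else 0)"
    if "k < N" "l < N" "r < d k" "q < d l" "c < length (ss l)" for k l r q a c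
  proof -
    have "L (k, r, a) (b (l, q, c)) =
        (\<Sum>i<d k. if k = l then (D k $$ (r, i) * C k $$ (i, q)) * herm (ss l ! c) (ss k ! a) else 0)"
      unfolding L_def b_def split
      by (rule sum.cong[OF refl]) (use that in \<open>simp add: dual_sum seed_S herm_scale_left\<close>)
    then show ?thesis
      using diagonalizationD(2)[OF diag[OF that(1)], of q r] that len
      by (cases "k = l") (simp_all flip: sum_distrib_right)
  qed
  have fact1: "inj_on b indices \<and> vec.independent (b ` indices)"
  proof -
    have "L p (u + v) = L p u + L p v" for p u v
      by (simp add: L_def split_beta matrix_vector_right_distrib herm_add_left algebra_simps sum.distrib)
    moreover have "L p (c *s u) = c * L p u" for p c u
      by (simp add: L_def split_beta vector_scalar_commute herm_scale_left sum_distrib_left mult.left_commute)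
    moreover have "L p (b q) = 0" if pq: "p \<in> indices" "q \<in> indices" "p \<noteq> q" for p q
    proof -
      obtain k i a l j c where "p = (k, i, a)" "q = (l, j, c)" by (metis prod_cases3)
      then show ?thesis
        using pq seeds(3)[of k c a] by (auto simp: Lb indices_def)
    qed
    moreover have "L p (b p) \<noteq> 0" if "p \<in> indices" for p
      using that seeds(1) by (auto simp: Lb indices_def)
    ultimately show ?thesis
      using vec.independent_of_functionals[OF finite_indices, of L b] by blast
  qed
  have eig: "A *v b p = \<theta>s p *s b p" if p: "p \<in> indices" for p
  proof -
    obtain k r a where [simp]: "p = (k, r, a)" by (metis prod_cases3)
    have kra: "k < N" "r < d k" "a < length (ss k)" using p by (auto simp: indices_def)
    have "A *v b p = (\<Sum>i<d k. \<Sum>j<d k. (B k $$ (j, i) * C k $$ (i, r)) *s ((ws k ! j) *v (ss k ! a)))"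
      unfolding b_def by (simp add: mult_vec_sum vector_scalar_commute A kra seed_S vec.scale_sum_right
          vector_smult_assoc mult.commute)
    also have "\<dots> = (\<Sum>j<d k. (\<Sum>i<d k. B k $$ (j, i) * C k $$ (i, r)) *s ((ws k ! j) *v (ss k ! a)))"
      by (subst sum.swap) (simp add: vec.scale_sum_left)
    also have "\<dots> = (\<Sum>j<d k. (C k $$ (j, r) * es k ! r) *s ((ws k ! j) *v (ss k ! a)))"
      by (rule sum.cong[OF refl]) (use diagonalizationD(1)[OF diag[OF kra(1)], of r] kra len in simp)
    also have "\<dots> = \<theta>s p *s b p"
      by (simp add: \<theta>s_def b_def vec.scale_sum_right vector_smult_assoc mult.commute)
    finally show ?thesis .
  qed
  have "vec.dim (eigenspace A \<theta>) = card {p \<in> indices. \<theta>s p = \<theta>}"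
    using dim_eigenspace_of_eigenbasis[of indices b A \<theta>s] finite_indices card_indices eig fact1 by blast
  also have "{p \<in> indices. \<theta>s p = \<theta>} =
      (SIGMA k:{..<N}. {r. r < length (es k) \<and> es k ! r = \<theta>} \<times> {..<length (ss k)})"
    using len by (auto simp: indices_def \<theta>s_def)
  also have "card \<dots> = (\<Sum>k<N. count_list (es k) \<theta> * length (ss k))"
    by (simp add: count_list_eq_card)
  finally show ?thesis .
qed

lemma basis_of_W:
  assumes k: "k < N" and s: "s \<in> S k" "s \<noteq> 0"
  shows "basis_of (W k s) (map (\<lambda>w. w *v s) (ws k))"
proof -
  have "inj_on (\<lambda>i. ws k ! i *v s) {..<d k}" "vec.independent ((\<lambda>i. ws k ! i *v s) ` {..<d k})"
    using vec.independent_of_functionals[where b = "\<lambda>i. ws k ! i *v s" and L = "\<lambda>i u. herm (vs k ! i *v u) s"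
        and I = "{..<d k}"] dual[OF k k _ _ s(1)] s
    by (simp_all add: matrix_vector_right_distrib vector_scalar_commute herm_add_left herm_scale_left)
  moreover have "set (map (\<lambda>w. w *v s) (ws k)) = (\<lambda>i. ws k ! i *v s) ` {..<d k}"
    by (force simp: in_set_conv_nth)
  ultimately show ?thesis
    by (auto simp: basis_of_def W_def distinct_conv_nth inj_on_def)
qed

end

lemma eigenspace_nonzero_iff: "eigenspace M \<theta> \<noteq> {0} \<longleftrightarrow> vec.dim (eigenspace M \<theta>) \<noteq> 0"
proof -
  have "0 \<in> eigenspace M \<theta>" by (simp add: eigenspace_def)
  then show ?thesis by (auto simp: vec.dim_eq_0 subset_singleton_iff)
qed

section \<open>Invariants of a module with a pure basis\<close>

lemma Estar_mult_vec: "(Estar adj x i *v u) $ y = (if gdist adj x y = i then u $ y else 0)"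
proof -
  have "(Estar adj x i *v u) $ y = (\<Sum>z\<in>UNIV. if y = z then (if gdist adj x y = i then u $ y else 0) else 0)"
    unfolding Estar_def matrix_vector_mult_def vec_lambda_beta by (rule sum.cong) auto
  then show ?thesis by simp
qed

lemma pure_with_support_iff:
  "pure_with_support adj x i u \<longleftrightarrow> u \<noteq> 0 \<and> Estar adj x i *v u = u"
proof -
  have "Estar adj x i *v (Estar adj x i *v v) = Estar adj x i *v v" for v
    by (simp add: vec_eq_iff Estar_mult_vec)
  then show ?thesis unfolding pure_with_support_def by (auto intro: rangeI) (metis rangeI)
qed

lemma Estar_pure:
  assumes "pure_with_support adj x i u"
  shows "Estar adj x n *v u = (if n = i then u else 0)"
  using assms by (auto simp: pure_with_support_iff vec_eq_iff Estar_mult_vec) metis+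

context
  fixes adj :: "'v::finite graph" and x :: 'v and W bs sups
  assumes basis: "basis_of W bs"
    and pure: "list_all2 (pure_with_support adj x) sups bs"
begin

lemma length_sups: "length sups = length bs"
  using pure by (rule list_all2_lengthD)

lemma Estar_basis: "i < length bs \<Longrightarrow> Estar adj x n *v (bs ! i) = (if n = sups ! i then bs ! i else 0)"
  using Estar_pure list_all2_nthD2[OF pure] by blast

lemma Estar_image: "(*v) (Estar adj x n) ` W = vec.span ((!) bs ` {i. i < length bs \<and> sups ! i = n})"
proof -
  have "W = vec.span ((!) bs ` {..<length bs})"
    using basis by (auto simp: basis_of_def set_conv_nth intro!: arg_cong[where f = vec.span])
  then have "(*v) (Estar adj x n) ` W = vec.span ((*v) (Estar adj x n) ` (!) bs ` {..<length bs})"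
    using vec.linear_span_image[OF matrix_vector_mul_linear_gen] by metis
  \<comment> \<open>Basis vectors of another support are sent to 0; removing 0 from both generating
    sets makes them equal.\<close>
  also have "\<dots> = vec.span ((*v) (Estar adj x n) ` (!) bs ` {..<length bs} - {0})"
    by (rule vec.span_delete_0[symmetric])
  also have "(*v) (Estar adj x n) ` (!) bs ` {..<length bs} - {0} = (!) bs ` {i. i < length bs \<and> sups ! i = n} - {0}"
    by (auto simp: Estar_basis image_iff split: if_splits)
  also have "vec.span \<dots> = vec.span ((!) bs ` {i. i < length bs \<and> sups ! i = n})"
    by (rule vec.span_delete_0)
  finally show ?thesis .
qed

lemma dim_Estar_image: "vec.dim ((*v) (Estar adj x n) ` W) = count_list sups n"
proof -
  let ?I = "{i. i < length bs \<and> sups ! i = n}"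
  have "vec.independent ((!) bs ` ?I)"
    by (rule vec.independent_mono[of "set bs"]) (use basis in \<open>auto simp: basis_of_def\<close>)
  moreover have "inj_on ((!) bs) ?I"
    using basis by (auto simp: basis_of_def inj_on_def nth_eq_iff_index_eq)
  ultimately show ?thesis
    unfolding Estar_image count_list_eq_card
    by (simp add: vec.dim_eq_card_independent card_image length_sups)
qed

lemma module_support_eq:
  assumes "set sups \<subseteq> {..gdiam adj}"
  shows "module_support adj x W = set sups"
proof -
  have "0 \<in> (*v) (Estar adj x n) ` W" for n
    using basis by (auto simp: basis_of_def vec.span_zero intro!: image_eqI[of _ _ 0])
  then have "(*v) (Estar adj x n) ` W \<noteq> {0} \<longleftrightarrow> vec.dim ((*v) (Estar adj x n) ` W) \<noteq> 0" for n
    by (auto simp: vec.dim_eq_0 subset_singleton_iff)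
  then show ?thesis
    using assms by (auto simp: module_support_def dim_Estar_image count_list_0_iff)
qed

lemma dim_of_basis: "vec.dim W = length bs"
  using basis vec.dim_span_eq_card_independent distinct_card by (fastforce simp: basis_of_def)

end

lemma summand_dataI:
  assumes basis: "basis_of W bs"
    and pure: "list_all2 (pure_with_support adj x) sups bs"
    and sups: "sorted sups" "set sups \<subseteq> {..gdiam adj}"
    and "r = Min (set sups)" "\<delta> = card (set sups) - 1" "sh = map (count_list sups) [r..<r + \<delta> + 1]"
      "d = length bs"
    and "module_multiplicity (terwilliger_algebra adj x) W = m"
    and "represents (adjacency_matrix adj) bs (mat_of_rows_list d Brows)"
    and "eigenvalue_list (mat_of_rows_list d Brows) es"
  shows "summand_data adj x W r m d \<delta> sh bs Brows es"
  unfolding summand_data_def shape_def endpoint_def module_diameter_def pure_basis_def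
  using assms module_support_eq[OF basis pure sups(2)]
  by (auto simp: dim_Estar_image[OF basis pure] dim_of_basis[OF basis pure])

text \<open>The support \<open>i\<close> of the first basis vector does not recur, so the part of
  \<open>W\<close> at distance \<open>i\<close> is the line through that vector.\<close>

lemma seedI:
  assumes basis: "basis_of W (\<nu> # bs)"
    and pure: "list_all2 (pure_with_support adj x) (i # sups) (\<nu> # bs)"
    and sups: "sorted (i # sups)" "i \<notin> set sups" "set (i # sups) \<subseteq> {..gdiam adj}"
    and cs: "map (\<lambda>j. \<nu> $ ord j) [1..<Suc n] = cs"
  shows "seed adj x W i ord n \<nu> cs"
proof -
  have "{j. j < length (\<nu> # bs) \<and> (i # sups) ! j = i} = {0}"
    using sups(2) length_sups[OF basis pure] by (fastforce simp: nth_Cons in_set_conv_nth split: nat.splits)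
  then have img: "(*v) (Estar adj x i) ` W = vec.span {\<nu>}"
    using Estar_image[OF basis pure, of i] by simp
  moreover have "vec.dim ((*v) (Estar adj x i) ` W) = 1"
    using dim_Estar_image[OF basis pure, of i] sups(2) by (simp add: count_notin)
  moreover have "Min (set (i # sups)) = i"
    using sups(1) by (intro Min_eqI) auto
  ultimately show ?thesis
    using module_support_eq[OF basis pure sups(3)] pure cs
    by (auto simp: seed_def endpoint_def)
qed

section \<open>Distances in the Coxeter graph\<close>

locale coxeter =
  fixes adj :: "'v::finite graph"
  assumes coxeter: "coxeter_graph adj"
begin

abbreviation dst :: "'v \<Rightarrow> 'v \<Rightarrow> nat" where "dst \<equiv> gdist adj"

lemma adj_sym: "adj a b \<Longrightarrow> adj b a"
  and adj_irrefl: "\<not> adj a a"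
  and connected: "adj\<^sup>*\<^sup>* a b"
  using coxeter by (auto simp: coxeter_graph_def distance_regular_def simple_connected_graph_def
      dest: sympD irreflpD)

lemma relpow_dist: "(adj ^^ dst a b) a b"
proof -
  obtain n where "(adj ^^ n) a b" using connected rtranclp_imp_relpowp by metis
  then show ?thesis unfolding gdist_def by (rule LeastI)
qed

lemma dist_le: "(adj ^^ n) a b \<Longrightarrow> dst a b \<le> n"
  unfolding gdist_def by (rule Least_le)

lemma dist_eq_0 [simp]: "dst a b = 0 \<longleftrightarrow> a = b"
  using relpow_dist[of a b] dist_le[of 0 a b] by auto

lemma dist_self [simp]: "dst a a = 0"
  by simp

lemma relpow_sym: "(adj ^^ n) a b \<Longrightarrow> (adj ^^ n) b a"
proof (induction n arbitrary: b)
  case (Suc n)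
  then obtain c where "(adj ^^ n) a c" "adj c b" by auto
  then show ?case using Suc.IH adj_sym by (meson relpowp_Suc_I2)
qed simp

lemma dist_commute: "dst a b = dst b a"
  by (meson dist_le le_antisym relpow_dist relpow_sym)

lemma dist_step: "adj b c \<Longrightarrow> dst a c \<le> Suc (dst a b)"
  by (meson dist_le relpow_dist relpowp_Suc_I)

lemma dist_steps:
  assumes "adj b c"
  shows "dst a c = dst a b \<or> dst a c = Suc (dst a b) \<or> dst a b = Suc (dst a c)"
  using dist_step[OF assms, of a] dist_step[OF adj_sym[OF assms], of a] by linarith

lemma dist_pred:
  assumes "dst a b = Suc n"
  obtains c where "adj b c" "dst a c = n"
proof -
  obtain c where c: "(adj ^^ n) a c" "adj c b" using relpow_dist[of a b] assms by auto
  then have "dst a c = n" using dist_le[OF c(1)] dist_step[OF c(2), of a] assms by linarith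
  then show ?thesis using that c adj_sym by blast
qed

lemma dist_eq_1 [simp]: "dst a b = Suc 0 \<longleftrightarrow> adj a b"
proof
  show "adj a b" if "dst a b = Suc 0" using relpow_dist[of a b] that by auto
  show "dst a b = Suc 0" if "adj a b"
    using dist_le[of 1 a b] that adj_irrefl dist_eq_0[of a b]
    by (metis One_nat_def le_Suc_eq le_zero_eq relpowp_1)
qed

lemma gdiam: "gdiam adj = 4"
proof -
  have "length (fst (intersection_array adj)) = 4"
    using coxeter by (simp add: coxeter_graph_def)
  then show ?thesis by (simp add: intersection_array_def)
qed

lemma dist_le_4: "dst a b \<le> 4"
proof -
  have "{dst y z | y z. True} = (\<lambda>(y, z). dst y z) ` UNIV" by force
  then have "dst a b \<le> Max {dst y z | y z. True}"
    by (intro Max_ge) auto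
  then show ?thesis using gdiam by (simp add: gdiam_def)
qed

lemma intersection_array_nth:
  "i < 4 \<Longrightarrow> intersection_number adj i 1 (i + 1) = [3, 2, 2, 1] ! i"
  "i < 4 \<Longrightarrow> intersection_number adj (i + 1) 1 i = [1, 1, 1, 2] ! i"
proof -
  have "map (\<lambda>i. intersection_number adj i 1 (i + 1)) [0..<4] = [3, 2, 2, 1]"
    "map (\<lambda>i. intersection_number adj i 1 (i - 1)) [1..<5] = [1, 1, 1, 2]"
    using coxeter by (auto simp: coxeter_graph_def intersection_array_def gdiam)
  then show "i < 4 \<Longrightarrow> intersection_number adj i 1 (i + 1) = [3, 2, 2, 1] ! i"
    "i < 4 \<Longrightarrow> intersection_number adj (i + 1) 1 i = [1, 1, 1, 2] ! i"
    by (auto simp: upt_rec less_Suc_eq numeral_eq_Suc)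
qed

lemma card_common:
  assumes "dst r v = h" "j \<le> 4"
  shows "card {w. adj v w \<and> dst r w = j} = intersection_number adj h 1 j"
proof -
  have reg: "\<exists>p. \<forall>y z. dst y z = h \<longrightarrow> card (Gam adj 1 y \<inter> Gam adj j z) = p"
    using coxeter assms dist_le_4[of r v] gdiam by (simp add: coxeter_graph_def distance_regular_def)
  then obtain p where p: "\<And>y z. dst y z = h \<Longrightarrow> card (Gam adj 1 y \<inter> Gam adj j z) = p" by blast
  have h: "dst v r = h" using assms dist_commute by simp
  have "intersection_number adj h 1 j = p"
    unfolding intersection_number_def by (rule the_equality) (use p h in auto)
  moreover have "Gam adj 1 v \<inter> Gam adj j r = {w. adj v w \<and> dst r w = j}"
    by (auto simp: Gam_def)
  ultimately show ?thesis using p[OF h] by simp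
qed

lemma card_farther: "dst r v = i \<Longrightarrow> i < 4 \<Longrightarrow> card {w. adj v w \<and> dst r w = i + 1} = [3, 2, 2, 1] ! i"
  using card_common[of r v i "i + 1"] intersection_array_nth(1)[of i] by simp

lemma card_closer: "dst r v = i + 1 \<Longrightarrow> i < 4 \<Longrightarrow> card {w. adj v w \<and> dst r w = i} = [1, 1, 1, 2] ! i"
  using card_common[of r v "i + 1" i] intersection_array_nth(2)[of i] by simp

lemma degree: "card {w. adj v w} = 3"
proof -
  have "{w. adj v w \<and> dst v w = 0 + 1} = {w. adj v w}" by auto
  then show ?thesis using card_farther[of v v 0] by simp
qed

definition nbhd :: "'v \<Rightarrow> 'v \<Rightarrow> 'v \<Rightarrow> 'v \<Rightarrow> bool" where
  "nbhd v a b c \<longleftrightarrow> a \<noteq> b \<and> a \<noteq> c \<and> b \<noteq> c \<and> (\<forall>w. adj v w \<longleftrightarrow> w = a \<or> w = b \<or> w = c)"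

lemma nbhd3:
  assumes "adj v a" "adj v b" "adj v c" "a \<noteq> b" "a \<noteq> c" "b \<noteq> c"
  shows "nbhd v a b c"
proof -
  have "{a, b, c} = {w. adj v w}"
    by (rule card_subset_eq) (use assms degree[of v] in auto)
  then show ?thesis using assms unfolding nbhd_def by blast
qed

lemma nbhd2:
  assumes "adj v a" "adj v b" "a \<noteq> b"
  obtains c where "nbhd v a b c"
proof -
  have "\<not> {w. adj v w} \<subseteq> {a, b}"
    using card_mono[of "{a, b}" "{w. adj v w}"] degree[of v] assms by auto
  then show ?thesis using that nbhd3 assms by blast
qed

lemma nbhd1:
  assumes "adj v a"
  obtains b c where "nbhd v a b c"
proof -
  have "\<not> {w. adj v w} \<subseteq> {a}"
    using card_mono[of "{a}" "{w. adj v w}"] degree[of v] by auto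
  then show ?thesis using that nbhd2 assms by blast
qed

lemma nbhdD: "nbhd v a b c \<Longrightarrow> adj v a" "nbhd v a b c \<Longrightarrow> adj v b" "nbhd v a b c \<Longrightarrow> adj v c"
  "nbhd v a b c \<Longrightarrow> adj v w \<Longrightarrow> w = a \<or> w = b \<or> w = c"
  "nbhd v a b c \<Longrightarrow> a \<noteq> b" "nbhd v a b c \<Longrightarrow> a \<noteq> c" "nbhd v a b c \<Longrightarrow> b \<noteq> c"
  by (auto simp: nbhd_def)

lemma nbhd_rotate: "nbhd v a b c \<Longrightarrow> nbhd v b c a" and nbhd_swap: "nbhd v a b c \<Longrightarrow> nbhd v a c b"
  by (auto simp: nbhd_def)

text \<open>This is c_1 = c_2 = c_3 = 1; the bound on \<open>i\<close> excludes c_4 = 2.\<close>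

lemma unique_closer:
  assumes "dst r v = Suc i" "i < 3" "adj v a" "dst r a = i" "adj v b" "dst r b = i"
  shows "a = b"
proof -
  have "card {w. adj v w \<and> dst r w = i} = 1"
    using card_closer[of r v i] assms(1,2) by (cases i; cases "i - 1") (auto simp: numeral_3_eq_3 less_Suc_eq)
  then obtain c where "{w. adj v w \<and> dst r w = i} = {c}" by (auto simp: card_1_singleton_iff)
  moreover have "a \<in> {w. adj v w \<and> dst r w = i}" "b \<in> {w. adj v w \<and> dst r w = i}"
    using assms by simp_all
  ultimately show ?thesis by simp
qed

text \<open>a_1 = 0: the b_1 = 2 farther neighbours and \<open>r\<close> exhaust the valency
  3.\<close>

lemma dist_cases_1:
  assumes "adj r v" "adj v w" "w \<noteq> r"
  shows "dst r w = 2"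
proof -
  let ?F = "{w. adj v w \<and> dst r w = 2}"
  have "card ?F = 2" using card_farther[of r v 1] assms by (simp add: numeral_2_eq_2)
  moreover have "insert r ?F \<subseteq> {w. adj v w}" using assms adj_sym by auto
  moreover have "r \<notin> ?F" by simp
  ultimately have "insert r ?F = {w. adj v w}"
    by (intro card_subset_eq) (use degree[of v] in simp_all)
  then show ?thesis using assms by blast
qed

text \<open>a_2 = 0: c_2 + b_2 = 1 + 2 is already the valency.\<close>

lemma dist_cases_2:
  assumes "dst r v = 2" "adj v w"
  shows "dst r w = 1 \<or> dst r w = 3"
proof -
  let ?F = "{w. adj v w \<and> dst r w = 3}" and ?C = "{w. adj v w \<and> dst r w = 1}"
  have "card ?F = 2" "card ?C = 1"
    using card_farther[of r v 2] card_closer[of r v 1] assms by (simp_all add: numeral_3_eq_3)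
  moreover have "?F \<inter> ?C = {}" by (simp only: disjoint_iff mem_Collect_eq) linarith
  ultimately have "card (?F \<union> ?C) = 3" by (subst card_Un_disjoint) simp_all
  then have "?F \<union> ?C = {w. adj v w}"
    by (intro card_subset_eq) (use degree[of v] in auto)
  then show ?thesis using assms by blast
qed

text \<open>c_3 = a_3 = b_3 = 1. Most later arguments place two neighbours on two of these levels
  and conclude that the third neighbour is on the remaining one.\<close>

lemma nbhd_dist_3:
  assumes "dst r v = 3"
  obtains a b c where "nbhd v a b c" "dst r a = 2" "dst r b = 3" "dst r c = 4"
proof -
  have "card {w. adj v w \<and> dst r w = 4} = 1" "card {w. adj v w \<and> dst r w = 2} = 1"
    using card_farther[of r v 3] card_closer[of r v 2] assms by simp_all
  then obtain a c where ac: "{w. adj v w \<and> dst r w = 2} = {a}" "{w. adj v w \<and> dst r w = 4} = {c}"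
    by (auto simp: card_1_singleton_iff)
  then have "a \<noteq> c" "adj v a" "adj v c" by force+
  then obtain b where b: "nbhd v a c b" using nbhd2 by metis
  have "b \<notin> {w. adj v w \<and> dst r w = 2}" "b \<notin> {w. adj v w \<and> dst r w = 4}"
    unfolding ac using nbhdD(6,7)[OF b] by auto
  then have "dst r b = 3"
    using dist_steps[of v b r] nbhdD(3)[OF b] assms by auto
  then show ?thesis using that[of a b c] ac b nbhd_swap by blast
qed

text \<open>c_4 = 2, and since the diameter is 4 the remaining neighbour gives a_4 = 1.\<close>

lemma nbhd_dist_4:
  assumes "dst r v = 4"
  obtains a b c where "nbhd v a b c" "dst r a = 3" "dst r b = 3" "dst r c = 4"
proof -
  have "card {w. adj v w \<and> dst r w = 3} = 2"
    using card_closer[of r v 3] assms by simp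
  then obtain a b where ab: "{w. adj v w \<and> dst r w = 3} = {a, b}" "a \<noteq> b"
    by (auto simp: card_2_iff)
  then have "adj v a" "adj v b" by auto
  then obtain c where c: "nbhd v a b c" using ab(2) nbhd2 by metis
  have "c \<notin> {w. adj v w \<and> dst r w = 3}"
    unfolding ab using nbhdD(6,7)[OF c] by auto
  then have "dst r c \<noteq> 3" using nbhdD(3)[OF c] by simp
  then have "dst r c = 4"
    using dist_steps[of v c r] dist_le_4[of r c] nbhdD[OF c] assms by auto
  then show ?thesis using that[of a b c] ab c by blast
qed

lemma unique_level_3:
  "dst r v = 3 \<Longrightarrow> adj v a \<Longrightarrow> dst r a = i \<Longrightarrow> adj v b \<Longrightarrow> dst r b = i \<Longrightarrow> a = b"
  by (erule nbhd_dist_3) (auto simp: nbhd_def)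

lemma unique_level_4:
  "dst r v = 4 \<Longrightarrow> adj v a \<Longrightarrow> dst r a = 4 \<Longrightarrow> adj v b \<Longrightarrow> dst r b = 4 \<Longrightarrow> a = b"
  by (erule nbhd_dist_4) (auto simp: nbhd_def)

lemma dist_path_2: "adj a b \<Longrightarrow> adj b c \<Longrightarrow> a \<noteq> c \<Longrightarrow> dst a c = 2"
  using dist_cases_1 by blast

lemma dist_path_3:
  assumes "adj a b" "adj b c" "adj c e" "a \<noteq> c" "b \<noteq> e"
  shows "dst a e = 3"
proof -
  have "dst a c = 2" using dist_path_2 assms by blast
  moreover have "dst a e \<noteq> 1"
  proof
    assume "dst a e = 1"
    then have "b = e"
      using unique_closer[of a c 1 b e] \<open>dst a c = 2\<close> assms adj_sym by (simp add: numeral_2_eq_2)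
    then show False using assms by simp
  qed
  ultimately show ?thesis using dist_cases_2[of a c e] assms by blast
qed

section \<open>Girth at least seven, and heptagons on paths of length three\<close>

lemma no_cycle_3: "adj a b \<Longrightarrow> adj b c \<Longrightarrow> adj c a \<Longrightarrow> False"
  using dist_path_2[of a b c] adj_sym adj_irrefl dist_eq_1[of a c] by (metis One_nat_def Suc_1 n_not_Suc_n)

lemma no_cycle_4: "adj a b \<Longrightarrow> adj b c \<Longrightarrow> adj c e \<Longrightarrow> adj e a \<Longrightarrow> a \<noteq> c \<Longrightarrow> b \<noteq> e \<Longrightarrow> False"
  using unique_closer[of a c 1 b e] dist_path_2[of a b c] adj_sym by (simp add: numeral_2_eq_2)

lemma no_cycle_5:
  assumes "adj a b" "adj b c" "adj c e" "adj e f" "adj f a" "a \<noteq> c" "b \<noteq> e"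
  shows False
proof -
  have "dst a e = 3" using dist_path_3 assms by blast
  moreover have "dst a e \<le> 2"
    using dist_step[of f e a] dist_eq_1[of a f] adj_sym assms by (metis numeral_2_eq_2)
  ultimately show False by simp
qed

text \<open>Opposite vertices of a hexagon have distance 3, and one would have two neighbours at
  distance 2 from the other, against c_3 = 1.\<close>

lemma no_cycle_6:
  assumes "adj a b" "adj b c" "adj c e" "adj e f" "adj f g" "adj g a" "a \<noteq> c" "b \<noteq> e" "a \<noteq> f" "c \<noteq> f"
  shows False
proof -
  have "dst a e = 3" "dst a c = 2" "dst a f = 2"
    using dist_path_3[of a b c e] dist_path_2[of a b c] dist_path_2[of a g f] assms adj_sym by blast+
  then show False using unique_level_3[of a e c 2 f] assms adj_sym by blast
qed

text \<open>Since a_3 = 1, \<open>e\<close> has a neighbour \<open>f\<close> at distance 3 from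
  \<open>a\<close>; a shortest path from \<open>f\<close> back to \<open>a\<close> closes the
  heptagon. It cannot end through \<open>b\<close>, because that would create a pentagon.\<close>

lemma heptagon:
  assumes "adj a b" "adj b c" "adj c e" "a \<noteq> c" "b \<noteq> e"
  obtains f g h where "adj e f" "adj f g" "adj g h" "adj h a" "f \<noteq> c" "g \<noteq> e" "h \<noteq> b" "h \<noteq> f" "g \<noteq> a"
    "dst a f = 3"
proof -
  have ae: "dst a e = 3" using dist_path_3 assms by blast
  then obtain f where f: "adj e f" "dst a f = 3" by (metis nbhd_dist_3 nbhdD(2))
  obtain g where g: "adj f g" "dst a g = 2" using dist_pred[of a f 2] f by auto
  obtain h where h: "adj g h" "dst a h = 1" using dist_pred[of a g 1] g by auto
  have "f \<noteq> c" using dist_path_2[of a b c] assms f by auto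
  moreover have "h \<noteq> b"
  proof
    assume "h = b"
    then show False using no_cycle_5[of b c e f g] \<open>f \<noteq> c\<close> assms f g h adj_sym by blast
  qed
  ultimately show ?thesis
    using that[of f g h] f g h ae adj_sym[of a h] dist_eq_1[of a h] dist_eq_1[of a f]
      dist_self[of a] by (metis One_nat_def num.distinct(3,5) numeral_eq_iff numeral_eq_one_iff zero_neq_numeral)
qed

end

section \<open>Uniqueness of the Coxeter graph\<close>

text \<open>
  Label 0 is the base vertex \<open>x\<close>; labels 1--3, 4--9 and 10--21 are \<open>\<Gamma>\<^sub>1(x)\<close>, \<open>\<Gamma>\<^sub>2(x)\<close> and \<open>\<Gamma>\<^sub>3(x)\<close> in the
  order \<open>y\<^sub>1, \<dots>, y\<^sub>6\<close> and \<open>z\<^sub>1, \<dots>, z\<^sub>1\<^sub>2\<close> of the theorem; labels 22--27 are \<open>\<Gamma>\<^sub>4(x)\<close>.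
\<close>

definition neighbours :: "nat list list" where
  "neighbours =
    [[1, 2, 3],
     [0, 4, 5], [0, 6, 7], [0, 8, 9],
     [1, 10, 11], [1, 12, 13], [2, 14, 15], [2, 16, 17], [3, 18, 19], [3, 20, 21],
     [4, 20, 26], [4, 16, 22], [5, 18, 23], [5, 14, 25], [6, 13, 24], [6, 19, 26],
     [7, 11, 27], [7, 21, 23], [8, 12, 27], [8, 15, 22], [9, 10, 24], [9, 17, 25],
     [11, 19, 25], [12, 17, 26], [14, 20, 27], [13, 21, 22], [10, 15, 23], [16, 18, 24]]"

definition labelling :: "'v::finite graph \<Rightarrow> (nat \<Rightarrow> 'v) \<Rightarrow> bool" where
  "labelling adj p \<longleftrightarrow> bij_betw p {..<28} UNIV \<and> (\<forall>i<28. {w. adj (p i) w} = p ` set (neighbours ! i))"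

context coxeter
begin

text \<open>
  \<open>A\<^sub>i\<close> is a child of \<open>u\<^sub>i\<close>; its own children are \<open>a\<^sub>ip\<close>, matched inside \<open>\<Gamma>\<^sub>3(x)\<close> to a descendant of the next
  \<open>u\<^sub>i\<close> in cyclic order, and \<open>a\<^sub>im\<close>, matched to a descendant of the previous one.
\<close>

definition triangle where
  "triangle x u1 u2 u3 A1 A2 A3 a1p a1m a2p a2m a3p a3m \<longleftrightarrow> nbhd x u1 u2 u3 \<and>
     adj u1 A1 \<and> adj u2 A2 \<and> adj u3 A3 \<and> A1 \<noteq> x \<and> A2 \<noteq> x \<and> A3 \<noteq> x \<and>
     nbhd A1 u1 a1p a1m \<and> nbhd A2 u2 a2p a2m \<and> nbhd A3 u3 a3p a3m \<and>
     adj a1p a2m \<and> adj a2p a3m \<and> adj a3p a1m"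

lemma triangle_rotate:
  "triangle x u1 u2 u3 A1 A2 A3 a1p a1m a2p a2m a3p a3m \<Longrightarrow>
   triangle x u2 u3 u1 A2 A3 A1 a2p a2m a3p a3m a1p a1m"
  using nbhd_rotate by (auto simp: triangle_def)

text \<open>In the heptagon x, u, y, z, z', y', u' the vertex \<open>z'\<close> has distance 3 from
  \<open>u\<close>. Its neighbours \<open>z\<close> and \<open>y'\<close> have distances 2 and 3,
  which leaves only distance 4 for the third neighbour \<open>t\<close>.\<close>

lemma dist_top:
  assumes "adj x u" "adj x u'" "u \<noteq> u'" "adj u y" "y \<noteq> x" "adj y z" "z \<noteq> u" "adj z z'" "z' \<noteq> y"
    "adj z' y'" "adj y' u'" "y' \<noteq> x" "adj z' t" "t \<noteq> z" "t \<noteq> y'"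
  shows "dst u t = 4"
proof -
  have "dst u z = 2" "dst u z' = 3" "dst u y' = 3"
    using dist_path_2[of u y z] dist_path_3[of u y z z'] dist_path_3[of u x u' y'] assms adj_sym by blast+
  then have "dst u t \<noteq> 2" "dst u t \<noteq> 3"
    using unique_level_3[of u z'] assms adj_sym by blast+
  then show ?thesis
    using \<open>dst u z' = 3\<close> assms(13) by (metis nbhd_dist_3 nbhdD(4))
qed

lemma branches_differ:
  "adj x u \<Longrightarrow> adj x u' \<Longrightarrow> u \<noteq> u' \<Longrightarrow> adj u y \<Longrightarrow> adj u' y \<Longrightarrow> y = x"
  using no_cycle_4[of x u y u'] adj_sym by blast

text \<open>Heptagons on the paths A1 u1 x u2, A2 u2 x u3 and A1 u1 x u3 produce \<open>A2\<close>,
  \<open>A3\<close> and \<open>Y\<close>; the 9-cycle closes when \<open>Y = A3\<close>. Otherwise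
  \<open>a3m\<close> would have a neighbour \<open>q\<close> at distance 2 from \<open>A1\<close>,
  and each possible path from \<open>A1\<close> to \<open>q\<close> contradicts the girth or
  \<open>dist_top\<close>.\<close>

lemma triangle_exists:
  assumes x: "nbhd x u1 u2 u3" and A1: "adj u1 A1" "A1 \<noteq> x"
  shows "\<exists>A2 A3 a1p a1m a2p a2m a3p a3m. triangle x u1 u2 u3 A1 A2 A3 a1p a1m a2p a2m a3p a3m"
proof -
  note u = nbhdD(1-3)[OF x] nbhdD(5-7)[OF x]
  have level: "dst x y = 2 \<and> dst x z = 3" if "adj x u" "adj u y" "y \<noteq> x" "adj y z" "z \<noteq> u" for u y z
    using dist_path_2[of x u y] dist_path_3[of x u y z] that by blast
  obtain A2 a2m a1p where A2: "adj u2 A2" "adj A2 a2m" "adj a2m a1p" "adj a1p A1" "A2 \<noteq> x" "a2m \<noteq> u2" "a1p \<noteq> u1"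
    using heptagon[of A1 u1 x u2] A1 u adj_sym by metis
  obtain A3 a3m a2p where A3: "adj u3 A3" "adj A3 a3m" "adj a3m a2p" "adj a2p A2" "A3 \<noteq> x" "a3m \<noteq> u3" "a2p \<noteq> u2"
    using heptagon[of A2 u2 x u3] A2 u adj_sym by metis
  obtain Y k a1m where Y: "adj u3 Y" "adj Y k" "adj k a1m" "adj a1m A1" "Y \<noteq> x" "k \<noteq> u3" "a1m \<noteq> u1" "dst A1 Y = 3"
    using heptagon[of A1 u1 x u3] A1 u adj_sym by metis
  have ne: "A1 \<noteq> A2" "A1 \<noteq> A3" "A2 \<noteq> A3" "A1 \<noteq> Y" "A2 \<noteq> Y"
    using branches_differ u A1 A2(1,5) A3(1,5) Y(1,5) by metis+
  have lev: "dst x A1 = 2" "dst x A2 = 2" "dst x A3 = 2" "dst x Y = 2" "dst x a1p = 3" "dst x a2m = 3"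
    "dst x a2p = 3" "dst x a3m = 3" "dst x k = 3" "dst x a1m = 3"
    using level A1 A2 A3 Y u adj_sym by blast+
  have parent: "y = y'" if "adj z y" "adj z y'" "dst x z = 3" "dst x y = 2" "dst x y' = 2" for z y y'
    using unique_level_3 that by blast
  have mate: "w = w'" if "adj z w" "adj z w'" "dst x z = 3" "dst x w = 3" "dst x w' = 3" for z w w'
    using unique_level_3 that by blast
  have p: "a1p \<noteq> a3m" "a2m \<noteq> k" "a1m \<noteq> a2p"
    using parent[of a1p A1 A3] parent[of a2m A2 Y] parent[of a1m A1 A2] ne lev A1 A2 A3 Y adj_sym by blast+
  have ne2: "a2p \<noteq> a2m" "a1p \<noteq> a1m"
    using mate[of a2m a1p a3m] mate[of a1p a2m k] p lev A2 A3 Y adj_sym by blast+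
  have "Y = A3"
  proof (rule ccontr)
    assume neq: "Y \<noteq> A3"
    \<comment> \<open>Seen from \<open>A1\<close>, the neighbours \<open>x\<close> and
      \<open>Y\<close> of \<open>u3\<close> are on levels 2 and 3, so \<open>A3\<close> is on level
      4.\<close>
    have "dst A1 u3 = 3" using dist_path_3[of A1 u1 x u3] A1 u adj_sym by blast
    then have "dst A1 A3 \<noteq> 3" "dst A1 A3 \<noteq> 2"
      using unique_level_3[of A1 u3 Y 3 A3] unique_level_3[of A1 u3 x 2 A3] dist_path_2[of A1 u1 x]
        neq Y A3 u A1 adj_sym by blast+
    then have 1: "dst A1 A3 = 4"
      using \<open>dst A1 u3 = 3\<close> A3(1) by (metis nbhd_dist_3 nbhdD(4))
    \<comment> \<open>In the same way \<open>a2m\<close> and \<open>u2\<close> occupy levels 2 and 3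
      around \<open>A2\<close>, so \<open>a2p\<close> is on level 4.\<close>
    have "dst A1 a2m = 2" "dst A1 A2 = 3" "dst A1 u2 = 3"
      using dist_path_2[of A1 a1p a2m] dist_path_3[of A1 a1p a2m A2] dist_path_3[of A1 u1 x u2]
        lev A1 A2 u adj_sym by (metis numeral_eq_iff num.distinct(5))+
    then have "dst A1 a2p \<noteq> 2" "dst A1 a2p \<noteq> 3"
      using unique_level_3[of A1 A2 a2m 2 a2p] unique_level_3[of A1 A2 u2 3 a2p] ne2 A2 A3 adj_sym by blast+
    then have 2: "dst A1 a2p = 4"
      using \<open>dst A1 A2 = 3\<close> A3(4) adj_sym by (metis nbhd_dist_3 nbhdD(4))
    \<comment> \<open>\<open>A3\<close> and \<open>a2p\<close> are two neighbours of
      \<open>a3m\<close> on level 4; if \<open>a3m\<close> were on that level as well, a_4 = 1 would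
      fail.\<close>
    have "dst A1 a3m \<noteq> 4"
      using unique_level_4[of A1 a3m A3 a2p] 1 2 A3 lev adj_sym by (metis numeral_eq_iff num.distinct(5))
    then have "dst A1 a3m = 3"
      using dist_steps[of A3 a3m A1] dist_le_4[of A1 a3m] 1 A3 by auto
    then obtain q where q: "adj a3m q" "dst A1 q = 2" using dist_pred[of A1 a3m 2] by auto
    obtain h where h: "adj q h" "adj A1 h" using dist_pred[of A1 q 1] q by auto
    \<comment> \<open>So \<open>q\<close> is the third neighbour of \<open>a3m\<close> and lies in
      Gamma_4(x), which keeps it away from \<open>u1\<close>.\<close>
    have "q \<noteq> A3" "q \<noteq> a2p" using q 1 2 by auto
    then have xq: "dst x q = 4"
      using parent[of a3m A3 q] mate[of a3m a2p q] q(1) lev A3 adj_sym by (metis nbhd_dist_3 nbhdD(4))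
    then have "h \<noteq> u1" using h q dist_step[of u1 q x] u adj_sym
      by (metis Suc_leI dist_eq_1 numeral_nat(2) not_less_eq_eq numeral_2_eq_2 numeral_le_iff one_le_numeral semiring_norm(69) semiring_norm(72) le_trans)
    have "nbhd A1 u1 a1p a1m" using nbhd3 A1 A2 Y ne2 adj_sym by metis
    then consider "h = a1p" | "h = a1m" using h \<open>h \<noteq> u1\<close> by (auto simp: nbhd_def)
    then show False
    proof cases
      case 1
      show False
        by (rule no_cycle_6[of a1p a2m A2 a2p a3m q])
           (use 1 A2 A3 q h p ne2 lev \<open>q \<noteq> a2p\<close> xq adj_sym in auto)
    next
      case 2
      \<comment> \<open>The heptagon x, u3, Y, k, a1m, A1, u1 puts \<open>q\<close> at distance 4
        from \<open>u3\<close>, but u3, A3, a3m, q is a path of length 3.\<close>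
      have "dst u3 q = 4"
        by (rule dist_top[of x u3 u1 Y k a1m A1 q]) (use 2 A1 Y u q h lev xq adj_sym in auto)
      moreover have "dst u3 q = 3"
        using dist_path_3[of u3 A3 a3m q] A3 q \<open>q \<noteq> A3\<close> by blast
      ultimately show False by simp
    qed
  qed
  have "a3m \<noteq> k" using mate[of a3m a2p a1m] p lev A3 Y adj_sym by metis
  then have "triangle x u1 u2 u3 A1 A2 A3 a1p a1m a2p a2m k a3m"
    unfolding triangle_def
    using x A1 A2 A3 Y \<open>Y = A3\<close> ne2 adj_sym nbhd3[of A1 u1 a1p a1m] nbhd3[of A2 u2 a2p a2m] nbhd3[of A3 u3 k a3m]
    by auto
  then show ?thesis by blast
qed

end

section \<open>The two 9-cycles and the vertices at distance four\<close>

context coxeter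
begin

lemma dist_adj: "adj a b \<Longrightarrow> dst a b \<noteq> 2 \<and> dst a b \<noteq> 3 \<and> dst a b \<noteq> 4"
  by (drule dist_eq_1[THEN iffD2]) (simp del: dist_eq_1)

lemma triangle_levels:
  assumes "triangle x u1 u2 u3 A1 A2 A3 a1p a1m a2p a2m a3p a3m"
  shows "dst x A1 = 2" "dst x A2 = 2" "dst x A3 = 2" "dst x a1p = 3" "dst x a1m = 3"
    "dst x a2p = 3" "dst x a2m = 3" "dst x a3p = 3" "dst x a3m = 3"
proof -
  have level: "dst x y = 2 \<and> dst x z = 3" if "adj x u" "adj u y" "y \<noteq> x" "adj y z" "z \<noteq> u" for u y z
    using dist_path_2[of x u y] dist_path_3[of x u y z] that by blast
  show "dst x A1 = 2" "dst x A2 = 2" "dst x A3 = 2" "dst x a1p = 3" "dst x a1m = 3"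
    "dst x a2p = 3" "dst x a2m = 3" "dst x a3p = 3" "dst x a3m = 3"
    using assms level unfolding triangle_def nbhd_def by metis+
qed

text \<open>The two 9-cycles; each \<open>u_i\<close> has one child on each. Rotation and
  interchange of the cycles preserve the predicate, so each later adjacency is proved for one
  position and transported to the others.\<close>

definition triangle_pair where
  "triangle_pair x u1 u2 u3 A1 A2 A3 a1p a1m a2p a2m a3p a3m B1 B2 B3 b1p b1m b2p b2m b3p b3m \<longleftrightarrow>
     triangle x u1 u2 u3 A1 A2 A3 a1p a1m a2p a2m a3p a3m \<and>
     triangle x u1 u2 u3 B1 B2 B3 b1p b1m b2p b2m b3p b3m \<and> A1 \<noteq> B1 \<and> A2 \<noteq> B2 \<and> A3 \<noteq> B3"

lemma triangle_pair_rotate: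
  "triangle_pair x u1 u2 u3 A1 A2 A3 a1p a1m a2p a2m a3p a3m B1 B2 B3 b1p b1m b2p b2m b3p b3m \<Longrightarrow>
   triangle_pair x u2 u3 u1 A2 A3 A1 a2p a2m a3p a3m a1p a1m B2 B3 B1 b2p b2m b3p b3m b1p b1m"
  using triangle_rotate by (auto simp: triangle_pair_def)

lemma triangle_pair_swap:
  "triangle_pair x u1 u2 u3 A1 A2 A3 a1p a1m a2p a2m a3p a3m B1 B2 B3 b1p b1m b2p b2m b3p b3m \<Longrightarrow>
   triangle_pair x u1 u2 u3 B1 B2 B3 b1p b1m b2p b2m b3p b3m A1 A2 A3 a1p a1m a2p a2m a3p a3m"
  by (auto simp: triangle_pair_def)

text \<open>The second cycle starts at the other child \<open>B1\<close> of \<open>u1\<close>. If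
  the cycles shared \<open>A2\<close>, uniqueness of neighbours inside Gamma_3(x) would identify
  \<open>b1p\<close> with a leaf below \<open>A1\<close> or \<open>A3\<close>, giving it two
  parents; \<open>A3\<close> is treated alike.\<close>

lemma triangle_pair_exists:
  assumes x: "nbhd x u1 u2 u3" and A1: "adj u1 A1" "A1 \<noteq> x"
  shows "\<exists>A2 A3 a1p a1m a2p a2m a3p a3m B1 B2 B3 b1p b1m b2p b2m b3p b3m.
    triangle_pair x u1 u2 u3 A1 A2 A3 a1p a1m a2p a2m a3p a3m B1 B2 B3 b1p b1m b2p b2m b3p b3m"
proof -
  obtain A2 A3 a1p a1m a2p a2m a3p a3m where A: "triangle x u1 u2 u3 A1 A2 A3 a1p a1m a2p a2m a3p a3m"
    using triangle_exists[OF assms] by blast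
  obtain B1 where "nbhd u1 x A1 B1" using nbhd2[of u1 x A1] A1 nbhdD[OF x] adj_sym by metis
  then have B1: "adj u1 B1" "B1 \<noteq> x" "A1 \<noteq> B1" by (auto simp: nbhd_def)
  obtain B2 B3 b1p b1m b2p b2m b3p b3m where B: "triangle x u1 u2 u3 B1 B2 B3 b1p b1m b2p b2m b3p b3m"
    using triangle_exists[OF x B1(1,2)] by blast
  have parent: "y = y'" if "adj y z" "adj y' z" "dst x z = 3" "dst x y = 2" "dst x y' = 2" for z y y'
    using unique_level_3 that adj_sym by blast
  have mate: "w = w'" if "adj z w" "adj z w'" "dst x z = 3" "dst x w = 3" "dst x w' = 3" for z w w'
    using unique_level_3 that by blast
  note lev = triangle_levels[OF A] triangle_levels[OF B]
  note A' = A[unfolded triangle_def] and B' = B[unfolded triangle_def]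
  note u = nbhdD(1-3)[OF x] nbhdD(5-7)[OF x]
  have ne: "B1 \<noteq> A2" "B1 \<noteq> A3"
    using branches_differ[of x u1 u2] branches_differ[of x u1 u3] u B1 A' by metis+
  have b1: "adj B1 b1p" "adj B1 b1m" "b1p \<noteq> u1" using B' by (auto simp: nbhd_def)
  have "A2 \<noteq> B2"
  proof
    assume "A2 = B2"
    then have "b2m = a2p \<or> b2m = a2m" using A' B' unfolding nbhd_def by metis
    then have "b1p = a3m \<or> b1p = a1p"
      using mate[of a2p b1p a3m] mate[of a2m b1p a1p] A' B' lev adj_sym by blast
    then show False
      using parent[of B1 b1p A3] parent[of B1 b1p A1] ne b1 \<open>A1 \<noteq> B1\<close> A' lev unfolding nbhd_def by blast
  qed
  moreover have "A3 \<noteq> B3"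
  proof
    assume "A3 = B3"
    then have "b3p = a3p \<or> b3p = a3m" using A' B' unfolding nbhd_def by metis
    then have "b1m = a1m \<or> b1m = a2p"
      using mate[of a3p b1m a1m] mate[of a3m b1m a2p] A' B' lev adj_sym by blast
    then show False
      using parent[of B1 b1m A2] parent[of B1 b1m A1] ne b1 \<open>A1 \<noteq> B1\<close> A' lev unfolding nbhd_def by blast
  qed
  ultimately have "triangle_pair x u1 u2 u3 A1 A2 A3 a1p a1m a2p a2m a3p a3m B1 B2 B3 b1p b1m b2p b2m b3p b3m"
    using A B \<open>A1 \<noteq> B1\<close> by (simp add: triangle_pair_def)
  then show ?thesis by blast
qed

context
  fixes x u1 u2 u3 A1 A2 A3 a1p a1m a2p a2m a3p a3m B1 B2 B3 b1p b1m b2p b2m b3p b3m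
  assumes pair: "triangle_pair x u1 u2 u3 A1 A2 A3 a1p a1m a2p a2m a3p a3m B1 B2 B3 b1p b1m b2p b2m b3p b3m"
begin

lemma level_facts:
  "dst x A1 = 2" "dst x A2 = 2" "dst x A3 = 2" "dst x a1p = 3" "dst x a1m = 3"
  "dst x a2p = 3" "dst x a2m = 3" "dst x a3p = 3" "dst x a3m = 3"
  "dst x B1 = 2" "dst x B2 = 2" "dst x B3 = 2" "dst x b1p = 3" "dst x b1m = 3"
  "dst x b2p = 3" "dst x b2m = 3" "dst x b3p = 3" "dst x b3m = 3"
  using triangle_levels[OF pair[unfolded triangle_pair_def, THEN conjunct1]]
    triangle_levels[OF pair[unfolded triangle_pair_def, THEN conjunct2, THEN conjunct1]]
  by simp_all

lemma adjacency_facts: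
  "adj x u1" "adj x u2" "adj x u3" "adj u1 A1" "adj u1 B1" "adj u2 A2" "adj u2 B2" "adj u3 A3" "adj u3 B3"
  "adj A1 a1p" "adj A1 a1m" "adj A2 a2p" "adj A2 a2m" "adj A3 a3p" "adj A3 a3m"
  "adj B1 b1p" "adj B1 b1m" "adj B2 b2p" "adj B2 b2m" "adj B3 b3p" "adj B3 b3m"
  "adj a1p a2m" "adj a2p a3m" "adj a3p a1m" "adj b1p b2m" "adj b2p b3m" "adj b3p b1m"
  "u1 \<noteq> u2" "u1 \<noteq> u3" "u2 \<noteq> u3" "A1 \<noteq> x" "A2 \<noteq> x" "A3 \<noteq> x" "B1 \<noteq> x" "B2 \<noteq> x" "B3 \<noteq> x"
  "A1 \<noteq> B1" "A2 \<noteq> B2" "A3 \<noteq> B3"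
  "a1p \<noteq> a1m" "a2p \<noteq> a2m" "a3p \<noteq> a3m" "b1p \<noteq> b1m" "b2p \<noteq> b2m" "b3p \<noteq> b3m"
  "a1p \<noteq> u1" "a1m \<noteq> u1" "a2p \<noteq> u2" "a2m \<noteq> u2" "a3p \<noteq> u3" "a3m \<noteq> u3"
  "b1p \<noteq> u1" "b1m \<noteq> u1" "b2p \<noteq> u2" "b2m \<noteq> u2" "b3p \<noteq> u3" "b3m \<noteq> u3"
proof -
  have *: "nbhd x u1 u2 u3" "nbhd A1 u1 a1p a1m" "nbhd A2 u2 a2p a2m" "nbhd A3 u3 a3p a3m"
    "nbhd B1 u1 b1p b1m" "nbhd B2 u2 b2p b2m" "nbhd B3 u3 b3p b3m"
    using pair unfolding triangle_pair_def triangle_def by blast+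
  have **: "adj u1 A1" "adj u1 B1" "adj u2 A2" "adj u2 B2" "adj u3 A3" "adj u3 B3"
    "adj a1p a2m" "adj a2p a3m" "adj a3p a1m" "adj b1p b2m" "adj b2p b3m" "adj b3p b1m"
    "A1 \<noteq> x" "A2 \<noteq> x" "A3 \<noteq> x" "B1 \<noteq> x" "B2 \<noteq> x" "B3 \<noteq> x" "A1 \<noteq> B1" "A2 \<noteq> B2" "A3 \<noteq> B3"
    using pair unfolding triangle_pair_def triangle_def by blast+
  note neq = *[THEN nbhdD(5)] *[THEN nbhdD(6)] *[THEN nbhdD(7)]
  show "adj x u1" "adj x u2" "adj x u3" "adj u1 A1" "adj u1 B1" "adj u2 A2" "adj u2 B2" "adj u3 A3" "adj u3 B3"
    "adj A1 a1p" "adj A1 a1m" "adj A2 a2p" "adj A2 a2m" "adj A3 a3p" "adj A3 a3m"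
    "adj B1 b1p" "adj B1 b1m" "adj B2 b2p" "adj B2 b2m" "adj B3 b3p" "adj B3 b3m"
    "adj a1p a2m" "adj a2p a3m" "adj a3p a1m" "adj b1p b2m" "adj b2p b3m" "adj b3p b1m"
    "u1 \<noteq> u2" "u1 \<noteq> u3" "u2 \<noteq> u3" "A1 \<noteq> x" "A2 \<noteq> x" "A3 \<noteq> x" "B1 \<noteq> x" "B2 \<noteq> x" "B3 \<noteq> x"
    "A1 \<noteq> B1" "A2 \<noteq> B2" "A3 \<noteq> B3"
    "a1p \<noteq> a1m" "a2p \<noteq> a2m" "a3p \<noteq> a3m" "b1p \<noteq> b1m" "b2p \<noteq> b2m" "b3p \<noteq> b3m"
    "a1p \<noteq> u1" "a1m \<noteq> u1" "a2p \<noteq> u2" "a2m \<noteq> u2" "a3p \<noteq> u3" "a3m \<noteq> u3"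
    "b1p \<noteq> u1" "b1m \<noteq> u1" "b2p \<noteq> u2" "b2m \<noteq> u2" "b3p \<noteq> u3" "b3m \<noteq> u3"
    by (rule ** *[THEN nbhdD(1)] *[THEN nbhdD(2)] *[THEN nbhdD(3)] neq neq[THEN not_sym])+
qed

lemmas adjacency_facts_sym = adjacency_facts(1-27)[THEN adj_sym]

lemma nbhd_facts: "nbhd x u1 u2 u3" "nbhd u1 x A1 B1" "nbhd u2 x A2 B2" "nbhd u3 x A3 B3"
  "nbhd A1 u1 a1p a1m" "nbhd A2 u2 a2p a2m" "nbhd A3 u3 a3p a3m"
  "nbhd B1 u1 b1p b1m" "nbhd B2 u2 b2p b2m" "nbhd B3 u3 b3p b3m"
  by (rule nbhd3; (rule adjacency_facts adjacency_facts_sym adjacency_facts(28-)[THEN not_sym]))+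

lemma middle_distinct: "distinct [A1, A2, A3, B1, B2, B3]"
  using branches_differ[of x u1 u2] branches_differ[of x u1 u3] branches_differ[of x u2 u3] adjacency_facts
  by auto

text \<open>A leaf has only one neighbour in Gamma_2(x), since c_3 = 1, so leaves below different
  parents differ.\<close>

lemma leaves_distinct:
  "distinct [a1p, a1m, a2p, a2m, a3p, a3m, b1p, b1m, b2p, b2m, b3p, b3m]"
proof -
  have *: "z \<noteq> z'" if "adj y z" "adj y' z'" "y \<noteq> y'" "dst x y = 2" "dst x y' = 2" "dst x z = 3" for y y' z z'
    using unique_level_3[of x z y 2 y'] that adj_sym by blast
  have ne: "A1 \<noteq> A2" "A1 \<noteq> A3" "A1 \<noteq> B1" "A1 \<noteq> B2" "A1 \<noteq> B3" "A2 \<noteq> A3" "A2 \<noteq> B1" "A2 \<noteq> B2" "A2 \<noteq> B3"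
    "A3 \<noteq> B1" "A3 \<noteq> B2" "A3 \<noteq> B3" "B1 \<noteq> B2" "B1 \<noteq> B3" "B2 \<noteq> B3"
    using middle_distinct by simp_all
  show ?thesis
    unfolding distinct.simps list.set insert_iff empty_iff de_Morgan_disj
    by (intro conjI TrueI not_False_eq_True[THEN iffD2];
       (rule adjacency_facts(40-45) | (rule *; rule adjacency_facts(10-21) level_facts ne)))
qed

lemma leaf_cases:
  assumes "dst x w = 3"
  shows "w \<in> {a1p, a1m, a2p, a2m, a3p, a3m, b1p, b1m, b2p, b2m, b3p, b3m}"
proof -
  obtain y where y: "adj w y" "dst x y = 2" using dist_pred[of x w 2] assms by auto
  obtain u where u: "adj y u" "adj x u" using dist_pred[of x y 1] y by auto
  have "u \<in> {u1, u2, u3}" using u nbhd_facts by (auto simp: nbhd_def)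
  then have "y \<in> {A1, A2, A3, B1, B2, B3}"
    using y u adj_sym[of y u] nbhd_facts(2-4) by (auto simp: nbhd_def)
  moreover have "w \<notin> {u1, u2, u3}" using assms dist_adj adjacency_facts(1-3) by auto
  ultimately show ?thesis
    using adj_sym[OF y(1)] nbhd_facts(5-) by (auto simp: nbhd_def)
qed

lemma top_level:
  assumes "adj a1p t" "t \<noteq> A1" "t \<noteq> a2m"
  shows "dst x t = 4"
proof -
  have "dst x t \<noteq> 2" "dst x t \<noteq> 3"
    using unique_level_3[of x a1p t _ A1] unique_level_3[of x a1p t _ a2m] assms
      level_facts(1,4,7) adjacency_facts(22) adjacency_facts_sym(10) by blast+
  then show ?thesis using assms(1) level_facts(4) by (metis nbhd_dist_3 nbhdD(4))
qed

text \<open>As c_4 = 2, \<open>t\<close> has a second neighbour \<open>w\<close> in Gamma_3(x).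
  Every leaf other than \<open>b3m\<close> is excluded, either by a short cycle or because it would
  give \<open>t\<close> two different distances from \<open>u1\<close> or \<open>u2\<close>.\<close>

lemma top_adjacent:
  assumes t: "adj a1p t" "t \<noteq> A1" "t \<noteq> a2m"
  shows "adj b3m t"
proof -
  note e = adjacency_facts(1-27) adjacency_facts_sym adjacency_facts(28-) adjacency_facts(28-)[THEN not_sym]
  have xt: "dst x t = 4" by (rule top_level[OF t])
  note lv = level_facts xt
  have ut: "u \<noteq> t" if "adj x u" for u using that xt dist_adj by auto
  have yt: "y \<noteq> t" if "dst x y = 2" for y using that xt by auto
  have zt: "z \<noteq> t" if "dst x z = 3" for z using that xt by auto
  obtain w where w: "adj t w" "w \<noteq> a1p" "dst x w = 3"
    using xt by (metis nbhd_dist_4 nbhdD(1,2,5))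
  have lvl23: "y \<noteq> z" if "dst x y = 2" "dst x z = 3" for y z using that by auto
  have lvl12: "u \<noteq> y" if "adj x u" "dst x y = 2" for u y using that dist_adj by auto
  have lvl13: "u \<noteq> y" if "adj x u" "dst x y = 3" for u y using that dist_adj by auto
  have no: "w \<noteq> a1m" "w \<noteq> b1p" "w \<noteq> b1m" "w \<noteq> a2m" "w \<noteq> a2p" "w \<noteq> b2p" "w \<noteq> b2m" "w \<noteq> a3p" "w \<noteq> b3p" "w \<noteq> a3m"
  proof -
    show "w \<noteq> a1m"
      using no_cycle_4[of A1 a1p t a1m] t w(1) e yt[OF lv(1)] adj_sym by blast
    have hex: "w \<noteq> b" if "adj b B1" "b \<noteq> u1" for b
    proof
      assume "w = b"
      then show False
        using no_cycle_6[of u1 A1 a1p t b B1] t(1) w(1,2) that yt[OF lv(1)] adjacency_facts(4,10,46)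
          adjacency_facts_sym(5) by blast
    qed
    show "w \<noteq> b1p" "w \<noteq> b1m"
      using hex adjacency_facts_sym(16,17) adjacency_facts(52,53) by blast+
    show "w \<noteq> a2m"
      using no_cycle_3[of a1p a2m t] t w(1) e adj_sym by blast
    show "w \<noteq> a2p"
      using no_cycle_5[of a1p a2m A2 a2p t] t w(1,2) e lvl23[OF lv(2,4)] adj_sym by blast
    \<comment> \<open>This comes from the heptagon x, u2, A2, a2m, a1p, A1, u1; a child of
      \<open>B2\<close> adjacent to \<open>t\<close> would give distance 3 instead.\<close>
    have "dst u2 t = 4"
      by (rule dist_top[of x u2 u1 A2 a2m a1p A1 t]) (use e t lvl23 lv in blast)+
    then have "\<not> adj B2 w" 
      using dist_path_3[of u2 B2 w t] e w(1) lvl13[of u2 w] w(3) yt[OF lv(11)] ut[of u2] adj_sym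
        by (metis numeral_eq_iff num.distinct(5) semiring_norm(88) verit_eq_simplify(10))
    then show "w \<noteq> b2p" "w \<noteq> b2m" using e by blast+
    \<comment> \<open>For \<open>w = a3p\<close> or \<open>w = b3p\<close>, \<open>dist_top\<close>
      would give distance 4 here.\<close>
    have 1: "dst u1 t = 3" using dist_path_3[of u1 A1 a1p t] t e by blast
    show "w \<noteq> a3p"
    proof
      assume "w = a3p"
      then have "adj a3p t" using w(1) adj_sym by simp
      then have "dst u1 t = 4"
        by (rule dist_top[of x u1 u3 A1 a1m a3p A3 t, rotated 12])
           (rule e lvl23[OF lv(1,8), THEN not_sym] yt[OF lv(3), THEN not_sym] zt[OF lv(5), THEN not_sym])+
      then show False using 1 by simp
    qed
    show "w \<noteq> b3p"
    proof
      assume "w = b3p"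
      then have "adj b3p t" using w(1) adj_sym by simp
      then have "dst u1 t = 4"
        by (rule dist_top[of x u1 u3 B1 b1m b3p B3 t, rotated 12])
           (rule e lvl23[OF lv(10,17), THEN not_sym] yt[OF lv(12), THEN not_sym] zt[OF lv(14), THEN not_sym])+
      then show False using 1 by simp
    qed
    show "w \<noteq> a3m"
    proof
      assume "w = a3m"
      then have "adj a3m t" using w(1) adj_sym by simp
      then show False
        by (rule no_cycle_6[of a1p a2m A2 a2p a3m t, rotated 4])
           (rule e t(1)[THEN adj_sym] lvl23[OF lv(2,4), THEN not_sym] lvl23[OF lv(2,9)] w(2)[unfolded \<open>w = a3m\<close>, THEN not_sym])+
    qed
  qed
  then have "w = b3m" using leaf_cases[OF w(3)] w(2) by blast
  then show ?thesis using w(1) adj_sym by blast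
qed

end

end

lemma all_less_28:
  "(\<forall>i<28. Q i) \<longleftrightarrow> (\<forall>i\<in>set [0, 1, 2, 3, 4, 5, 6, 7, 8, 9, 10, 11, 12, 13, 14, 15, 16, 17, 18, 19, 20, 21, 22, 23,
    24, 25, 26, 27 :: nat]. Q i)"
proof -
  have "{..<28} = set [0, 1, 2, 3, 4, 5, 6, 7, 8, 9, 10, 11, 12, 13, 14, 15, 16, 17, 18, 19, 20, 21, 22, 23,
    24, 25, 26, 27 :: nat]"
    by (simp add: lessThan_nat_numeral lessThan_Suc insert_commute)
  then show ?thesis by (metis lessThan_iff)
qed

section \<open>Edges among the vertices at distance four and the complete labelling\<close>

context coxeter
begin

context
  fixes x u1 u2 u3 A1 A2 A3 a1p a1m a2p a2m a3p a3m B1 B2 B3 b1p b1m b2p b2m b3p b3m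
  assumes pair: "triangle_pair x u1 u2 u3 A1 A2 A3 a1p a1m a2p a2m a3p a3m B1 B2 B3 b1p b1m b2p b2m b3p b3m"
begin

text \<open>Of the twelve leaves to which \<open>s\<close> could be attached, the girth excludes
  eight, while \<open>a1m\<close> and \<open>b2p\<close> already have \<open>t\<close> as their
  neighbour in Gamma_4(x). The remaining \<open>a2p\<close> and \<open>b1m\<close> share that
  neighbour, so either one leads to \<open>a2p\<close>.\<close>

lemma top_edge:
  assumes t: "adj a1m t" "adj b2p t" "dst x t = 4" and s: "adj t s" "dst x s = 4"
  shows "adj a2p s"
proof -
  note e = adjacency_facts(1-27)[OF pair] adjacency_facts_sym[OF pair] adjacency_facts(28-)[OF pair]
    adjacency_facts(28-)[OF pair, THEN not_sym] t(1,2) t(1,2)[THEN adj_sym] s(1) s(1)[THEN adj_sym]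
  note lv = level_facts[OF pair]
  have ys: "y \<noteq> s" "s \<noteq> y" "y \<noteq> t" "t \<noteq> y" if "dst x y = 2" for y using that s t by auto
  have zs: "z \<noteq> s" "s \<noteq> z" "z \<noteq> t" "t \<noteq> z" if "dst x z = 3" for z using that s t by auto
  have yz: "y \<noteq> z" "z \<noteq> y" if "dst x y = 2" "dst x z = 3" for y z using that by auto
  note ne = ys[OF lv(1)] ys[OF lv(2)] ys[OF lv(3)] ys[OF lv(10)] ys[OF lv(11)] ys[OF lv(12)]
    zs[OF lv(4)] zs[OF lv(5)] zs[OF lv(6)] zs[OF lv(7)] zs[OF lv(8)] zs[OF lv(9)]
    zs[OF lv(13)] zs[OF lv(14)] zs[OF lv(15)] zs[OF lv(16)] zs[OF lv(17)] zs[OF lv(18)]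
    yz[OF lv(1,7)] yz[OF lv(3,5)] yz[OF lv(11,13)] yz[OF lv(12,15)] yz[OF lv(2,4)] yz[OF lv(2,9)]
  have unique: "s = t'" if "adj z s" "adj z t'" "dst x z = 3" "dst x t' = 4" for z t'
    using unique_level_3[of x z s 4 t'] that s by blast
  have st: "s \<noteq> t" using s adj_irrefl by auto
  have "\<not> adj s a1p"
  proof
    assume *: "adj s a1p"
    show False
      by (rule no_cycle_5[of a1p A1 a1m t s]) (rule e ne * *[THEN adj_sym])+
  qed
  moreover have "\<not> adj s a2m"
  proof
    assume *: "adj s a2m"
    show False
      by (rule no_cycle_6[of t a1m A1 a1p a2m s]) (rule e ne * *[THEN adj_sym])+
  qed
  moreover have "\<not> adj s a3p"
  proof
    assume *: "adj s a3p"
    show False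
      by (rule no_cycle_4[of a1m a3p s t]) (rule e ne * *[THEN adj_sym])+
  qed
  moreover have "\<not> adj s a3m"
  proof
    assume *: "adj s a3m"
    show False
      by (rule no_cycle_6[of t a1m a3p A3 a3m s]) (rule e ne * *[THEN adj_sym])+
  qed
  moreover have "\<not> adj s b1p"
  proof
    assume *: "adj s b1p"
    show False
      by (rule no_cycle_6[of t b2p B2 b2m b1p s]) (rule e ne * *[THEN adj_sym])+
  qed
  moreover have "\<not> adj s b2m"
  proof
    assume *: "adj s b2m"
    show False
      by (rule no_cycle_5[of b2m B2 b2p t s]) (rule e ne * *[THEN adj_sym])+
  qed
  moreover have "\<not> adj s b3m"
  proof
    assume *: "adj s b3m"
    show False
      by (rule no_cycle_4[of b2p b3m s t]) (rule e ne * *[THEN adj_sym])+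
  qed
  moreover have "\<not> adj s b3p"
  proof
    assume *: "adj s b3p"
    show False
      by (rule no_cycle_6[of t b2p b3m B3 b3p s]) (rule e ne * *[THEN adj_sym])+
  qed
  moreover have "\<not> adj s a1m" "\<not> adj s b2p"
    using unique[of a1m t] unique[of b2p t] st t lv(5,15) adj_sym by blast+
  \<comment> \<open>By \<open>top_adjacent\<close> for the rotated pair, the third neighbour of
    \<open>a2p\<close> is also adjacent to \<open>b1m\<close>; it must be \<open>s\<close>.\<close>
  moreover have "adj a2p s" if "adj s b1m"
  proof -
    obtain t' where t': "nbhd a2p A2 a3m t'"
      using nbhd2[of a2p A2 a3m] adjacency_facts_sym(12)[OF pair] adjacency_facts(23)[OF pair] yz[OF lv(2,9)] by metis
    note t'' = nbhdD(3)[OF t'] nbhdD(6,7)[OF t', THEN not_sym]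
    have "adj b1m t'" "dst x t' = 4"
      using top_adjacent[OF triangle_pair_rotate[OF pair] t''] top_level[OF triangle_pair_rotate[OF pair] t''] by simp_all
    then show ?thesis using unique[of b1m t'] that lv(14) t''(1) adj_sym by blast
  qed
  moreover obtain w where "adj s w" "dst x w = 3"
    using s(2) by (metis nbhd_dist_4 nbhdD(1))
  ultimately show ?thesis
    using leaf_cases[OF pair, of w] adj_sym by auto
qed

end

text \<open>Rotation and interchange turn \<open>top_adjacent\<close> into the six vertices of
  Gamma_4(x) with their leaves, and rotation turns \<open>top_edge\<close> into the three edges
  among them. This completes all 28 neighbourhoods.\<close>

lemma labelling_exists:
  assumes "nbhd x u1 u2 u3" "adj u1 A1" "A1 \<noteq> x"
  shows "\<exists>p. labelling adj p \<and> p 0 = x \<and> p 1 = u1 \<and> p 2 = u2 \<and> p 3 = u3 \<and> p 4 = A1"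
proof -
  obtain A2 A3 a1p a1m a2p a2m a3p a3m B1 B2 B3 b1p b1m b2p b2m b3p b3m where
    pair: "triangle_pair x u1 u2 u3 A1 A2 A3 a1p a1m a2p a2m a3p a3m B1 B2 B3 b1p b1m b2p b2m b3p b3m"
    using triangle_pair_exists[OF assms] by blast
  note pairs = pair triangle_pair_rotate[OF pair] triangle_pair_rotate[OF triangle_pair_rotate[OF pair]]
  note pairs' = pairs pairs[THEN triangle_pair_swap]
  have ex_top: "\<exists>t. adj a1p t \<and> adj b3m t \<and> dst x t = 4"
    if pair: "triangle_pair x u1 u2 u3 A1 A2 A3 a1p a1m a2p a2m a3p a3m B1 B2 B3 b1p b1m b2p b2m b3p b3m"
    for u1 u2 u3 A1 A2 A3 a1p a1m a2p a2m a3p a3m B1 B2 B3 b1p b1m b2p b2m b3p b3m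
  proof -
    have "A1 \<noteq> a2m" using level_facts(1,7)[OF pair] by auto
    then obtain t where t: "nbhd a1p A1 a2m t"
      using nbhd2 adjacency_facts_sym(10)[OF pair] adjacency_facts(22)[OF pair] by metis
    note t' = nbhdD(3)[OF t] nbhdD(6,7)[OF t, THEN not_sym]
    show ?thesis using t'(1) top_adjacent[OF pair t'] top_level[OF pair t'] by blast
  qed
  obtain ta1 ta2 ta3 tb1 tb2 tb3 where top:
    "adj a1p ta1" "adj b3m ta1" "dst x ta1 = 4" "adj a2p ta2" "adj b1m ta2" "dst x ta2 = 4"
    "adj a3p ta3" "adj b2m ta3" "dst x ta3 = 4" "adj b1p tb1" "adj a3m tb1" "dst x tb1 = 4"
    "adj b2p tb2" "adj a1m tb2" "dst x tb2 = 4" "adj b3p tb3" "adj a2m tb3" "dst x tb3 = 4"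
    using pairs'[THEN ex_top] by blast
  note lv = level_facts[OF pair]
  have ex_edge: "\<exists>s. adj t s \<and> dst x s = 4" if "dst x t = 4" for t
    using that by (metis nbhd_dist_4 nbhdD(3))
  have unique: "s = t" if "adj z s" "adj z t" "dst x z = 3" "dst x s = 4" "dst x t = 4" for z s t
    using unique_level_3[of x z s 4 t] that by blast
  have edges: "adj tb2 ta2" "adj tb3 ta3" "adj tb1 ta1"
    using ex_edge[OF top(15)] top_edge[OF pairs(1) top(14,13,15)] unique[OF _ top(4) lv(6) _ top(6)]
      ex_edge[OF top(18)] top_edge[OF pairs(2) top(17,16,18)] unique[OF _ top(7) lv(8) _ top(9)]
      ex_edge[OF top(12)] top_edge[OF pairs(3) top(11,10,12)] unique[OF _ top(1) lv(4) _ top(3)]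
    by blast+
  have yz: "y \<noteq> z" if "dst x y = 2" "dst x z = 3" for y z using that by auto
  have yt: "y \<noteq> t" if "dst x y = 2" "dst x t = 4" for y t using that by auto
  have zt: "z \<noteq> t" if "dst x z = 3" "dst x t = 4" for z t using that by auto
  note e = adjacency_facts(1-27)[OF pair] adjacency_facts_sym[OF pair] 
    top(1,2,4,5,7,8,10,11,13,14,16,17) top(1,2,4,5,7,8,10,11,13,14,16,17)[THEN adj_sym] edges edges[THEN adj_sym]
  have ld: "a1m \<noteq> b2p" "a1p \<noteq> b3m" "a2m \<noteq> b3p" "a2p \<noteq> b1m" "a3m \<noteq> b1p" "a3p \<noteq> b2m"
    using leaves_distinct[OF pair] by auto
  have N: "nbhd a1m A1 a3p tb2" "nbhd a1p A1 a2m ta1" "nbhd b1m B1 b3p ta2" "nbhd b1p B1 b2m tb1"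
    "nbhd b2m B2 b1p ta3" "nbhd b2p B2 b3m tb2" "nbhd a2m A2 a1p tb3" "nbhd a2p A2 a3m ta2"
    "nbhd b3p B3 b1m tb3" "nbhd b3m B3 b2p ta1" "nbhd a3p A3 a1m ta3" "nbhd a3m A3 a2p tb1"
    "nbhd ta1 a1p b3m tb1" "nbhd ta2 b1m a2p tb2" "nbhd ta3 b2m a3p tb3"
    "nbhd tb1 b1p a3m ta1" "nbhd tb2 a1m b2p ta2" "nbhd tb3 a2m b3p ta3"
    by (rule nbhd3; (rule e ld ld[THEN not_sym] | (rule yz; rule lv) | (rule yt; rule lv top) | (rule zt; rule lv top)))+
  note N' = nbhd_facts[OF pair] N
  \<comment> \<open>The order makes \<open>A1, A2, A3\<close> the vertices y_1, y_4, y_6 and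
    \<open>B1, B2, B3\<close> the vertices y_2, y_3, y_5, and lets S consist of the leaves
    \<open>a1p, a2p, a3p, b1m, b2m, b3m\<close>.\<close>
  define ps where "ps = [x, u1, u2, u3, A1, B1, B2, A2, B3, A3, a1m, a1p, b1m, b1p, b2m, b2p, a2m, a2p,
    b3p, b3m, a3p, a3m, ta1, ta2, ta3, tb1, tb2, tb3]"
  have "v \<in> set ps" for v
  proof -
    have "dst x v = 0 \<or> dst x v = 1 \<or> dst x v = 2 \<or> dst x v = 3 \<or> dst x v = 4"
      using dist_le_4[of x v] by linarith
    then consider "x = v" | "adj x v" | "dst x v = 2" | "dst x v = 3" | "dst x v = 4" by auto
    then show ?thesis
    proof cases
      case 2
      then show ?thesis using nbhdD(4)[OF assms(1)] by (auto simp: ps_def)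
    next
      case 3
      then obtain u where u: "adj v u" "adj x u" using dist_pred[of x v 1] by auto
      have "v \<noteq> x" using 3 by auto
      moreover have "u = u1 \<or> u = u2 \<or> u = u3" using nbhdD(4)[OF assms(1) u(2)] .
      ultimately have "v \<in> {A1, A2, A3, B1, B2, B3}"
        using N'(2-4)[THEN nbhdD(4), of v] adj_sym[OF u(1)] by blast
      then show ?thesis by (auto simp: ps_def)
    next
      case 4
      then show ?thesis using leaf_cases[OF pair] by (auto simp: ps_def)
    next
      case 5
      then obtain w where w: "adj w v" "dst x w = 3" by (metis nbhd_dist_4 nbhdD(1) adj_sym)
      then have "w \<in> {a1p, a1m, a2p, a2m, a3p, a3m, b1p, b1m, b2p, b2m, b3p, b3m}"
        using leaf_cases[OF pair] by blast
      then have "v \<in> set ps"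
        using N(1-12)[THEN nbhdD(4), of v] w(1) unfolding ps_def
        by (elim insertE emptyE) (hypsubst; simp; blast)+
      then show ?thesis .
    qed (simp add: ps_def)
  qed
  then have "set ps = UNIV" by blast
  moreover have len: "length ps = 28" by (simp add: ps_def)
  moreover have "CARD('v) = 28" using coxeter by (simp add: coxeter_graph_def)
  \<comment> \<open>A list of length 28 that covers 28 vertices has no repetition, so the vertices
    need not be compared pairwise.\<close>
  ultimately have "distinct ps" by (simp add: card_distinct)
  then have "bij_betw ((!) ps) {..<28} UNIV"
    using bij_betw_nth[of ps "{..<28}" UNIV] len \<open>set ps = UNIV\<close> by simp
  moreover have "\<forall>i<28. {w. adj (ps ! i) w} = (!) ps ` set (neighbours ! i)"
  proof -
    have set_eq: "{w. adj v w} = {a, b, c}" if "nbhd v a b c" for v a b c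
      using that by (auto simp: nbhd_def)
    show ?thesis
      unfolding all_less_28 by (simp add: ps_def neighbours_def N'[THEN set_eq] insert_commute)
  qed
  ultimately have "labelling adj ((!) ps)" by (simp add: labelling_def)
  then show ?thesis by (intro exI[of _ "(!) ps"]) (simp add: ps_def)
qed

end

section \<open>Coordinates\<close>

locale labelled_coxeter = coxeter adj for adj :: "'v::finite graph" +
  fixes p :: "nat \<Rightarrow> 'v"
  assumes labelling: "labelling adj p"
begin

lemma p_inj: "i < 28 \<Longrightarrow> j < 28 \<Longrightarrow> p i = p j \<longleftrightarrow> i = j"
  using labelling by (auto simp: labelling_def bij_betw_def inj_on_def)

lemma p_surj: obtains i where "i < 28" "v = p i"
proof -
  have "v \<in> p ` {..<28}" using labelling by (simp add: labelling_def bij_betw_def)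
  then show ?thesis using that by blast
qed

lemma neighbours_set: "i < 28 \<Longrightarrow> {w. adj (p i) w} = p ` set (neighbours ! i)"
  using labelling by (simp add: labelling_def)

lemma neighbours_sorted: "\<forall>i<28. length (neighbours ! i) = 3 \<and> distinct (neighbours ! i) \<and> set (neighbours ! i) \<subseteq> {..<28}"
  unfolding all_less_28 by (simp add: neighbours_def)

lemma nbhd_p:
  assumes "i < 28"
  shows "nbhd (p i) (p (neighbours ! i ! 0)) (p (neighbours ! i ! 1)) (p (neighbours ! i ! 2))"
proof -
  obtain a b c where abc: "neighbours ! i = [a, b, c]"
    using neighbours_sorted assms by (auto simp: length_Suc_conv numeral_3_eq_3)
  then have "a < 28" "b < 28" "c < 28" "a \<noteq> b" "a \<noteq> c" "b \<noteq> c"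
    using neighbours_sorted assms by auto
  moreover have "adj (p i) w \<longleftrightarrow> w = p a \<or> w = p b \<or> w = p c" for w
    using neighbours_set[OF assms] abc by auto
  ultimately show ?thesis by (simp add: nbhd_def abc p_inj)
qed

lemma adj_p: "i < 28 \<Longrightarrow> j < 28 \<Longrightarrow> adj (p i) (p j) \<longleftrightarrow> j \<in> set (neighbours ! i)"
proof -
  assume ij: "i < 28" "j < 28"
  have "adj (p i) (p j) \<longleftrightarrow> p j \<in> p ` set (neighbours ! i)"
    using neighbours_set[OF ij(1)] by auto
  also have "\<dots> \<longleftrightarrow> j \<in> set (neighbours ! i)"
    using inj_on_image_mem_iff[of p "{..<28}" j] neighbours_sorted ij labelling
    by (simp add: labelling_def bij_betw_def)
  finally show ?thesis .
qed

definition level :: "nat \<Rightarrow> nat" where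
  "level i = [0, 1, 1, 1, 2, 2, 2, 2, 2, 2, 3, 3, 3, 3, 3, 3, 3, 3, 3, 3, 3, 3, 4, 4, 4, 4, 4, 4] ! i"

lemma dist_level: "\<forall>i<28. dst (p 0) (p i) = level i"
proof -
  note adj = adj_p[THEN iffD2]
  have 1: "dst (p 0) (p i) = 1" if "i \<in> {1, 2, 3}" for i
    using that adj_p[of 0 i] by (auto simp: neighbours_def)
  have 2: "dst (p 0) (p i) = 2" if "i < 28" "j \<in> {1, 2, 3}" "i \<in> set (neighbours ! j)" "i \<noteq> 0" for i j
    using dist_path_2[of "p 0" "p j" "p i"] 1[OF that(2)] adj_p[of j i] p_inj[of 0 i] that by auto
  have 3: "dst (p 0) (p i) = 3"
    if "i < 28" "j \<in> {1, 2, 3}" "k \<in> set (neighbours ! j)" "k \<noteq> 0" "k < 28" "i \<in> set (neighbours ! k)" "i \<noteq> j" for i j k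
    using dist_path_3[of "p 0" "p j" "p k" "p i"] 1[OF that(2)] adj_p[of j k] adj_p[of k i] p_inj[of 0 k] p_inj[of j i] that
    by auto
  \<comment> \<open>The list of a leaf names its parent, its neighbour in Gamma_3(x) and its
    neighbour in Gamma_4(x), in this order.\<close>
  have 4: "dst (p 0) (p (neighbours ! i ! 2)) = 4"
    if i: "i < 28" and h: "dst (p 0) (p i) = 3" "dst (p 0) (p (neighbours ! i ! 0)) = 2" "dst (p 0) (p (neighbours ! i ! 1)) = 3" for i
  proof -
    obtain a b c where abc: "nbhd (p i) a b c" "dst (p 0) a = 2" "dst (p 0) b = 3" "dst (p 0) c = 4"
      using nbhd_dist_3 h(1) by metis
    note N = nbhd_p[OF i]
    have "p (neighbours ! i ! 0) = a" "p (neighbours ! i ! 1) = b"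
      using nbhdD(4)[OF abc(1) nbhdD(1)[OF N]] nbhdD(4)[OF abc(1) nbhdD(2)[OF N]] abc h by auto
    then have "p (neighbours ! i ! 2) = c"
      using nbhdD(4)[OF abc(1) nbhdD(3)[OF N]] nbhdD(6,7)[OF N] by auto
    then show ?thesis using abc by simp
  qed
  have mid: "\<forall>i\<in>{4, 5, 6, 7, 8, 9}. dst (p 0) (p i) = 2"
    using 2[of 4 1] 2[of 5 1] 2[of 6 2] 2[of 7 2] 2[of 8 3] 2[of 9 3]
    by (simp add: neighbours_def)
  have leaf: "\<forall>i\<in>{10, 11, 12, 13, 14, 15, 16, 17, 18, 19, 20, 21}. dst (p 0) (p i) = 3"
    using 3[of 10 1 4] 3[of 11 1 4] 3[of 12 1 5] 3[of 13 1 5] 3[of 14 2 6] 3[of 15 2 6] 3[of 16 2 7] 3[of 17 2 7] 3[of 18 3 8] 3[of 19 3 8] 3[of 20 3 9] 3[of 21 3 9]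
    by (simp add: neighbours_def)
  have "dst (p 0) (p 22) = 4"
    using 4[of 11] mid leaf by (simp add: neighbours_def)
  moreover have "dst (p 0) (p 23) = 4"
    using 4[of 12] mid leaf by (simp add: neighbours_def)
  moreover have "dst (p 0) (p 24) = 4"
    using 4[of 14] mid leaf by (simp add: neighbours_def)
  moreover have "dst (p 0) (p 25) = 4"
    using 4[of 13] mid leaf by (simp add: neighbours_def)
  moreover have "dst (p 0) (p 26) = 4"
    using 4[of 10] mid leaf by (simp add: neighbours_def)
  moreover have "dst (p 0) (p 27) = 4"
    using 4[of 16] mid leaf by (simp add: neighbours_def)
  ultimately show ?thesis
    unfolding all_less_28 using 1 mid leaf by (simp add: level_def)
qed

lemma Gam_p: "Gam adj k (p 0) = p ` {i. i < 28 \<and> level i = k}"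
proof
  show "Gam adj k (p 0) \<subseteq> p ` {i. i < 28 \<and> level i = k}"
  proof
    fix v assume "v \<in> Gam adj k (p 0)"
    moreover obtain i where "i < 28" "v = p i" by (rule p_surj)
    ultimately show "v \<in> p ` {i. i < 28 \<and> level i = k}" using dist_level by (simp add: Gam_def)
  qed
  show "p ` {i. i < 28 \<and> level i = k} \<subseteq> Gam adj k (p 0)"
    using dist_level by (auto simp: Gam_def)
qed

lemma vec_eq_p: "(u :: complex^'v) = w \<longleftrightarrow> (\<forall>i<28. u $ p i = w $ p i)"
  unfolding vec_eq_iff by (metis p_surj)

lemma adjacency_mult_vec:
  assumes "i < 28"
  shows "(adjacency_matrix adj *v u) $ p i = (\<Sum>j\<leftarrow>neighbours ! i. u $ p j)"
proof -
  have "(adjacency_matrix adj *v u) $ p i = (\<Sum>w\<in>UNIV. if adj (p i) w then u $ w else 0)"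
    unfolding adjacency_matrix_def matrix_vector_mult_def by (auto intro!: sum.cong)
  also have "\<dots> = sum (($) u) {w. adj (p i) w}"
    by (simp add: sum.If_cases)
  also have "\<dots> = (\<Sum>j\<in>set (neighbours ! i). u $ p j)"
    unfolding neighbours_set[OF assms]
    by (subst sum.reindex) (use neighbours_sorted assms p_inj in \<open>auto simp: inj_on_def subset_iff\<close>)
  also have "\<dots> = (\<Sum>j\<leftarrow>neighbours ! i. u $ p j)"
    using neighbours_sorted assms by (simp add: sum_list_distinct_conv_sum_set)
  finally show ?thesis .
qed

abbreviation A where "A \<equiv> adjacency_matrix adj"
abbreviation E where "E \<equiv> Estar adj (p 0)"

lemma A_p:
  "(A *v u) $ p 0 = u $ p 1 + u $ p 2 + u $ p 3"
  "(A *v u) $ p 1 = u $ p 0 + u $ p 4 + u $ p 5"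
  "(A *v u) $ p 2 = u $ p 0 + u $ p 6 + u $ p 7"
  "(A *v u) $ p 3 = u $ p 0 + u $ p 8 + u $ p 9"
  "(A *v u) $ p 4 = u $ p 1 + u $ p 10 + u $ p 11"
  "(A *v u) $ p 5 = u $ p 1 + u $ p 12 + u $ p 13"
  "(A *v u) $ p 6 = u $ p 2 + u $ p 14 + u $ p 15"
  "(A *v u) $ p 7 = u $ p 2 + u $ p 16 + u $ p 17"
  "(A *v u) $ p 8 = u $ p 3 + u $ p 18 + u $ p 19"
  "(A *v u) $ p 9 = u $ p 3 + u $ p 20 + u $ p 21"
  "(A *v u) $ p 10 = u $ p 4 + u $ p 20 + u $ p 26"
  "(A *v u) $ p 11 = u $ p 4 + u $ p 16 + u $ p 22"
  "(A *v u) $ p 12 = u $ p 5 + u $ p 18 + u $ p 23"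
  "(A *v u) $ p 13 = u $ p 5 + u $ p 14 + u $ p 25"
  "(A *v u) $ p 14 = u $ p 6 + u $ p 13 + u $ p 24"
  "(A *v u) $ p 15 = u $ p 6 + u $ p 19 + u $ p 26"
  "(A *v u) $ p 16 = u $ p 7 + u $ p 11 + u $ p 27"
  "(A *v u) $ p 17 = u $ p 7 + u $ p 21 + u $ p 23"
  "(A *v u) $ p 18 = u $ p 8 + u $ p 12 + u $ p 27"
  "(A *v u) $ p 19 = u $ p 8 + u $ p 15 + u $ p 22"
  "(A *v u) $ p 20 = u $ p 9 + u $ p 10 + u $ p 24"
  "(A *v u) $ p 21 = u $ p 9 + u $ p 17 + u $ p 25"
  "(A *v u) $ p 22 = u $ p 11 + u $ p 19 + u $ p 25"
  "(A *v u) $ p 23 = u $ p 12 + u $ p 17 + u $ p 26"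
  "(A *v u) $ p 24 = u $ p 14 + u $ p 20 + u $ p 27"
  "(A *v u) $ p 25 = u $ p 13 + u $ p 21 + u $ p 22"
  "(A *v u) $ p 26 = u $ p 10 + u $ p 15 + u $ p 23"
  "(A *v u) $ p 27 = u $ p 16 + u $ p 18 + u $ p 24"
  by (simp_all add: adjacency_mult_vec neighbours_def)

lemma E_p: "i < 28 \<Longrightarrow> (E k *v u) $ p i = (if level i = k then u $ p i else 0)"
  using dist_level by (simp add: Estar_mult_vec)

end

section \<open>Words in the generators\<close>

text \<open>Words stay lists of letters: membership in T is checked letter by letter, and reversing
  the list gives the adjoint when the letters are self-adjoint.\<close>

primrec chain :: "(complex^'v^'v) list \<Rightarrow> complex^'v^'v" where
  "chain [] = Finite_Cartesian_Product.mat 1"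
| "chain (M # Ms) = M ** chain Ms"

primrec combination :: "(complex \<times> (complex^'v^'v) list) list \<Rightarrow> complex^'v^'v" where
  "combination [] = 0"
| "combination (t # ts) = matrix_scale (fst t) (chain (snd t)) + combination ts"

lemma chain_mult_vec [simp]:
  "chain [] *v u = u"
  "chain (M # Ms) *v u = M *v (chain Ms *v u)"
  by (simp_all flip: matrix_vector_mul_assoc)

lemma combination_mult_vec [simp]:
  "combination [] *v u = 0"
  "combination ((c, Ms) # ts) *v u = c *s (chain Ms *v u) + combination ts *v u"
  by (simp_all add: matrix_vector_mult_add_rdistrib matrix_scale_mult_vec)

declare chain.simps [simp del] combination.simps [simp del]

lemma chain_closed: "matrix_subalgebra T \<Longrightarrow> set Ms \<subseteq> T \<Longrightarrow> chain Ms \<in> T"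
  by (induction Ms) (auto simp: matrix_subalgebra_def chain.simps)

lemma combination_closed:
  "matrix_subalgebra T \<Longrightarrow> \<forall>(c, Ms)\<in>set ts. set Ms \<subseteq> T \<Longrightarrow> combination ts \<in> T"
  by (induction ts) (auto simp: combination.simps matrix_subalgebra_def chain_closed cmat.subspace_0
      intro!: cmat.subspace_add cmat.subspace_scale chain_closed)

lemma herm_chain:
  "(\<And>M u w. M \<in> set Ms \<Longrightarrow> herm (M *v u) w = herm u (M *v w)) \<Longrightarrow>
   herm (chain Ms *v u) w = herm u (chain (rev Ms) *v w)"
proof (induction Ms arbitrary: u w)
  case (Cons M Ms)
  have append: "chain (Ks @ Ls) *v w = chain Ks *v (chain Ls *v w)" for Ks Ls :: "(complex^'a^'a) list"
    by (induction Ks) simp_all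
  show ?case using Cons by (simp add: append)
qed simp

text \<open>
  For each type \<open>k\<close>: the words that produce the basis from the seed, the projection onto the seeds, and
  the words that lead from the basis back to the seed. The coefficients of a projection solve the linear system
  which says that it fixes the seeds of its type and annihilates all other basis vectors; they are chosen
  symmetric under reversal of the words, so that the projection is self-adjoint.
\<close>

definition words :: "complex^'v^'v \<Rightarrow> (nat \<Rightarrow> complex^'v^'v) \<Rightarrow> nat \<Rightarrow> (complex \<times> (complex^'v^'v) list) list list" where
  "words A E k =
    [[[(1, [])], [(1, [E 1, A])], [(1, [E 2, A, E 1, A])], [(1, [E 3, A, E 2, A, E 1, A])],
      [(1 / 2, [E 4, A, E 3, A, E 2, A, E 1, A])]],
     [[(1, [])], [(1, [A])], [(1, [E 3, A, A])], [(1, [E 3, A, A, A])], [(1, [E 4, A, A, A])]],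
     [[(1, [])], [(1, [A])]],
     [[(1, [])], [(1, [A])], [(1, [E 3, A, A])], [(1, [E 4, A, A])]],
     [[(1, [])]],
     [[(1, [])], [(1, [E 4, A])]]] ! k"

definition projection :: "complex^'v^'v \<Rightarrow> (nat \<Rightarrow> complex^'v^'v) \<Rightarrow> nat \<Rightarrow> (complex \<times> (complex^'v^'v) list) list" where
  "projection A E k =
    [[(1, [E 0])],
     [(1, [E 1]), (- 1 / 3, [E 1, A, E 0, A, E 1])],
     [(1 / 3, [E 2]), (1 / 3, [E 2, A, E 3, A, E 3, A, E 2]), (- 1 / 6, [E 2, A, E 1, A, E 0, A, E 1, A, E 2])],
     [(2 / 3, [E 2]), (- 1 / 3, [E 2, A, E 3, A, E 3, A, E 2]), (- 1 / 2, [E 2, A, E 1, A, E 2]),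
      (1 / 6, [E 2, A, E 1, A, E 0, A, E 1, A, E 2])],
     [(1 / 3, [E 3]), (- 2 / 3, [E 3, A, E 3]), (- 1 / 6, [E 3, A, E 2, A, E 3]),
      (1 / 6, [E 3, A, E 3, A, E 2, A, E 3]), (1 / 6, [E 3, A, E 2, A, E 3, A, E 3]),
      (1 / 6, [E 3, A, E 3, A, E 4, A, E 3]), (1 / 6, [E 3, A, E 4, A, E 3, A, E 3]),
      (- 1 / 6, [E 3, A, E 3, A, E 4, A, E 3, A, E 3]), (1 / 6, [E 3, A, E 2, A, E 1, A, E 2, A, E 3]),
      (- 1 / 12, [E 3, A, E 2, A, E 1, A, E 0, A, E 1, A, E 2, A, E 3])],
     [(1 / 6, [E 3]), (1 / 6, [E 3, A, E 3]), (- 1 / 6, [E 3, A, E 3, A, E 2, A, E 3, A, E 3]),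
      (- 1 / 6, [E 3, A, E 3, A, E 4, A, E 3]), (- 1 / 6, [E 3, A, E 4, A, E 3, A, E 3]),
      (1 / 6, [E 3, A, E 3, A, E 4, A, E 3, A, E 3]), (- 1 / 6, [E 3, A, E 2, A, E 1, A, E 2, A, E 3]),
      (1 / 12, [E 3, A, E 2, A, E 1, A, E 0, A, E 1, A, E 2, A, E 3])]] ! k"

text \<open>In types II and IV the part in Gamma_3(x) is two-dimensional. Direct descent, and
  descent after one step inside Gamma_3(x), give the matrices with rows (4, -2), (-2, 4) in type II
  and (2, -1), (-1, 2) in type IV; the coefficients there are the entries of the inverses.\<close>

definition lowering :: "complex^'v^'v \<Rightarrow> (nat \<Rightarrow> complex^'v^'v) \<Rightarrow> nat \<Rightarrow> (complex \<times> (complex^'v^'v) list) list list" where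
  "lowering A E k =
    [[[(1, [])], [(1 / 3, [E 0, A, E 1])], [(1 / 6, [E 0, A, E 1, A, E 2])],
      [(1 / 12, [E 0, A, E 1, A, E 2, A, E 3])], [(1 / 12, [E 0, A, E 1, A, E 2, A, E 3, A, E 4])]],
     [[(1, [])], [(1 / 2, [E 1, A, E 2])],
      [(1 / 3, [E 1, A, E 2, A, E 3]), (1 / 6, [E 1, A, E 2, A, E 3, A, E 3])],
      [(1 / 6, [E 1, A, E 2, A, E 3]), (1 / 3, [E 1, A, E 2, A, E 3, A, E 3])],
      [(1 / 2, [E 1, A, E 2, A, E 3, A, E 4])]],
     [[(1, [])], [(1 / 2, [E 2, A, E 3])]],
     [[(1, [])], [(2 / 3, [E 2, A, E 3]), (1 / 3, [E 2, A, E 3, A, E 3])],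
      [(1 / 3, [E 2, A, E 3]), (2 / 3, [E 2, A, E 3, A, E 3])], [(1 / 3, [E 2, A, E 3, A, E 4])]],
     [[(1, [])]],
     [[(1, [])], [(1 / 2, [E 3, A, E 4])]]] ! k"

lemma all_less_6: "(\<forall>k<6. Q k) \<longleftrightarrow> Q 0 \<and> Q 1 \<and> Q 2 \<and> Q 3 \<and> Q 4 \<and> Q (5 :: nat)"
  by (auto simp: All_less_Suc eval_nat_numeral)

lemma mult_vec_minus: "(M :: complex^'n^'m) *v (- u) = - (M *v u)"
  by (simp add: matrix_vector_mult_def vec_eq_iff sum_negf)

lemmas mult_vec_linear = mult_vec_minus matrix_vector_mult_diff_distrib vec.scale_right_diff_distrib
  matrix_vector_right_distrib vector_scalar_commute vector_smult_assoc vec.scale_right_distrib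

context
  fixes A :: "complex^'v^'v" and E :: "nat \<Rightarrow> complex^'v^'v"
begin

text \<open>The six projections are evaluated once on the listed vectors. Lowering words send these
  vectors to combinations of them, so the values of the projections settle every case. The lemmas
  for the other types follow the same scheme.\<close>

lemma dual_type_I:
  assumes A: "A *v b0 = b1" "A *v b1 = 3 *s b0 + b2" "A *v b2 = 2 *s b1 + b3" "A *v b3 = 2 *s b2 + b3 + 2 *s b4" "A *v b4 = b3 + b4"
    and E: "\<And>n. E n *v b0 = (if n = 0 then b0 else 0)" "\<And>n. E n *v b1 = (if n = 1 then b1 else 0)" "\<And>n. E n *v b2 = (if n = 2 then b2 else 0)" "\<And>n. E n *v b3 = (if n = 3 then b3 else 0)" "\<And>n. E n *v b4 = (if n = 4 then b4 else 0)"
  shows "\<forall>k<6. \<forall>i<length (lowering A E k). \<forall>j<5. combination (projection A E k) *v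
    (combination (lowering A E k ! i) *v ([b0, b1, b2, b3, b4] ! j)) = (if k = 0 \<and> i = j then b0 else 0)"
proof -
  have P: "\<forall>k<6. combination (projection A E k) *v b0 = (if k = 0 then b0 else 0) \<and> combination (projection A E k) *v b1 = 0 \<and> combination (projection A E k) *v b2 = 0 \<and> combination (projection A E k) *v b3 = 0 \<and> combination (projection A E k) *v b4 = 0"
    unfolding all_less_6 projection_def by (simp add: A E mult_vec_linear; simp add: vec_eq_iff)
  show ?thesis
    unfolding all_less_6 lowering_def by (simp add: All_less_Suc eval_nat_numeral A E mult_vec_linear P; simp add: vec_eq_iff)
qed

text \<open>Projection 1 is \<open>E 1\<close> minus the averaging operator of Gamma_1(x): the word
  through \<open>E 0\<close> acts as 3 on the type I vector there and as 0 on the seeds of type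
  II.\<close>

lemma dual_type_II:
  assumes A: "A *v b0 = b1" "A *v b1 = 2 *s b0 + b2" "A *v b2 = 2 *s b1 + b3 + b4" "A *v b3 = (-1) *s b1 + b2 + (-2) *s b4" "A *v b4 = (-1) *s b3 + b4"
    and E: "\<And>n. E n *v b0 = (if n = 1 then b0 else 0)" "\<And>n. E n *v b1 = (if n = 2 then b1 else 0)" "\<And>n. E n *v b2 = (if n = 3 then b2 else 0)" "\<And>n. E n *v b3 = (if n = 3 then b3 else 0)" "\<And>n. E n *v b4 = (if n = 4 then b4 else 0)"
  shows "\<forall>k<6. \<forall>i<length (lowering A E k). \<forall>j<5. combination (projection A E k) *v
    (combination (lowering A E k ! i) *v ([b0, b1, b2, b3, b4] ! j)) = (if k = 1 \<and> i = j then b0 else 0)"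
proof -
  have P: "\<forall>k<6. combination (projection A E k) *v b0 = (if k = 1 then b0 else 0) \<and> combination (projection A E k) *v b1 = 0 \<and> combination (projection A E k) *v b2 = 0 \<and> combination (projection A E k) *v b3 = 0 \<and> combination (projection A E k) *v b4 = 0"
    unfolding all_less_6 projection_def by (simp add: A E mult_vec_linear; simp add: vec_eq_iff)
  show ?thesis
    unfolding all_less_6 lowering_def by (simp add: All_less_Suc eval_nat_numeral A E mult_vec_linear P; simp add: vec_eq_iff)
qed

text \<open>On Gamma_2(x) the word with two factors \<open>E 3\<close> acts as 2 on types I and III
  and as -1 on types II and IV, and the word through \<open>E 0\<close> acts as 6 on type I and as 0
  otherwise. This explains the coefficients of projection 2.\<close>

lemma dual_type_III:
  assumes A: "A *v b0 = b1" "A *v b1 = 2 *s b0 + b1"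
    and E: "\<And>n. E n *v b0 = (if n = 2 then b0 else 0)" "\<And>n. E n *v b1 = (if n = 3 then b1 else 0)"
  shows "\<forall>k<6. \<forall>i<length (lowering A E k). \<forall>j<2. combination (projection A E k) *v
    (combination (lowering A E k ! i) *v ([b0, b1] ! j)) = (if k = 2 \<and> i = j then b0 else 0)"
proof -
  have P: "\<forall>k<6. combination (projection A E k) *v b0 = (if k = 2 then b0 else 0) \<and> combination (projection A E k) *v b1 = 0"
    unfolding all_less_6 projection_def by (simp add: A E mult_vec_linear; simp add: vec_eq_iff)
  show ?thesis
    unfolding all_less_6 lowering_def by (simp add: All_less_Suc eval_nat_numeral A E mult_vec_linear P; simp add: vec_eq_iff)
qed

text \<open>The additional word \<open>E 2, A, E 1, A, E 2\<close> acts as 2 on types I and II and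
  as 0 on types III and IV; with the two words of projection 2 it isolates type IV.\<close>

lemma dual_type_IV:
  assumes A: "A *v b0 = b1" "A *v b1 = 2 *s b0 + b2 + b3" "A *v b2 = (-1) *s b0 + b1" "A *v b3 = 2 *s b1 + b2 + (-1) *s b3"
    and E: "\<And>n. E n *v b0 = (if n = 2 then b0 else 0)" "\<And>n. E n *v b1 = (if n = 3 then b1 else 0)" "\<And>n. E n *v b2 = (if n = 3 then b2 else 0)" "\<And>n. E n *v b3 = (if n = 4 then b3 else 0)"
  shows "\<forall>k<6. \<forall>i<length (lowering A E k). \<forall>j<4. combination (projection A E k) *v
    (combination (lowering A E k ! i) *v ([b0, b1, b2, b3] ! j)) = (if k = 3 \<and> i = j then b0 else 0)"
proof -
  have P: "\<forall>k<6. combination (projection A E k) *v b0 = (if k = 3 then b0 else 0) \<and> combination (projection A E k) *v b1 = 0 \<and> combination (projection A E k) *v b2 = 0 \<and> combination (projection A E k) *v b3 = 0"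
    unfolding all_less_6 projection_def by (simp add: A E mult_vec_linear; simp add: vec_eq_iff)
  show ?thesis
    unfolding all_less_6 lowering_def by (simp add: All_less_Suc eval_nat_numeral A E mult_vec_linear P; simp add: vec_eq_iff)
qed

text \<open>Projections 4 and 5 take more words because they must vanish on the two-dimensional
  parts of types II and IV in Gamma_3(x), that is, as 2 by 2 matrices.\<close>

lemma dual_type_V:
  assumes A: "A *v b0 = (-1) *s b0"
    and E: "\<And>n. E n *v b0 = (if n = 3 then b0 else 0)"
  shows "\<forall>k<6. \<forall>i<length (lowering A E k). \<forall>j<1. combination (projection A E k) *v
    (combination (lowering A E k ! i) *v ([b0] ! j)) = (if k = 4 \<and> i = j then b0 else 0)"
proof -
  have P: "\<forall>k<6. combination (projection A E k) *v b0 = (if k = 4 then b0 else 0)"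
    unfolding all_less_6 projection_def by (simp add: A E mult_vec_linear; simp add: vec_eq_iff)
  show ?thesis
    unfolding all_less_6 lowering_def by (simp add: All_less_Suc eval_nat_numeral A E mult_vec_linear P; simp add: vec_eq_iff)
qed

lemma dual_type_VI:
  assumes A: "A *v b0 = (-1) *s b0 + b1" "A *v b1 = 2 *s b0 + (-1) *s b1"
    and E: "\<And>n. E n *v b0 = (if n = 3 then b0 else 0)" "\<And>n. E n *v b1 = (if n = 4 then b1 else 0)"
  shows "\<forall>k<6. \<forall>i<length (lowering A E k). \<forall>j<2. combination (projection A E k) *v
    (combination (lowering A E k ! i) *v ([b0, b1] ! j)) = (if k = 5 \<and> i = j then b0 else 0)"
proof -
  have P: "\<forall>k<6. combination (projection A E k) *v b0 = (if k = 5 then b0 else 0) \<and> combination (projection A E k) *v b1 = 0"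
    unfolding all_less_6 projection_def by (simp add: A E mult_vec_linear; simp add: vec_eq_iff)
  show ?thesis
    unfolding all_less_6 lowering_def by (simp add: All_less_Suc eval_nat_numeral A E mult_vec_linear P; simp add: vec_eq_iff)
qed

end

section \<open>Eigenvalues\<close>

abbreviation sqrt2 :: complex where "sqrt2 \<equiv> complex_of_real (sqrt 2)"

definition action_rows :: "nat \<Rightarrow> complex list list" where
  "action_rows k =
    [[[0, 3, 0, 0, 0], [1, 0, 2, 0, 0], [0, 1, 0, 2, 0], [0, 0, 1, 1, 1], [0, 0, 0, 2, 1]],
     [[0, 2, 0, 0, 0], [1, 0, 2, - 1, 0], [0, 1, 0, 1, 0], [0, 0, 1, 0, - 1], [0, 0, 1, - 2, 1]],
     [[0, 2], [1, 1]],
     [[0, 2, - 1, 0], [1, 0, 1, 2], [0, 1, 0, 1], [0, 1, 0, - 1]],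
     [[- 1]],
     [[- 1, 2], [1, - 1]]] ! k"

abbreviation action_matrix :: "nat \<Rightarrow> complex Matrix.mat" where
  "action_matrix k \<equiv> mat_of_rows_list (length (action_rows k)) (action_rows k)"

definition eigenvalues :: "nat \<Rightarrow> complex list" where
  "eigenvalues k =
    [[3, 2, - 1 + sqrt2, - 1, - 1 - sqrt2],
     [2, 2, - 1 + sqrt2, - 1, - 1 - sqrt2],
     [2, - 1],
     [2, - 1 + sqrt2, - 1, - 1 - sqrt2],
     [- 1],
     [- 1 + sqrt2, - 1 - sqrt2]] ! k"

text \<open>Right eigenvectors in the columns, left eigenvectors in the rows.\<close>

definition right_eigenvectors :: "nat \<Rightarrow> complex list list" where
  "right_eigenvectors k =
    [[[1, - 3, 6 - 3 * sqrt2, - 3, 6 + 3 * sqrt2],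
      [1, - 2, - 4 + 3 * sqrt2, 1, - 4 - 3 * sqrt2],
      [1, - 1 / 2, 2 - 2 * sqrt2, 1, 2 + 2 * sqrt2],
      [1, 1 / 2, - 1 + sqrt2 / 2, - 1, - 1 - sqrt2 / 2],
      [1, 1, 1, 1, 1]],
     [[3, 2, - 2, 2, - 2],
      [3, 2, 1 - sqrt2, - 1, 1 + sqrt2],
      [2, 1, sqrt2, 0, - sqrt2],
      [1, 0, 1, 1, 1],
      [0, 1, 1, 1, 1]],
     [[1, - 2],
      [1, 1]],
     [[2, - 3 - 3 * sqrt2, - 1, - 3 + 3 * sqrt2],
      [3, sqrt2, 0, - sqrt2],
      [2, 3 + 2 * sqrt2, - 1, 3 - 2 * sqrt2],
      [1, 1, 1, 1]],
     [[1]],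
     [[sqrt2, - sqrt2],
      [1, 1]]] ! k"

definition left_eigenvectors :: "nat \<Rightarrow> complex list list" where
  "left_eigenvectors k =
    [[[1 / 28, 3 / 28, 3 / 14, 3 / 7, 3 / 14],
      [- 2 / 21, - 4 / 21, - 2 / 21, 4 / 21, 4 / 21],
      [1 / 14 + sqrt2 / 28, sqrt2 / 28, - 1 / 7 - sqrt2 / 7, - 1 / 7 - sqrt2 / 14, 3 / 14 + sqrt2 / 7],
      [- 1 / 12, 1 / 12, 1 / 6, - 1 / 3, 1 / 6],
      [1 / 14 - sqrt2 / 28, - sqrt2 / 28, - 1 / 7 + sqrt2 / 7, - 1 / 7 + sqrt2 / 14, 3 / 14 - sqrt2 / 7]],
     [[1 / 21, 2 / 21, 2 / 21, 8 / 21, - 8 / 21],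
      [1 / 21, 2 / 21, 2 / 21, - 13 / 21, 13 / 21],
      [- 3 / 28 - sqrt2 / 28, 1 / 28 - sqrt2 / 14, 1 / 28 + 5 * sqrt2 / 28, 1 / 7 - sqrt2 / 28, 3 / 28 + sqrt2 / 28],
      [1 / 6, - 1 / 6, - 1 / 6, 1 / 3, 1 / 6],
      [- 3 / 28 + sqrt2 / 28, 1 / 28 + sqrt2 / 14, 1 / 28 - 5 * sqrt2 / 28, 1 / 7 + sqrt2 / 28, 3 / 28 - sqrt2 / 28]],
     [[1 / 3, 2 / 3],
      [- 1 / 3, 1 / 3]],
     [[2 / 21, 4 / 21, 1 / 21, 1 / 7],
      [1 / 28 - sqrt2 / 14, - 5 / 28 + 3 * sqrt2 / 28, 1 / 7 - sqrt2 / 28, 5 / 28 - 3 * sqrt2 / 28],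
      [- 1 / 6, 1 / 6, - 1 / 3, 1 / 2],
      [1 / 28 + sqrt2 / 14, - 5 / 28 - 3 * sqrt2 / 28, 1 / 7 + sqrt2 / 28, 5 / 28 + 3 * sqrt2 / 28]],
     [[1]],
     [[sqrt2 / 4, 1 / 2],
      [- sqrt2 / 4, 1 / 2]]] ! k"

lemma sqrt2_square: "sqrt2 * sqrt2 = 2" "sqrt2 * (sqrt2 * c) = 2 * c"
  by (simp_all flip: of_real_mult mult.assoc)

lemma diagonalization_of_rows:
  assumes "length es = n" "length B = n" "length C = n" "length D = n"
    and DC: "\<forall>i<n. \<forall>j<n. (\<Sum>l<n. D ! i ! l * C ! l ! j) = (if i = j then 1 else 0)"
    and BC: "\<forall>i<n. \<forall>j<n. (\<Sum>l<n. B ! i ! l * C ! l ! j) = C ! i ! j * es ! j"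
  shows "diagonalization es (mat_of_rows_list n B) (mat_of_rows_list n C) (mat_of_rows_list n D)"
  unfolding diagonalization_def
proof (intro conjI)
  have C: "mat_of_rows_list n C \<in> carrier_mat n n" using assms by (simp add: mat_of_rows_list_def)
  show "mat_of_rows_list n D * mat_of_rows_list n C = 1\<^sub>m (length es)"
    by (rule eq_matI) (use assms in \<open>auto simp: mat_of_rows_list_def scalar_prod_def atLeast0LessThan\<close>)
  show "mat_of_rows_list n B * mat_of_rows_list n C = mat_of_rows_list n C * mat_diag (length es) ((!) es)"
    unfolding assms(1) mat_diag_mult_right[OF C]
    by (rule eq_matI) (use assms in \<open>auto simp: mat_of_rows_list_def scalar_prod_def atLeast0LessThan\<close>)
qed (use assms in \<open>simp add: mat_of_rows_list_def\<close>)

text \<open>In type II the eigenvalue 2 is double; the certificate provides two independent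
  eigenvectors for it.\<close>

lemma diagonalization_of_action:
  "\<forall>k<6. diagonalization (eigenvalues k) (action_matrix k)
     (mat_of_rows_list (length (action_rows k)) (right_eigenvectors k))
     (mat_of_rows_list (length (action_rows k)) (left_eigenvectors k))"
  unfolding all_less_6
  by (intro conjI diagonalization_of_rows)
     (simp_all add: action_rows_def eigenvalues_def right_eigenvectors_def left_eigenvectors_def
       All_less_Suc eval_nat_numeral, simp_all add: field_simps sqrt2_square)

definition supports :: "nat \<Rightarrow> nat list" where
  "supports k = [[0, 1, 2, 3, 4], [1, 2, 3, 3, 4], [2, 3], [2, 3, 3, 4], [3], [3, 4]] ! k"

section \<open>Seeds in coordinates and the action on the bases\<close>

context labelled_coxeter
begin

text \<open>Linear equations for the seeds in terms of labels. Type II: sum zero on Gamma_1(x). Type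
  III: constant on each triple y_1, y_4, y_6 and y_2, y_3, y_5, with opposite values. Type IV:
  opposite values on siblings and sum zero on each triple. Type VI: constant on S, opposite off S.
  Type V: as type VI with a sign change below y_2, y_3, y_5.\<close>

definition seed_pattern :: "nat \<Rightarrow> complex^'v \<Rightarrow> bool" where
  "seed_pattern k s \<longleftrightarrow> (\<forall>i<28. level i \<noteq> [0, 1, 2, 2, 3, 3] ! k \<longrightarrow> s $ p i = 0) \<and>
    [True,
     s $ p 3 = - s $ p 1 - s $ p 2,
     s $ p 5 = - s $ p 4 \<and> s $ p 6 = - s $ p 4 \<and> s $ p 7 = s $ p 4 \<and> s $ p 8 = - s $ p 4 \<and> s $ p 9 = s $ p 4,
     s $ p 5 = - s $ p 4 \<and> s $ p 6 = s $ p 4 - s $ p 8 \<and> s $ p 7 = s $ p 8 - s $ p 4 \<and> s $ p 9 = - s $ p 8,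
     s $ p 10 = - s $ p 11 \<and> s $ p 12 = - s $ p 11 \<and> s $ p 13 = s $ p 11 \<and> s $ p 14 = - s $ p 11 \<and> s $ p 15 = s $ p 11 \<and> s $ p 16 = - s $ p 11 \<and> s $ p 17 = s $ p 11 \<and> s $ p 18 = s $ p 11 \<and> s $ p 19 = - s $ p 11 \<and> s $ p 20 = s $ p 11 \<and> s $ p 21 = - s $ p 11,
     s $ p 10 = - s $ p 11 \<and> s $ p 12 = s $ p 11 \<and> s $ p 13 = - s $ p 11 \<and> s $ p 14 = s $ p 11 \<and> s $ p 15 = - s $ p 11 \<and> s $ p 16 = - s $ p 11 \<and> s $ p 17 = s $ p 11 \<and> s $ p 18 = - s $ p 11 \<and> s $ p 19 = s $ p 11 \<and> s $ p 20 = s $ p 11 \<and> s $ p 21 = - s $ p 11] ! k"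

lemma seed_pattern_subspace:
  assumes "k < 6"
  shows "vec.subspace {s. seed_pattern k s}"
proof -
  have "\<forall>k<6. vec.subspace {s. seed_pattern k s}"
    unfolding all_less_6 vec.subspace_def seed_pattern_def
    by (auto simp: right_diff_distrib)
  then show ?thesis using assms by blast
qed

text \<open>The label 1 appears as \<open>Suc 0\<close>, the form to which simplification brings it;
  \<open>A_p\<close> is adapted likewise in \<open>coordinates\<close>.\<close>

lemma E_levels:
  "(E k *v u) $ p 0 = (if k = 0 then u $ p 0 else 0)"
  "(E k *v u) $ p (Suc 0) = (if k = 1 then u $ p (Suc 0) else 0)"
  "(E k *v u) $ p 2 = (if k = 1 then u $ p 2 else 0)"
  "(E k *v u) $ p 3 = (if k = 1 then u $ p 3 else 0)"
  "(E k *v u) $ p 4 = (if k = 2 then u $ p 4 else 0)"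
  "(E k *v u) $ p 5 = (if k = 2 then u $ p 5 else 0)"
  "(E k *v u) $ p 6 = (if k = 2 then u $ p 6 else 0)"
  "(E k *v u) $ p 7 = (if k = 2 then u $ p 7 else 0)"
  "(E k *v u) $ p 8 = (if k = 2 then u $ p 8 else 0)"
  "(E k *v u) $ p 9 = (if k = 2 then u $ p 9 else 0)"
  "(E k *v u) $ p 10 = (if k = 3 then u $ p 10 else 0)"
  "(E k *v u) $ p 11 = (if k = 3 then u $ p 11 else 0)"
  "(E k *v u) $ p 12 = (if k = 3 then u $ p 12 else 0)"
  "(E k *v u) $ p 13 = (if k = 3 then u $ p 13 else 0)"
  "(E k *v u) $ p 14 = (if k = 3 then u $ p 14 else 0)"
  "(E k *v u) $ p 15 = (if k = 3 then u $ p 15 else 0)"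
  "(E k *v u) $ p 16 = (if k = 3 then u $ p 16 else 0)"
  "(E k *v u) $ p 17 = (if k = 3 then u $ p 17 else 0)"
  "(E k *v u) $ p 18 = (if k = 3 then u $ p 18 else 0)"
  "(E k *v u) $ p 19 = (if k = 3 then u $ p 19 else 0)"
  "(E k *v u) $ p 20 = (if k = 3 then u $ p 20 else 0)"
  "(E k *v u) $ p 21 = (if k = 3 then u $ p 21 else 0)"
  "(E k *v u) $ p 22 = (if k = 4 then u $ p 22 else 0)"
  "(E k *v u) $ p 23 = (if k = 4 then u $ p 23 else 0)"
  "(E k *v u) $ p 24 = (if k = 4 then u $ p 24 else 0)"
  "(E k *v u) $ p 25 = (if k = 4 then u $ p 25 else 0)"
  "(E k *v u) $ p 26 = (if k = 4 then u $ p 26 else 0)"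
  "(E k *v u) $ p 27 = (if k = 4 then u $ p 27 else 0)"
  by (simp_all add: E_p level_def)

lemma E_E: "E n *v (E k *v u) = (if n = k then E k *v u else 0)"
  by (simp add: vec_eq_iff Estar_mult_vec)

lemma E_seed:
  assumes "seed_pattern k s"
  shows "E n *v s = (if n = [0, 1, 2, 2, 3, 3] ! k then s else 0)"
  using assms unfolding vec_eq_p seed_pattern_def by (auto simp: E_p)

lemmas coordinates = vec_eq_p all_less_28 A_p[unfolded One_nat_def] E_levels level_def seed_pattern_def words_def

text \<open>Both sides are compared at all 28 labels while the free coordinates of the seed stay
  symbolic, so one computation covers every seed of the type. The lemmas for the other types work in
  the same way.\<close>

lemma action_type_I:
  fixes s :: "complex^'v"
  assumes "seed_pattern 0 s"
  defines "b \<equiv> \<lambda>i. combination (words A E 0 ! i) *v s"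
  shows "A *v b 0 = b 1" "A *v b 1 = 3 *s b 0 + b 2" "A *v b 2 = 2 *s b 1 + b 3" "A *v b 3 = 2 *s b 2 + b 3 + 2 *s b 4" "A *v b 4 = b 3 + b 4"
    "\<And>n. E n *v b 0 = (if n = 0 then b 0 else 0)" "\<And>n. E n *v b 1 = (if n = 1 then b 1 else 0)" "\<And>n. E n *v b 2 = (if n = 2 then b 2 else 0)" "\<And>n. E n *v b 3 = (if n = 3 then b 3 else 0)" "\<And>n. E n *v b 4 = (if n = 4 then b 4 else 0)"
proof -
  show "A *v b 0 = b 1" "A *v b 1 = 3 *s b 0 + b 2" "A *v b 2 = 2 *s b 1 + b 3" "A *v b 3 = 2 *s b 2 + b 3 + 2 *s b 4" "A *v b 4 = b 3 + b 4"
    using assms(1) unfolding b_def by (simp_all add: coordinates)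
  show "\<And>n. E n *v b 0 = (if n = 0 then b 0 else 0)" "\<And>n. E n *v b 1 = (if n = 1 then b 1 else 0)" "\<And>n. E n *v b 2 = (if n = 2 then b 2 else 0)" "\<And>n. E n *v b 3 = (if n = 3 then b 3 else 0)" "\<And>n. E n *v b 4 = (if n = 4 then b 4 else 0)"
    unfolding b_def words_def using E_seed[OF assms(1)] E_E by (simp_all add: vector_scalar_commute)
qed

lemma action_type_II:
  fixes s :: "complex^'v"
  assumes "seed_pattern 1 s"
  defines "b \<equiv> \<lambda>i. combination (words A E 1 ! i) *v s"
  shows "A *v b 0 = b 1" "A *v b 1 = 2 *s b 0 + b 2" "A *v b 2 = 2 *s b 1 + b 3 + b 4" "A *v b 3 = (-1) *s b 1 + b 2 + (-2) *s b 4" "A *v b 4 = (-1) *s b 3 + b 4"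
    "\<And>n. E n *v b 0 = (if n = 1 then b 0 else 0)" "\<And>n. E n *v b 1 = (if n = 2 then b 1 else 0)" "\<And>n. E n *v b 2 = (if n = 3 then b 2 else 0)" "\<And>n. E n *v b 3 = (if n = 3 then b 3 else 0)" "\<And>n. E n *v b 4 = (if n = 4 then b 4 else 0)"
proof -
  \<comment> \<open>The coordinates of the seed on Gamma_1(x) sum to 0, so \<open>A *v s\<close>
    vanishes at the base vertex.\<close>
  have "E 2 *v (A *v s) = A *v s"
    using assms(1) by (simp add: coordinates)
  then have *: "E n *v (A *v s) = (if n = 2 then A *v s else 0)" for n
    using E_E[of n 2 "A *v s"] by simp
  show "A *v b 0 = b 1" "A *v b 1 = 2 *s b 0 + b 2" "A *v b 2 = 2 *s b 1 + b 3 + b 4" "A *v b 3 = (-1) *s b 1 + b 2 + (-2) *s b 4" "A *v b 4 = (-1) *s b 3 + b 4"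
    using assms(1) unfolding b_def by (simp_all add: coordinates)
  show "\<And>n. E n *v b 0 = (if n = 1 then b 0 else 0)" "\<And>n. E n *v b 1 = (if n = 2 then b 1 else 0)" "\<And>n. E n *v b 2 = (if n = 3 then b 2 else 0)" "\<And>n. E n *v b 3 = (if n = 3 then b 3 else 0)" "\<And>n. E n *v b 4 = (if n = 4 then b 4 else 0)"
    unfolding b_def words_def using E_seed[OF assms(1)] E_E * by (simp_all add: vector_scalar_commute)
qed

lemma action_type_III:
  fixes s :: "complex^'v"
  assumes "seed_pattern 2 s"
  defines "b \<equiv> \<lambda>i. combination (words A E 2 ! i) *v s"
  shows "A *v b 0 = b 1" "A *v b 1 = 2 *s b 0 + b 1"
    "\<And>n. E n *v b 0 = (if n = 2 then b 0 else 0)" "\<And>n. E n *v b 1 = (if n = 3 then b 1 else 0)"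
proof -
  \<comment> \<open>Siblings carry opposite values, so \<open>A *v s\<close> vanishes on
    Gamma_1(x).\<close>
  have "E 3 *v (A *v s) = A *v s"
    using assms(1) by (simp add: coordinates)
  then have *: "E n *v (A *v s) = (if n = 3 then A *v s else 0)" for n
    using E_E[of n 3 "A *v s"] by simp
  show "A *v b 0 = b 1" "A *v b 1 = 2 *s b 0 + b 1"
    using assms(1) unfolding b_def by (simp_all add: coordinates)
  show "\<And>n. E n *v b 0 = (if n = 2 then b 0 else 0)" "\<And>n. E n *v b 1 = (if n = 3 then b 1 else 0)"
    unfolding b_def words_def using E_seed[OF assms(1)] E_E * by (simp_all add: vector_scalar_commute)
qed

lemma action_type_IV:
  fixes s :: "complex^'v"
  assumes "seed_pattern 3 s"
  defines "b \<equiv> \<lambda>i. combination (words A E 3 ! i) *v s"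
  shows "A *v b 0 = b 1" "A *v b 1 = 2 *s b 0 + b 2 + b 3" "A *v b 2 = (-1) *s b 0 + b 1" "A *v b 3 = 2 *s b 1 + b 2 + (-1) *s b 3"
    "\<And>n. E n *v b 0 = (if n = 2 then b 0 else 0)" "\<And>n. E n *v b 1 = (if n = 3 then b 1 else 0)" "\<And>n. E n *v b 2 = (if n = 3 then b 2 else 0)" "\<And>n. E n *v b 3 = (if n = 4 then b 3 else 0)"
proof -
  have "E 3 *v (A *v s) = A *v s"
    using assms(1) by (simp add: coordinates)
  then have *: "E n *v (A *v s) = (if n = 3 then A *v s else 0)" for n
    using E_E[of n 3 "A *v s"] by simp
  show "A *v b 0 = b 1" "A *v b 1 = 2 *s b 0 + b 2 + b 3" "A *v b 2 = (-1) *s b 0 + b 1" "A *v b 3 = 2 *s b 1 + b 2 + (-1) *s b 3"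
    using assms(1) unfolding b_def by (simp_all add: coordinates)
  show "\<And>n. E n *v b 0 = (if n = 2 then b 0 else 0)" "\<And>n. E n *v b 1 = (if n = 3 then b 1 else 0)" "\<And>n. E n *v b 2 = (if n = 3 then b 2 else 0)" "\<And>n. E n *v b 3 = (if n = 4 then b 3 else 0)"
    unfolding b_def words_def using E_seed[OF assms(1)] E_E * by (simp_all add: vector_scalar_commute)
qed

lemma action_type_V:
  fixes s :: "complex^'v"
  assumes "seed_pattern 4 s"
  defines "b \<equiv> \<lambda>i. combination (words A E 4 ! i) *v s"
  shows "A *v b 0 = (-1) *s b 0"
    "\<And>n. E n *v b 0 = (if n = 3 then b 0 else 0)"
proof -
  show "A *v b 0 = (-1) *s b 0"
    using assms(1) unfolding b_def by (simp_all add: coordinates)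
  show "\<And>n. E n *v b 0 = (if n = 3 then b 0 else 0)"
    unfolding b_def words_def using E_seed[OF assms(1)] E_E by (simp_all add: vector_scalar_commute)
qed

lemma action_type_VI:
  fixes s :: "complex^'v"
  assumes "seed_pattern 5 s"
  defines "b \<equiv> \<lambda>i. combination (words A E 5 ! i) *v s"
  shows "A *v b 0 = (-1) *s b 0 + b 1" "A *v b 1 = 2 *s b 0 + (-1) *s b 1"
    "\<And>n. E n *v b 0 = (if n = 3 then b 0 else 0)" "\<And>n. E n *v b 1 = (if n = 4 then b 1 else 0)"
proof -
  show "A *v b 0 = (-1) *s b 0 + b 1" "A *v b 1 = 2 *s b 0 + (-1) *s b 1"
    using assms(1) unfolding b_def by (simp_all add: coordinates)
  show "\<And>n. E n *v b 0 = (if n = 3 then b 0 else 0)" "\<And>n. E n *v b 1 = (if n = 4 then b 1 else 0)"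
    unfolding b_def words_def using E_seed[OF assms(1)] E_E by (simp_all add: vector_scalar_commute)
qed

definition ws :: "nat \<Rightarrow> (complex^'v^'v) list" where
  "ws k = map combination (words A E k)"

text \<open>A lowering word alone may be nonzero on other types; the projection applied after it
  removes those contributions.\<close>

definition vs :: "nat \<Rightarrow> (complex^'v^'v) list" where
  "vs k = map (\<lambda>l. combination (projection A E k) ** combination l) (lowering A E k)"

lemma word_lengths:
  "\<forall>k<6. length (ws k) = length (supports k) \<and> length (vs k) = length (supports k) \<and> length (action_rows k) = length (supports k)"
  unfolding all_less_6 by (simp add: ws_def vs_def words_def lowering_def supports_def action_rows_def)

lemma word_0: "\<forall>k<6. ws k ! 0 = Finite_Cartesian_Product.mat 1"
  unfolding all_less_6
  by (simp add: ws_def words_def combination.simps chain.simps matrix_eq matrix_scale_mult_vec)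

lemma A_action:
  "\<forall>k<6. seed_pattern k s \<longrightarrow> (\<forall>i<length (supports k).
     A *v (ws k ! i *v s) = (\<Sum>j<length (supports k). action_matrix k $$ (j, i) *s (ws k ! j *v s)))"
  unfolding all_less_6
  using action_type_I(1-5)[of s] action_type_II(1-5)[of s] action_type_III(1-2)[of s] action_type_IV(1-4)[of s] action_type_V(1)[of s] action_type_VI(1-2)[of s]
  by (simp add: ws_def supports_def action_rows_def words_def mat_of_rows_list_def All_less_Suc eval_nat_numeral)

lemma E_action:
  "\<forall>k<6. seed_pattern k s \<longrightarrow> (\<forall>i<length (supports k).
     E n *v (ws k ! i *v s) = (if n = supports k ! i then ws k ! i *v s else 0))"
  unfolding all_less_6
  using action_type_I(6-)[of s] action_type_II(6-)[of s] action_type_III(3-)[of s] action_type_IV(5-)[of s] action_type_V(2-)[of s] action_type_VI(3-)[of s]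
  by (simp add: ws_def supports_def words_def All_less_Suc eval_nat_numeral)

lemma dual_action:
  "\<forall>l<6. seed_pattern l s \<longrightarrow> (\<forall>k<6. \<forall>i<length (supports k). \<forall>j<length (supports l).
     vs k ! i *v (ws l ! j *v s) = (if k = l \<and> i = j then s else 0))"
proof -
  have len: "\<forall>k<6. length (lowering A E k) = length (supports k)"
    unfolding all_less_6 by (simp add: lowering_def supports_def)
  have "\<forall>k<6. \<forall>i<length (lowering A E k). \<forall>j<5.
      vs k ! i *v (ws 0 ! j *v s) = (if k = 0 \<and> i = j then s else 0)" if "seed_pattern 0 s"
  proof -
    have "[combination (words A E 0 ! 0) *v s, combination (words A E 0 ! 1) *v s, combination (words A E 0 ! 2) *v s, combination (words A E 0 ! 3) *v s, combination (words A E 0 ! 4) *v s] ! j = ws 0 ! j *v s" if "j < 5" for j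
      using that by (auto simp: ws_def words_def less_Suc_eq numeral_eq_Suc)
    moreover have "combination (words A E 0 ! 0) *v s = s" by (simp add: words_def)
    ultimately show ?thesis
      using dual_type_I[OF action_type_I[OF that]] by (simp add: vs_def flip: matrix_vector_mul_assoc)
  qed
  moreover  have "\<forall>k<6. \<forall>i<length (lowering A E k). \<forall>j<5.
      vs k ! i *v (ws 1 ! j *v s) = (if k = 1 \<and> i = j then s else 0)" if "seed_pattern 1 s"
  proof -
    have "[combination (words A E 1 ! 0) *v s, combination (words A E 1 ! 1) *v s, combination (words A E 1 ! 2) *v s, combination (words A E 1 ! 3) *v s, combination (words A E 1 ! 4) *v s] ! j = ws 1 ! j *v s" if "j < 5" for j
      using that by (auto simp: ws_def words_def less_Suc_eq numeral_eq_Suc)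
    moreover have "combination (words A E 1 ! 0) *v s = s" by (simp add: words_def)
    ultimately show ?thesis
      using dual_type_II[OF action_type_II[OF that]] by (simp add: vs_def flip: matrix_vector_mul_assoc)
  qed
  moreover  have "\<forall>k<6. \<forall>i<length (lowering A E k). \<forall>j<2.
      vs k ! i *v (ws 2 ! j *v s) = (if k = 2 \<and> i = j then s else 0)" if "seed_pattern 2 s"
  proof -
    have "[combination (words A E 2 ! 0) *v s, combination (words A E 2 ! 1) *v s] ! j = ws 2 ! j *v s" if "j < 2" for j
      using that by (auto simp: ws_def words_def less_Suc_eq numeral_eq_Suc)
    moreover have "combination (words A E 2 ! 0) *v s = s" by (simp add: words_def)
    ultimately show ?thesis
      using dual_type_III[OF action_type_III[OF that]] by (simp add: vs_def flip: matrix_vector_mul_assoc)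
  qed
  moreover  have "\<forall>k<6. \<forall>i<length (lowering A E k). \<forall>j<4.
      vs k ! i *v (ws 3 ! j *v s) = (if k = 3 \<and> i = j then s else 0)" if "seed_pattern 3 s"
  proof -
    have "[combination (words A E 3 ! 0) *v s, combination (words A E 3 ! 1) *v s, combination (words A E 3 ! 2) *v s, combination (words A E 3 ! 3) *v s] ! j = ws 3 ! j *v s" if "j < 4" for j
      using that by (auto simp: ws_def words_def less_Suc_eq numeral_eq_Suc)
    moreover have "combination (words A E 3 ! 0) *v s = s" by (simp add: words_def)
    ultimately show ?thesis
      using dual_type_IV[OF action_type_IV[OF that]] by (simp add: vs_def flip: matrix_vector_mul_assoc)
  qed
  moreover  have "\<forall>k<6. \<forall>i<length (lowering A E k). \<forall>j<1.
      vs k ! i *v (ws 4 ! j *v s) = (if k = 4 \<and> i = j then s else 0)" if "seed_pattern 4 s"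
  proof -
    have "[combination (words A E 4 ! 0) *v s] ! j = ws 4 ! j *v s" if "j < 1" for j
      using that by (auto simp: ws_def words_def less_Suc_eq numeral_eq_Suc)
    moreover have "combination (words A E 4 ! 0) *v s = s" by (simp add: words_def)
    ultimately show ?thesis
      using dual_type_V[OF action_type_V[OF that]] by (simp add: vs_def flip: matrix_vector_mul_assoc)
  qed
  moreover  have "\<forall>k<6. \<forall>i<length (lowering A E k). \<forall>j<2.
      vs k ! i *v (ws 5 ! j *v s) = (if k = 5 \<and> i = j then s else 0)" if "seed_pattern 5 s"
  proof -
    have "[combination (words A E 5 ! 0) *v s, combination (words A E 5 ! 1) *v s] ! j = ws 5 ! j *v s" if "j < 2" for j
      using that by (auto simp: ws_def words_def less_Suc_eq numeral_eq_Suc)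
    moreover have "combination (words A E 5 ! 0) *v s = s" by (simp add: words_def)
    ultimately show ?thesis
      using dual_type_VI[OF action_type_VI[OF that]] by (simp add: vs_def flip: matrix_vector_mul_assoc)
  qed
  ultimately show ?thesis
    unfolding all_less_6[where Q = "\<lambda>l. seed_pattern l s \<longrightarrow> _ l"] using len by (simp add: supports_def)
qed

end

section \<open>Isomorphism classes and the decomposition of V\<close>

context seed_system
begin

lemma isomorphic_iff:
  assumes "k < N" "l < N" "s \<in> S k" "s \<noteq> 0" "s' \<in> S l" "s' \<noteq> 0"
  shows "isomorphic_modules T (W k s) (W l s') \<longleftrightarrow> k = l"
  using W_isomorphic W_not_isomorphic assms by metis

text \<open>Two entries of \<open>ps\<close> differ in the type or in the seed, and
  \<open>W_orthogonal\<close> handles both cases. Spanning holds because \<open>ps\<close> lists all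
  seeds.\<close>

lemma decomposition:
  assumes ps: "distinct ps" "set ps = {(k, a). k < N \<and> a < length (ss k)}"
  shows "irreducible_decomposition T (map (\<lambda>(k, a). W k (ss k ! a)) ps)"
  unfolding irreducible_decomposition_def
proof (intro conjI ballI orthogonal_direct_sumI)
  let ?Ws = "map (\<lambda>(k, a). W k (ss k ! a)) ps"
  fix V assume "V \<in> set ?Ws"
  then obtain k a where "V = W k (ss k ! a)" "k < N" "a < length (ss k)" using ps by auto
  then show "irreducible_module T V" "vec.subspace V"
    using W_irreducible seed_S seeds(1) W_subspace by auto
next
  fix i j u w assume *: "i < length (map (\<lambda>(k, a). W k (ss k ! a)) ps)" "j < length (map (\<lambda>(k, a). W k (ss k ! a)) ps)"
    "i \<noteq> j" "u \<in> map (\<lambda>(k, a). W k (ss k ! a)) ps ! i" "w \<in> map (\<lambda>(k, a). W k (ss k ! a)) ps ! j"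
  obtain k a l b where p: "ps ! i = (k, a)" "ps ! j = (l, b)" by fastforce
  have "(k, a) \<in> set ps" "(l, b) \<in> set ps" "(k, a) \<noteq> (l, b)"
    using p * ps(1) nth_mem[of i ps] nth_mem[of j ps] nth_eq_iff_index_eq[of ps i j] by auto
  then show "herm u w = 0"
    using W_orthogonal[of k l "ss k ! a" "ss l ! b" u w] seeds(3)[of k a b] seed_S p * ps(2) by auto
next
  let ?X = "vec.span (\<Union> (set (map (\<lambda>(k, a). W k (ss k ! a)) ps)))"
  show "?X = UNIV"
  proof (rule word_span)
    fix k i s assume *: "k < N" "i < d k" "s \<in> S k"
    have "S k \<subseteq> {s. ws k ! i *v s \<in> ?X}"
    proof (rule vec.span_minimal)
      show "vec.subspace {s. ws k ! i *v s \<in> ?X}"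
        by (rule vec.subspaceI)
           (auto simp: matrix_vector_right_distrib vector_scalar_commute vec.span_add vec.span_scale vec.span_zero)
      show "set (ss k) \<subseteq> {s. ws k ! i *v s \<in> ?X}"
      proof
        fix s assume "s \<in> set (ss k)"
        then obtain a where a: "a < length (ss k)" "s = ss k ! a" by (auto simp: in_set_conv_nth)
        then have "(k, a) \<in> set ps" using *(1) ps(2) by auto
        then show "s \<in> {s. ws k ! i *v s \<in> ?X}"
          using word_in_W[OF *(2), of s] a by (auto intro!: vec.span_base bexI[of _ "(k, a)"])
      qed
    qed
    then show "ws k ! i *v s \<in> ?X" using *(3) by blast
  qed simp
qed

end

section \<open>Vectors with a given essential part\<close>

text \<open>For an injective order the sum has at most one nonzero term. Orders start at 1 and lists
  at 0, hence the shift.\<close>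

definition place :: "(nat \<Rightarrow> 'v::finite) \<Rightarrow> complex list \<Rightarrow> complex^'v" where
  "place ord cs = (\<chi> v. \<Sum>j\<in>{1..length cs}. if ord j = v then cs ! (j - 1) else 0)"

lemma place_at:
  assumes "inj_on ord {1..length cs}" "j \<in> {1..length cs}"
  shows "place ord cs $ ord j = cs ! (j - 1)"
proof -
  have "place ord cs $ ord j = (\<Sum>i\<in>{1..length cs}. if i = j then cs ! (j - 1) else 0)"
    unfolding place_def vec_lambda_beta
    by (rule sum.cong[OF refl]) (use assms in \<open>auto dest: inj_onD\<close>)
  then show ?thesis using assms(2) by simp
qed

lemma place_outside: "v \<notin> ord ` {1..length cs} \<Longrightarrow> place ord cs $ v = 0"
  by (auto simp: place_def intro!: sum.neutral)

lemma herm_place: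
  assumes "inj_on ord {1..n}" "length cs = n" "length es = n"
  shows "herm (place ord cs) (place ord es) = (\<Sum>j\<in>{1..n}. cs ! (j - 1) * cnj (es ! (j - 1)))"
proof -
  have "herm (place ord cs) (place ord es) = (\<Sum>v\<in>ord ` {1..n}. place ord cs $ v * cnj (place ord es $ v))"
    unfolding herm_def by (rule sum.mono_neutral_right) (use assms in \<open>auto simp: place_outside\<close>)
  also have "\<dots> = (\<Sum>j\<in>{1..n}. cs ! (j - 1) * cnj (es ! (j - 1)))"
    unfolding sum.reindex[OF assms(1)] by (rule sum.cong[OF refl]) (use assms in \<open>simp add: place_at\<close>)
  finally show ?thesis .
qed

lemma herm_combination:
  assumes "\<And>c Ms M u w. (c, Ms) \<in> set ts \<Longrightarrow> M \<in> set Ms \<Longrightarrow> herm (M *v u) w = herm u (M *v w)"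
  shows "herm (combination ts *v u) w = herm u (combination (map (\<lambda>(c, Ms). (cnj c, rev Ms)) ts) *v w)"
  using assms
proof (induction ts)
  case (Cons t ts)
  obtain c Ms where t: "t = (c, Ms)" by fastforce
  have "herm (chain Ms *v u) w = herm u (chain (rev Ms) *v w)"
    by (rule herm_chain) (use Cons.prems[of c Ms] t in auto)
  moreover have "herm (combination ts *v u) w = herm u (combination (map (\<lambda>(c, Ms). (cnj c, rev Ms)) ts) *v w)"
    by (rule Cons.IH) (erule (1) Cons.prems[OF list.set_intros(2)])
  ultimately show ?case
    by (simp add: t herm_add_left herm_add_right herm_scale_left herm_scale_right)
qed simp

lemma herm_Estar: "herm (Estar adj x n *v u) w = herm u (Estar adj x n *v w)"
  unfolding herm_def by (rule sum.cong[OF refl]) (simp add: Estar_mult_vec)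

lemma herm_adjacency:
  assumes "symp adj"
  shows "herm (adjacency_matrix adj *v u) w = herm u (adjacency_matrix adj *v w)"
proof -
  have "herm (adjacency_matrix adj *v u) w = (\<Sum>y\<in>UNIV. \<Sum>z\<in>UNIV. adjacency_matrix adj $ y $ z * u $ z * cnj (w $ y))"
    by (simp add: herm_def matrix_vector_mult_def sum_distrib_right)
  also have "\<dots> = (\<Sum>z\<in>UNIV. \<Sum>y\<in>UNIV. adjacency_matrix adj $ y $ z * u $ z * cnj (w $ y))"
    by (rule sum.swap)
  also have "\<dots> = (\<Sum>z\<in>UNIV. \<Sum>y\<in>UNIV. u $ z * cnj (adjacency_matrix adj $ z $ y * w $ y))"
    by (intro sum.cong refl) (use assms in \<open>auto simp: adjacency_matrix_def dest: sympD\<close>)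
  also have "\<dots> = herm u (adjacency_matrix adj *v w)"
    by (simp add: herm_def matrix_vector_mult_def sum_distrib_left)
  finally show ?thesis .
qed

lemma interval_6: "{1..6::nat} = {1, 2, 3, 4, 5, 6}" and interval_12: "{1..12::nat} = {1, 2, 3, 4, 5, 6, 7, 8, 9, 10, 11, 12}"
  by (auto simp: numeral_eq_Suc atLeastAtMostSuc_conv)

context coxeter begin

lemma symp_adj: "symp adj"
  using adj_sym by (rule sympI)

end

text \<open>The labelling is adapted to \<open>y\<close>, whereas \<open>u\<close> is arbitrary. For
  \<open>z\<close> the second alternative swaps the two members of each pair: an odd
  \<open>j\<close> goes to the label of \<open>j + 1\<close> and an even \<open>j\<close> to that of
  \<open>j - 1\<close>.\<close>

locale ordered_coxeter = labelled_coxeter adj p for adj :: "'v::finite graph" and p +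
  fixes u y z :: "nat \<Rightarrow> 'v"
  assumes u: "bij_betw u {1..3} (Gam adj 1 (p 0))"
    and y: "bij_betw y {1..6} (Gam adj 2 (p 0))" "\<forall>j\<in>{1..6}. y j = p (3 + j)"
    and z: "bij_betw z {1..12} (Gam adj 3 (p 0))"
      "(\<forall>j\<in>{1..12}. z j = p (9 + j)) \<or> (\<forall>j\<in>{1..12}. z j = p (if even j then 8 + j else 10 + j))"
begin

definition ss :: "nat \<Rightarrow> (complex^'v) list" where
  "ss k =
    [[estar adj (p 0) 0],
     [place u [1, -1, 0], place u [1, 1, -2]],
     [place y [1, -1, -1, 1, -1, 1]],
     [place y [1, -1, 0, 0, 1, -1], place y [1, -1, 2, -2, -1, 1]],
     [place z [-1, 1, -1, 1, -1, 1, -1, 1, 1, -1, 1, -1]],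
     [place z [-1, 1, 1, -1, 1, -1, -1, 1, -1, 1, 1, -1]]] ! k"

lemma place_level:
  assumes "bij_betw ord {1..n} (Gam adj m (p 0))" "length cs = n" "i < 28" "level i \<noteq> m"
  shows "place ord cs $ p i = 0"
proof (rule place_outside)
  have "ord ` {1..length cs} = p ` {i. i < 28 \<and> level i = m}"
    using assms(1,2) by (simp add: bij_betw_def Gam_p)
  then show "p i \<notin> ord ` {1..length cs}" using assms(3,4) p_inj by auto
qed

lemma place_ord:
  assumes "bij_betw ord {1..n} X" "length cs = n"
  shows "\<forall>j\<in>{1..n}. place ord cs $ ord j = cs ! (j - 1)"
  using assms by (auto simp: bij_betw_def place_at)

text \<open>As \<open>u\<close> may be any order, only the sum of the coordinates is determined by
  \<open>cs\<close>, and this is all that the pattern of type II asks for.\<close>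

lemma place_u_sum:
  assumes "length cs = 3"
  shows "place u cs $ p 1 + place u cs $ p 2 + place u cs $ p 3 = cs ! 0 + cs ! 1 + cs ! 2"
proof -
  have "{i. i < 28 \<and> level i = 1} = {1, 2, 3}"
    unfolding set_eq_iff mem_Collect_eq by (auto simp: level_def nth_Cons split: nat.splits)
  then have Gam: "Gam adj 1 (p 0) = {p 1, p 2, p 3}" by (simp add: Gam_p)
  have "place u cs $ p 1 + place u cs $ p 2 + place u cs $ p 3 = (\<Sum>v\<in>Gam adj 1 (p 0). place u cs $ v)"
    unfolding Gam by (simp add: p_inj)
  also have "\<dots> = (\<Sum>j\<in>{1..3}. place u cs $ u j)"
    using u by (rule sum.reindex_bij_betw[symmetric])
  also have "\<dots> = (\<Sum>j\<in>{1..3}. cs ! (j - 1))"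
    using place_ord[OF u assms] by simp
  also have "\<dots> = cs ! 0 + cs ! 1 + cs ! 2"
    by (simp add: numeral_3_eq_3 numeral_2_eq_2)
  finally show ?thesis .
qed

lemma seeds_pattern: "\<forall>k<6. \<forall>s\<in>set (ss k). seed_pattern k s"
proof -
  have sum0: "s3 = - s1 - s2" if "s1 + s2 + s3 = 0" for s1 s2 s3 :: complex
    using that by (simp add: algebra_simps eq_neg_iff_add_eq_0)
  have u': "place u cs $ p 3 = - place u cs $ p 1 - place u cs $ p 2" if "length cs = 3" "cs ! 0 + cs ! 1 + cs ! 2 = 0" for cs
    using sum0 place_u_sum[OF that(1)] that(2) by simp
  have y': "place y cs $ p 4 = cs ! 0 \<and> place y cs $ p 5 = cs ! 1 \<and> place y cs $ p 6 = cs ! 2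
     \<and> place y cs $ p 7 = cs ! 3 \<and> place y cs $ p 8 = cs ! 4 \<and> place y cs $ p 9 = cs ! 5" if "length cs = 6" for cs
    using place_ord[OF y(1) that] y(2) unfolding interval_6 by simp
  \<comment> \<open>Both alternatives for \<open>z\<close> are covered; for the two vectors below
    they differ only in sign.\<close>
  have z': "seed_pattern k (place z cs)" if "k \<in> {4, 5}" "length cs = 12"
    "\<forall>s. (\<forall>j\<in>{1..12}. s $ p (9 + j) = cs ! (j - 1)) \<and> (\<forall>i<28. level i \<noteq> 3 \<longrightarrow> s $ p i = 0) \<longrightarrow> seed_pattern k s"
    "\<forall>s. (\<forall>j\<in>{1..12}. s $ p (if even j then 8 + j else 10 + j) = cs ! (j - 1)) \<and> (\<forall>i<28. level i \<noteq> 3 \<longrightarrow> s $ p i = 0) \<longrightarrow> seed_pattern k s"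
    for k cs
    using that z(2) place_ord[OF z(1) that(2)] place_level[OF z(1) that(2)] by (elim disjE) simp_all
  have "seed_pattern 0 (estar adj (p 0) 0)"
    by (auto simp: seed_pattern_def estar_def p_inj level_def)
  moreover have "seed_pattern 1 (place u [1, -1, 0])" "seed_pattern 1 (place u [1, 1, -2])"
    using u'[of "[1, -1, 0]"] u'[of "[1, 1, -2]"] place_level[OF u] by (simp_all add: seed_pattern_def)
  moreover have "seed_pattern 2 (place y [1, -1, -1, 1, -1, 1])" "seed_pattern 3 (place y [1, -1, 0, 0, 1, -1])"
    "seed_pattern 3 (place y [1, -1, 2, -2, -1, 1])"
    using place_level[OF y(1)] by (simp_all add: seed_pattern_def y')
  moreover have "seed_pattern 4 (place z [-1, 1, -1, 1, -1, 1, -1, 1, 1, -1, 1, -1])"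
    by (rule z') (unfold interval_12, simp_all add: seed_pattern_def)
  moreover have "seed_pattern 5 (place z [-1, 1, 1, -1, 1, -1, -1, 1, -1, 1, 1, -1])"
    by (rule z') (unfold interval_12, simp_all add: seed_pattern_def)
  ultimately show ?thesis
    unfolding all_less_6 by (simp add: ss_def)
qed

lemma place_nonzero: "bij_betw ord {1..n} X \<Longrightarrow> length cs = n \<Longrightarrow> 1 \<le> n \<Longrightarrow> cs ! 0 \<noteq> 0 \<Longrightarrow> place ord cs \<noteq> 0"
  using place_ord[of ord n X cs] by (metis One_nat_def atLeastAtMost_iff diff_Suc_1 le_refl zero_index)

lemma seeds_orthogonal:
  "\<forall>k<6. ss k \<noteq> [] \<and> (\<forall>a<length (ss k). ss k ! a \<noteq> 0) \<and>
     (\<forall>a<length (ss k). \<forall>b<length (ss k). a \<noteq> b \<longrightarrow> herm (ss k ! a) (ss k ! b) = 0)"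
proof -
  have "estar adj (p 0) 0 \<noteq> 0" using dist_self by (auto simp: vec_eq_iff estar_def)
  moreover have "inj_on u {1..3}" "inj_on y {1..6}" using u y(1) by (auto simp: bij_betw_def)
  ultimately show ?thesis
    unfolding all_less_6
    by (auto simp: ss_def less_Suc_eq herm_place place_nonzero[OF u] place_nonzero[OF y(1)] place_nonzero[OF z(1)]
        numeral_eq_Suc sum.atLeast_Suc_atMost)
qed

lemma S_pattern:
  assumes "k < 6" "s \<in> vec.span (set (ss k))"
  shows "seed_pattern k s"
proof -
  have "vec.span (set (ss k)) \<subseteq> {s. seed_pattern k s}"
    by (rule vec.span_minimal) (use seeds_pattern seed_pattern_subspace assms in auto)
  then show ?thesis using assms(2) by blast
qed

section \<open>The seed system of the Coxeter graph\<close>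

abbreviation G where "G \<equiv> insert A {E i | i. i \<le> gdiam adj}"
abbreviation T where "T \<equiv> terwilliger_algebra adj (p 0)"

lemma generators_in_T: "A \<in> T" "n \<le> 4 \<Longrightarrow> E n \<in> T"
  using hull_subset[of G matrix_subalgebra] by (auto simp: terwilliger_algebra_def gdiam)

lemma combinations_in_T:
  "\<forall>k<6. (\<forall>ts\<in>set (words A E k). combination ts \<in> T) \<and> combination (projection A E k) \<in> T \<and>
     (\<forall>ts\<in>set (lowering A E k). combination ts \<in> T)"
proof -
  have closed: "combination ts \<in> T" if "\<forall>(c, Ms)\<in>set ts. set Ms \<subseteq> T" for ts
    by (rule combination_closed[OF _ that]) (simp add: terwilliger_algebra_def matrix_subalgebra_hull)
  show ?thesis
    unfolding all_less_6 words_def projection_def lowering_def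
    by (simp add: closed generators_in_T)
qed

lemma generators_symmetric: "M \<in> G \<Longrightarrow> herm (M *v v) w = herm v (M *v w)"
  using herm_Estar herm_adjacency[OF symp_adj] by auto

text \<open>The coefficients are real, and reversing the words permutes each list while preserving
  coefficients, so the adjoint is the same sum in another order.\<close>

lemma projection_symmetric:
  "\<forall>k<6. herm (combination (projection A E k) *v v) w = herm v (combination (projection A E k) *v w)"
proof -
  have symm: "herm (combination (projection A E k) *v v) w =
    herm v (combination (map (\<lambda>(c, Ms). (cnj c, rev Ms)) (projection A E k)) *v w)" if "k < 6" for k
  proof (rule herm_combination)
    define sym where "sym M \<longleftrightarrow> (\<forall>v w. herm (M *v v) w = herm v (M *v w))" for M :: "complex^'v^'v"
    have "sym A" "sym (E n)" for n
      using herm_Estar herm_adjacency[OF symp_adj] by (auto simp: sym_def)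
    then have "\<forall>k<6. \<forall>(c, Ms)\<in>set (projection A E k). \<forall>M\<in>set Ms. sym M"
      unfolding all_less_6 by (simp add: projection_def)
    then show "herm (M *v u) w = herm u (M *v w)" if "(c, Ms) \<in> set (projection A E k)" "M \<in> set Ms" for c Ms M u w
      using that \<open>k < 6\<close> unfolding sym_def by fast
  qed
  have "\<forall>k<6. combination (map (\<lambda>(c, Ms). (cnj c, rev Ms)) (projection A E k)) *v w = combination (projection A E k) *v w"
    unfolding all_less_6 by (simp add: projection_def add_ac)
  then show ?thesis using symm by simp
qed

sublocale seed_system G T 6 ws vs ss
proof
  show "T = matrix_subalgebra hull G" by (simp add: terwilliger_algebra_def)
  show "herm (M *v v) w = herm v (M *v w)" if "M \<in> G" for M v w
    using generators_symmetric[OF that] .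
  have T1: "M ** M' \<in> T" if "M \<in> T" "M' \<in> T" for M M'
    using that matrix_subalgebra_hull[of G] by (auto simp: matrix_subalgebra_def terwilliger_algebra_def)
  fix k :: nat assume k: "k < 6"
  have dim: "length (ws k) = length (supports k)" "length (vs k) = length (supports k)" using word_lengths k by auto
  have "0 < length (supports k)"
    using k by (auto simp: supports_def less_Suc_eq numeral_eq_Suc)
  show "set (ws k) \<subseteq> T" using combinations_in_T k by (auto simp: ws_def)
  show "set (vs k) \<subseteq> T" using combinations_in_T k T1 by (auto simp: vs_def)
  show "length (vs k) = length (ws k)" "ws k \<noteq> []" "ws k ! 0 = Finite_Cartesian_Product.mat 1"
    using dim \<open>0 < length (supports k)\<close> word_0 k by auto
  show "ss k \<noteq> []" "a < length (ss k) \<Longrightarrow> ss k ! a \<noteq> 0"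
    "a < length (ss k) \<Longrightarrow> b < length (ss k) \<Longrightarrow> a \<noteq> b \<Longrightarrow> herm (ss k ! a) (ss k ! b) = 0" for a b
    using seeds_orthogonal k by blast+
  show "vs k ! i *v (ws l ! j *v s) = (if k = l \<and> i = j then s else 0)"
    if "l < 6" "i < length (ws k)" "j < length (ws l)" "s \<in> vec.span (set (ss l))" for l i j s
    using dual_action[of s] S_pattern[OF that(1,4)] word_lengths that k by auto
  show "herm (vs k ! 0 *v v) w = herm v (vs k ! 0 *v w)" for v w
  proof -
    have "\<forall>k<6. vs k ! 0 *v v = combination (projection A E k) *v v" for v
      unfolding all_less_6 by (simp add: vs_def lowering_def flip: matrix_vector_mul_assoc)
    then show ?thesis using projection_symmetric k by simp
  qed
  show "\<exists>c. \<forall>i<length (ws k). \<forall>s\<in>vec.span (set (ss k)).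
     M *v (ws k ! i *v s) = (\<Sum>j<length (ws k). c j i *s (ws k ! j *v s))" if M: "M \<in> G" for M
  proof (cases "M = A")
    case True
    then show ?thesis
      using A_action S_pattern k dim by (auto intro!: exI[of _ "\<lambda>j i. action_matrix k $$ (j, i)"])
  next
    case False
    then obtain n where n: "M = E n" using M by auto
    show ?thesis
    proof (intro exI[of _ "\<lambda>j i. if j = i \<and> n = supports k ! i then 1 else 0"] allI impI ballI)
      fix i s assume i: "i < length (ws k)" and s: "s \<in> vec.span (set (ss k))"
      have "M *v (ws k ! i *v s) = (if n = supports k ! i then ws k ! i *v s else 0)"
        using E_action[of s n] S_pattern[OF k s] k i dim n by auto
      also have "\<dots> = (\<Sum>j<length (ws k). if j = i then (if n = supports k ! i then ws k ! i *v s else 0) else 0)"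
        using i by simp
      also have "\<dots> = (\<Sum>j<length (ws k). (if j = i \<and> n = supports k ! i then 1 else 0) *s (ws k ! j *v s))"
        by (rule sum.cong) auto
      finally show "M *v (ws k ! i *v s) = (\<Sum>j<length (ws k). (if j = i \<and> n = supports k ! i then 1 else 0) *s (ws k ! j *v s))" .
    qed
  qed
next
  \<comment> \<open>The count of basis vectors is 5 + 10 + 2 + 8 + 1 + 2 = 28.\<close>
  have "{..<6::nat} = {0, 1, 2, 3, 4, 5}" by auto
  moreover have "CARD('v) = 28" using coxeter by (simp add: coxeter_graph_def)
  ultimately show "(\<Sum>k<6. length (ws k) * length (ss k)) = CARD('v)"
    using word_lengths[unfolded all_less_6] by (simp add: supports_def ss_def)
qed

end

section \<open>The orderings\<close>

context coxeter
begin

text \<open>The three branches and the first child may be prescribed in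
  \<open>labelling_exists\<close>; the common neighbours of the pairs and \<open>y 1\<close> are
  taken. In the other branches the distance conditions select \<open>p 7\<close> and
  \<open>p 9\<close>, because by a_3 = 1 each of \<open>p 2\<close> and \<open>p 3\<close> has only
  one neighbour at distance 3 from \<open>p 4\<close>.\<close>

lemma order2_labelling:
  assumes "order2 adj x y"
  shows "\<exists>p. labelling adj p \<and> p 0 = x \<and> (\<forall>j\<in>{1..6}. y j = p (3 + j))"
proof -
  have bij: "bij_betw y {1..6} (Gam adj 2 x)"
    and pairs: "\<exists>w\<in>Gam adj 1 x. adj w (y 1) \<and> adj w (y 2)" "\<exists>w\<in>Gam adj 1 x. adj w (y 3) \<and> adj w (y 4)"
      "\<exists>w\<in>Gam adj 1 x. adj w (y 5) \<and> adj w (y 6)"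
    and far: "dst (y 1) (y 4) = 3" "dst (y 1) (y 6) = 3"
    using assms unfolding order2_def by simp_all
  have ne: "y i \<noteq> y j" if "i \<in> {1..6}" "j \<in> {1..6}" "i \<noteq> j" for i j
    using bij that by (auto simp: bij_betw_def dest: inj_onD)
  have yx: "y i \<noteq> x" if "i \<in> {1..6}" for i
  proof -
    have "y i \<in> Gam adj 2 x" using bij that by (auto simp: bij_betw_def)
    then show ?thesis by (auto simp: Gam_def)
  qed
  obtain w1 w2 w3 where w: "adj x w1" "adj w1 (y 1)" "adj w1 (y 2)" "adj x w2" "adj w2 (y 3)" "adj w2 (y 4)"
    "adj x w3" "adj w3 (y 5)" "adj w3 (y 6)"
    using pairs by (auto simp: Gam_def)
  have third: "v \<in> {x, y i, y j}" if "adj x w" "adj w (y i)" "adj w (y j)" "adj w v" "i \<in> {1..6}" "j \<in> {1..6}" "i \<noteq> j" for w i j v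
    using nbhd3[of w x "y i" "y j"] that yx ne adj_sym nbhdD(4) by blast
  have "w1 \<noteq> w2" "w1 \<noteq> w3" "w2 \<noteq> w3"
    using third[of w1 1 2 "y 3"] third[of w1 1 2 "y 5"] third[of w2 3 4 "y 5"] w ne yx by auto
  then have "nbhd x w1 w2 w3" using nbhd3 w by blast
  then obtain p where p: "labelling adj p" "p 0 = x" "p 1 = w1" "p 2 = w2" "p 3 = w3" "p 4 = y 1"
    using labelling_exists[of x w1 w2 w3 "y 1"] w(2) yx[of 1] by auto
  interpret labelled_coxeter adj p by unfold_locales (rule p(1))
  have nb: "v = p a \<or> v = p b" if "adj (p i) v" "v \<noteq> x" "neighbours ! i = [0, a, b]" "i < 28" for v i a b
    using nbhdD(4)[OF nbhd_p[OF that(4)] that(1)] that(2,3) p(2) by auto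
  have y2: "y 2 = p 5"
    using nb[of 1 "y 2" 4 5] w(3) p ne[of 2 1] yx[of 2] by (simp add: neighbours_def)
  have "dst (p 4) (p 2) = 3" "dst (p 4) (p 7) = 3" "dst (p 4) (p 3) = 3" "dst (p 4) (p 9) = 3"
    using dist_path_3[of "p 4" "p 1" "p 0" "p 2"] dist_path_3[of "p 4" "p 11" "p 16" "p 7"]
      dist_path_3[of "p 4" "p 1" "p 0" "p 3"] dist_path_3[of "p 4" "p 10" "p 20" "p 9"]
    by (simp_all add: adj_p p_inj neighbours_def)
  then have not3: "dst (p 4) (p 6) \<noteq> 3" "dst (p 4) (p 8) \<noteq> 3"
    using unique_level_3[of "p 4" "p 2" "p 6" 3 "p 7"] unique_level_3[of "p 4" "p 3" "p 8" 3 "p 9"]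
    by (auto simp: adj_p p_inj neighbours_def)
  have "y 4 = p 7" "y 6 = p 9"
    using nb[of 2 "y 4" 6 7] nb[of 3 "y 6" 8 9] w(6,9) p yx[of 4] yx[of 6] not3 far by (auto simp: neighbours_def)
  moreover have "y 3 = p 6" "y 5 = p 8"
    using nb[of 2 "y 3" 6 7] nb[of 3 "y 5" 8 9] w(5,8) p yx[of 3] yx[of 5] ne[of 3 4] ne[of 5 6] calculation
    by (auto simp: neighbours_def)
  ultimately show ?thesis
    unfolding interval_6 using p y2 by (intro exI[of _ p]) simp
qed

lemma labelling_at: "\<exists>p. labelling adj p \<and> p 0 = x"
proof -
  obtain u1 where "adj x u1" using degree[of x] by (metis Collect_empty_eq card.empty zero_neq_numeral)
  then obtain u2 u3 where x: "nbhd x u1 u2 u3" using nbhd1 by blast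
  obtain A1 B1 where "nbhd u1 x A1 B1" using nbhd1[of u1 x] \<open>adj x u1\<close> adj_sym by blast
  then have "adj u1 A1" "A1 \<noteq> x" by (auto simp: nbhd_def)
  then show ?thesis using labelling_exists[OF x] by blast
qed

end

context labelled_coxeter
begin

lemma level_sets:
  "Gam adj 1 (p 0) = p ` {1, 2, 3}" "Gam adj 2 (p 0) = p ` {4, 5, 6, 7, 8, 9}"
  "Gam adj 3 (p 0) = p ` {10, 11, 12, 13, 14, 15, 16, 17, 18, 19, 20, 21}"
  "Gam adj 4 (p 0) = p ` {22, 23, 24, 25, 26, 27}"
proof -
  have "{i. i < 28 \<and> level i = 1} = {1, 2, 3}" "{i. i < 28 \<and> level i = 2} = {4, 5, 6, 7, 8, 9}"
    "{i. i < 28 \<and> level i = 3} = {10, 11, 12, 13, 14, 15, 16, 17, 18, 19, 20, 21}"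
    "{i. i < 28 \<and> level i = 4} = {22, 23, 24, 25, 26, 27}"
    unfolding set_eq_iff mem_Collect_eq by (auto simp: level_def nth_Cons split: nat.splits)
  then show "Gam adj 1 (p 0) = p ` {1, 2, 3}" "Gam adj 2 (p 0) = p ` {4, 5, 6, 7, 8, 9}"
    "Gam adj 3 (p 0) = p ` {10, 11, 12, 13, 14, 15, 16, 17, 18, 19, 20, 21}"
    "Gam adj 4 (p 0) = p ` {22, 23, 24, 25, 26, 27}"
    by (simp_all only: Gam_p)
qed

lemma level_neighbours:
  "k < 28 \<Longrightarrow> {w \<in> Gam adj m (p 0). adj (p k) w} = p ` set (filter (\<lambda>i. level i = m) (neighbours ! k))"
  using neighbours_sorted by (fastforce simp: Gam_p adj_p)

lemma order1_exists: "order1 adj (p 0) p"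
  unfolding order1_def level_sets by (rule bij_betw_imageI) (auto simp: inj_on_def p_inj)

lemma bij_shift: "a + n < 28 \<Longrightarrow> bij_betw (\<lambda>j. p (a + j)) {1..n} (p ` {a + 1..a + n})"
proof (rule bij_betw_imageI)
  show "(\<lambda>j. p (a + j)) ` {1..n} = p ` {a + 1..a + n}"
    unfolding image_image[symmetric, of p "(+) a"] by (simp add: add.commute)
qed (auto simp: inj_on_def p_inj)

lemma order2_exists: "order2 adj (p 0) (\<lambda>j. p (3 + j))"
proof -
  have D: "dst (p 4) (p 7) = 3" "dst (p 7) (p 9) = 3" "dst (p 9) (p 4) = 3"
    "dst (p 5) (p 6) = 3" "dst (p 6) (p 8) = 3" "dst (p 8) (p 5) = 3"
    using dist_path_3[of "p 4" "p 11" "p 16" "p 7"] dist_path_3[of "p 7" "p 17" "p 21" "p 9"]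
      dist_path_3[of "p 9" "p 20" "p 10" "p 4"] dist_path_3[of "p 5" "p 13" "p 14" "p 6"]
      dist_path_3[of "p 6" "p 15" "p 19" "p 8"] dist_path_3[of "p 8" "p 18" "p 12" "p 5"]
    by (simp_all add: adj_p p_inj neighbours_def)
  have "{3 + 1..3 + 6} = {4, 5, 6, 7, 8, 9 :: nat}" by auto
  then have "bij_betw (\<lambda>j. p (3 + j)) {1..6} (Gam adj 2 (p 0))"
    using bij_shift[of 3 6] unfolding level_sets by simp
  moreover have "\<forall>(i, j)\<in>{(1, 2), (3, 4), (5, 6)}. \<exists>w\<in>Gam adj 1 (p 0). adj w (p (3 + i)) \<and> adj w (p (3 + j))"
    unfolding level_sets by (simp add: adj_p neighbours_def)
  ultimately show ?thesis
    unfolding order2_def using D D[THEN trans[OF dist_commute]] by simp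
qed

lemma order3_exists:
  assumes y: "\<forall>j\<in>{1..6}. y j = p (3 + j)"
  shows "order3 adj (p 0) y (\<lambda>j. p (9 + j))"
proof -
  let ?L = "{10, 11, 12, 13, 14, 15, 16, 17, 18, 19, 20, 21 :: nat}"
  have "{9 + 1..9 + 12} = ?L" by (auto simp: numeral_eq_Suc atLeastAtMostSuc_conv)
  then have bij: "bij_betw (\<lambda>j. p (9 + j)) {1..12} (Gam adj 3 (p 0))"
    using bij_shift[of 9 12] unfolding level_sets by simp
  have children: "\<forall>j\<in>{1..6}. {p (9 + (2 * j - 1)), p (9 + 2 * j)} = {w \<in> Gam adj 3 (p 0). adj (y j) w}"
    using y unfolding interval_6 by (simp add: level_neighbours neighbours_def level_def)
  define S where "S = (\<lambda>j. p (9 + j)) ` {2, 3, 5, 8, 10, 11}"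
  have S: "p i \<in> S \<longleftrightarrow> i \<in> {11, 12, 14, 17, 19, 20}" if "i < 28" for i
    using that by (auto simp: S_def p_inj)
  have "v \<in> S \<longleftrightarrow> w \<notin> S" if v: "v \<in> Gam adj 3 (p 0)" and w: "w \<in> Gam adj 3 (p 0)" "adj v w" for v w
  proof -
    have *: "\<forall>i\<in>?L. \<forall>j\<in>set (neighbours ! i). level j = 3 \<longrightarrow> (p i \<in> S \<longleftrightarrow> p j \<notin> S)"
      by (simp add: neighbours_def level_def S)
    obtain i where i: "i \<in> ?L" "v = p i" using v unfolding level_sets by blast
    then have "i < 28" by auto
    then have "w \<in> p ` set (filter (\<lambda>i. level i = 3) (neighbours ! i))"
      using level_neighbours[of i 3] w i by blast
    then show ?thesis using * i by auto
  qed
  moreover have "{w \<in> Gam adj 3 (p 0). adj t w} \<subseteq> S \<or> {w \<in> Gam adj 3 (p 0). adj t w} \<inter> S = {}"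
    if t: "t \<in> Gam adj 4 (p 0)" for t
  proof -
    obtain i where i: "i \<in> {22, 23, 24, 25, 26, 27}" "t = p i" using t unfolding level_sets by blast
    then have "i < 28" by auto
    have "(\<forall>j\<in>set (neighbours ! i). level j = 3 \<longrightarrow> p j \<in> S) \<or> (\<forall>j\<in>set (neighbours ! i). level j = 3 \<longrightarrow> p j \<notin> S)"
      using i(1) by (elim insertE emptyE; simp add: neighbours_def level_def S)
    then show ?thesis unfolding i(2) level_neighbours[OF \<open>i < 28\<close>] by auto
  qed
  ultimately show ?thesis
    unfolding order3_def Let_def S_def[symmetric] using bij children by blast
qed

text \<open>\<open>\<sigma> j\<close> records whether the j-th pair is ordered as in the labelling.
  Edges inside Gamma_3(x) force equal choices along each 9-cycle, that is, for pairs 1, 4, 6 and for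
  pairs 2, 3, 5; the vertex labelled 22 is adjacent to leaves of both cycles and links the two
  choices.\<close>

lemma order3_cases:
  assumes y: "\<forall>j\<in>{1..6}. y j = p (3 + j)" and z: "order3 adj (p 0) y z"
  shows "(\<forall>j\<in>{1..12}. z j = p (9 + j)) \<or> (\<forall>j\<in>{1..12}. z j = p (if even j then 8 + j else 10 + j))"
proof -
  define S where "S = z ` {2, 3, 5, 8, 10, 11}"
  have children: "\<forall>j\<in>{1..6}. {z (2 * j - 1), z (2 * j)} = {w \<in> Gam adj 3 (p 0). adj (y j) w}"
    and edge: "\<And>v w. v \<in> Gam adj 3 (p 0) \<Longrightarrow> w \<in> Gam adj 3 (p 0) \<Longrightarrow> adj v w \<Longrightarrow> v \<in> S \<longleftrightarrow> w \<notin> S"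
    and top: "\<And>t. t \<in> Gam adj 4 (p 0) \<Longrightarrow>
      {w \<in> Gam adj 3 (p 0). adj t w} \<subseteq> S \<or> {w \<in> Gam adj 3 (p 0). adj t w} \<inter> S = {}"
    using z[unfolded order3_def Let_def, folded S_def, THEN conjunct2, THEN conjunct1]
      z[unfolded order3_def Let_def, folded S_def, THEN conjunct2, THEN conjunct2, THEN conjunct1]
      z[unfolded order3_def Let_def, folded S_def, THEN conjunct2, THEN conjunct2, THEN conjunct2]
    by blast+
  define \<sigma> where "\<sigma> j \<longleftrightarrow> z (2 * j) = p (9 + 2 * j)" for j
  have pair: "z a = (if \<sigma> j then p c else p e) \<and> z b = (if \<sigma> j then p e else p c)"
    if "{z a, z b} = {p c, p e}" "b = 2 * j" "e = 9 + 2 * j" "c < 28" "e < 28" "c \<noteq> e" for a b c e j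
    using that p_inj unfolding \<sigma>_def doubleton_eq_iff by auto
  have "{z 1, z 2} = {p 10, p 11}" "{z 3, z 4} = {p 12, p 13}" "{z 5, z 6} = {p 14, p 15}"
    "{z 7, z 8} = {p 16, p 17}" "{z 9, z 10} = {p 18, p 19}" "{z 11, z 12} = {p 20, p 21}"
    using children y unfolding interval_6 by (simp_all add: level_neighbours neighbours_def level_def)
  note zs = this[THEN pair]
  have z': "z 1 = (if \<sigma> 1 then p 10 else p 11)" "z 2 = (if \<sigma> 1 then p 11 else p 10)"
    "z 3 = (if \<sigma> 2 then p 12 else p 13)" "z 4 = (if \<sigma> 2 then p 13 else p 12)"
    "z 5 = (if \<sigma> 3 then p 14 else p 15)" "z 6 = (if \<sigma> 3 then p 15 else p 14)"
    "z 7 = (if \<sigma> 4 then p 16 else p 17)" "z 8 = (if \<sigma> 4 then p 17 else p 16)"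
    "z 9 = (if \<sigma> 5 then p 18 else p 19)" "z 10 = (if \<sigma> 5 then p 19 else p 18)"
    "z 11 = (if \<sigma> 6 then p 20 else p 21)" "z 12 = (if \<sigma> 6 then p 21 else p 20)"
    using zs(1)[of 1] zs(2)[of 2] zs(3)[of 3] zs(4)[of 4] zs(5)[of 5] zs(6)[of 6] by auto
  have mem: "p 10 \<in> S \<longleftrightarrow> \<not> \<sigma> 1" "p 11 \<in> S \<longleftrightarrow> \<sigma> 1" "p 12 \<in> S \<longleftrightarrow> \<sigma> 2" "p 13 \<in> S \<longleftrightarrow> \<not> \<sigma> 2"
    "p 14 \<in> S \<longleftrightarrow> \<sigma> 3" "p 16 \<in> S \<longleftrightarrow> \<not> \<sigma> 4" "p 17 \<in> S \<longleftrightarrow> \<sigma> 4"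
    "p 18 \<in> S \<longleftrightarrow> \<not> \<sigma> 5" "p 19 \<in> S \<longleftrightarrow> \<sigma> 5" "p 20 \<in> S \<longleftrightarrow> \<sigma> 6"
    by (simp_all add: S_def z' p_inj)
  have "\<sigma> 1 = \<sigma> 4" "\<sigma> 1 = \<sigma> 6" "\<sigma> 2 = \<sigma> 5" "\<sigma> 2 = \<sigma> 3"
    using edge[of "p 11" "p 16"] edge[of "p 10" "p 20"] edge[of "p 12" "p 18"] edge[of "p 13" "p 14"] mem
    unfolding level_sets by (simp_all add: adj_p neighbours_def)
  moreover have "\<sigma> 1 = \<sigma> 5"
  proof -
    have "{w \<in> Gam adj 3 (p 0). adj (p 22) w} = {p 11, p 19}"
      by (simp add: level_neighbours neighbours_def level_def)
    moreover have "p 22 \<in> Gam adj 4 (p 0)" unfolding level_sets by simp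
    ultimately have "{p 11, p 19} \<subseteq> S \<or> {p 11, p 19} \<inter> S = {}" using top by metis
    then show ?thesis using mem(2,9) by auto
  qed
  ultimately have "(\<forall>j\<in>{1, 2, 3, 4, 5, 6}. \<sigma> j) \<or> (\<forall>j\<in>{1, 2, 3, 4, 5, 6}. \<not> \<sigma> j)" by auto
  then show ?thesis unfolding interval_12 using z' by auto
qed

end

section \<open>The data of the eight summands, the dimension of T and the spectrum\<close>

context ordered_coxeter
begin

lemma S_seed: "k < 6 \<Longrightarrow> s \<in> set (ss k) \<Longrightarrow> s \<in> S k \<and> s \<noteq> 0"
  using seeds(1)[of k] seed_S[of _ k] by (auto simp: in_set_conv_nth)

text \<open>The order is that of the summands in the theorem, so \<open>Suc k\<close> is the number
  of the type.\<close>

definition seed_indices :: "(nat \<times> nat) list" where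
  "seed_indices = [(0, 0), (1, 0), (1, 1), (2, 0), (3, 0), (3, 1), (4, 0), (5, 0)]"

lemma set_seed_indices: "distinct seed_indices" "set seed_indices = {(k, a). k < 6 \<and> a < length (ss k)}"
proof -
  have "\<forall>k<6. \<forall>a. a < length (ss k) \<longleftrightarrow> (k, a) \<in> set seed_indices"
    unfolding all_less_6 by (auto simp: seed_indices_def ss_def less_Suc_eq)
  moreover have "\<forall>(k, a)\<in>set seed_indices. k < 6"
    by (simp add: seed_indices_def)
  ultimately show "set seed_indices = {(k, a). k < 6 \<and> a < length (ss k)}" by auto
qed (simp add: seed_indices_def)

lemma decomposition_seeds: "irreducible_decomposition T (map (\<lambda>(k, a). W k (ss k ! a)) seed_indices)"
  using decomposition set_seed_indices by blast

lemma isomorphic_seeds: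
  "\<forall>i<8. \<forall>j<8. isomorphic_modules T (map (\<lambda>(k, a). W k (ss k ! a)) seed_indices ! i)
      (map (\<lambda>(k, a). W k (ss k ! a)) seed_indices ! j) \<longleftrightarrow>
     map (\<lambda>(k, a). Suc k) seed_indices ! i = map (\<lambda>(k, a). Suc k) seed_indices ! j"
proof (intro allI impI)
  fix i j :: nat assume ij: "i < 8" "j < 8"
  obtain k a l b where p: "seed_indices ! i = (k, a)" "seed_indices ! j = (l, b)" by fastforce
  have len: "length seed_indices = 8" by (simp add: seed_indices_def)
  then have "(k, a) \<in> set seed_indices" "(l, b) \<in> set seed_indices"
    using p ij nth_mem[of i seed_indices] nth_mem[of j seed_indices] by auto
  then show "isomorphic_modules T (map (\<lambda>(k, a). W k (ss k ! a)) seed_indices ! i)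
      (map (\<lambda>(k, a). W k (ss k ! a)) seed_indices ! j) \<longleftrightarrow>
     map (\<lambda>(k, a). Suc k) seed_indices ! i = map (\<lambda>(k, a). Suc k) seed_indices ! j"
    using isomorphic_iff[of k l "ss k ! a" "ss l ! b"] seed_S seeds(1) p ij len set_seed_indices(2) by auto
qed

lemma pure_words:
  assumes "k < 6" "s \<in> set (ss k)"
  shows "list_all2 (pure_with_support adj (p 0)) (supports k) (map (\<lambda>w. w *v s) (ws k))"
proof (rule list_all2_all_nthI)
  note s = S_seed[OF assms]
  note pat = S_pattern[OF assms(1) s[THEN conjunct1]]
  show "length (supports k) = length (map (\<lambda>w. w *v s) (ws k))" using word_lengths assms(1) by simp
  fix i assume i: "i < length (supports k)"
  then have "vs k ! i *v (ws k ! i *v s) = s" using dual_action[of s] pat assms(1) by simp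
  then have "ws k ! i *v s \<noteq> 0" using s by auto
  moreover have "E (supports k ! i) *v (ws k ! i *v s) = ws k ! i *v s"
    using E_action[of s "supports k ! i"] pat assms(1) i by simp
  ultimately show "pure_with_support adj (p 0) (supports k ! i) (map (\<lambda>w. w *v s) (ws k) ! i)"
    using i word_lengths assms(1) by (simp add: pure_with_support_iff)
qed

lemma supports_sorted: "\<forall>k<6. sorted (supports k) \<and> set (supports k) \<subseteq> {..4}"
  unfolding all_less_6 by (simp add: supports_def)

lemma represents_words:
  assumes "k < 6" "s \<in> set (ss k)"
  shows "represents A (map (\<lambda>w. w *v s) (ws k)) (action_matrix k)"
proof -
  have len: "length (action_rows k) = length (ws k)" "length (supports k) = length (ws k)"
    using word_lengths assms(1) by auto
  have pat: "seed_pattern k s" using S_pattern[OF assms(1)] S_seed[OF assms] by blast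
  have "action_matrix k \<in> carrier_mat (length (ws k)) (length (ws k))"
    by (simp add: mat_of_rows_list_def len)
  moreover have "A *v (ws k ! i *v s) = (\<Sum>j<length (ws k). action_matrix k $$ (j, i) *s (ws k ! j *v s))"
    if "i < length (ws k)" for i
    by (rule A_action[of s, rule_format, of k i, unfolded len(2), OF assms(1) pat that])
  ultimately show ?thesis by (simp add: represents_def)
qed

lemma summand:
  assumes k: "k < 6" and s: "s \<in> set (ss k)"
    and "r = Min (set (supports k))" "\<delta> = card (set (supports k)) - 1"
      "sh = map (count_list (supports k)) [r..<r + \<delta> + 1]" "n = length (supports k)" "m = length (ss k)"
      "bs = map (\<lambda>w. w *v s) (ws k)" "Brows = action_rows k" "es = eigenvalues k"
  shows "summand_data adj (p 0) (W k s) r m n \<delta> sh bs Brows es"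
proof (rule summand_dataI)
  note S = S_seed[OF k s]
  have len: "length (action_rows k) = length (supports k)" "length (ws k) = length (supports k)"
    using word_lengths k by auto
  show "basis_of (W k s) bs" using basis_of_W[OF k] S assms by simp
  show "list_all2 (pure_with_support adj (p 0)) (supports k) bs" using pure_words[OF k s] assms by simp
  show "sorted (supports k)" "set (supports k) \<subseteq> {..gdiam adj}" using supports_sorted k gdiam by auto
  show "module_multiplicity (terwilliger_algebra adj (p 0)) (W k s) = m"
    using multiplicity[OF k _ _ decomposition_seeds] S assms by simp
  show "represents (adjacency_matrix adj) bs (mat_of_rows_list n Brows)"
    using represents_words[OF k s] assms len by simp
  show "eigenvalue_list (mat_of_rows_list n Brows) es"
    using eigenvalue_list_of_diagonalization diagonalization_of_action k assms len by auto
qed (use assms word_lengths in auto)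

lemma seed_of_W:
  assumes k: "k < 6" and s: "s \<in> set (ss k)"
    and i: "supports k \<noteq> []" "i = hd (supports k)" "i \<notin> set (tl (supports k))" and cs: "map (\<lambda>j. s $ ord j) [1..<Suc n] = cs"
  shows "seed adj (p 0) (W k s) i ord n s cs"
proof -
  have words: "map (\<lambda>w. w *v s) (ws k) = s # map (\<lambda>w. w *v s) (tl (ws k))"
    using ws_0(1)[OF k] ws_0(2)[OF k] by (cases "ws k") auto
  have "basis_of (W k s) (s # map (\<lambda>w. w *v s) (tl (ws k)))"
    unfolding words[symmetric] using basis_of_W[OF k] S_seed[OF k s] by blast
  moreover have "list_all2 (pure_with_support adj (p 0)) (supports k) (s # map (\<lambda>w. w *v s) (tl (ws k)))"
    unfolding words[symmetric] by (rule pure_words[OF k s])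
  moreover have "sorted (supports k)" "set (supports k) \<subseteq> {..gdiam adj}"
    unfolding gdiam using supports_sorted k by blast+
  moreover have "supports k = i # tl (supports k)" using i(1,2) by simp
  ultimately show ?thesis using i(3) cs by (metis seedI)
qed

lemma map_place:
  assumes "bij_betw ord {1..n} X" "length cs = n"
  shows "map (\<lambda>j. place ord cs $ ord j) [1..<Suc n] = cs"
  by (rule nth_equalityI) (use place_ord[OF assms] assms(2) in \<open>auto simp del: upt_Suc\<close>)

lemma estar_p: "i < 28 \<Longrightarrow> estar adj (p 0) k $ p i = (if level i = k then 1 else 0)"
  using dist_level by (simp add: estar_def)

lemma type_I:
  "summand_data adj (p 0) (W 0 (ss 0 ! 0)) 0 1 5 4 [1, 1, 1, 1, 1]
     [estar adj (p 0) 0, estar adj (p 0) 1, estar adj (p 0) 2, estar adj (p 0) 3, estar adj (p 0) 4]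
     [[0, 3, 0, 0, 0],
      [1, 0, 2, 0, 0],
      [0, 1, 0, 2, 0],
      [0, 0, 1, 1, 1],
      [0, 0, 0, 2, 1]]
     [3, 2, -1 + sqrt2, -1, -1 - sqrt2]"
proof (rule summand)
  have "seed_pattern 0 (estar adj (p 0) 0)" using seeds_pattern by (simp add: ss_def)
  \<comment> \<open>The factor 1/2 in the last word compensates c_4 = 2.\<close>
  have "ws 0 ! 1 *v estar adj (p 0) 0 = estar adj (p 0) 1" "ws 0 ! 2 *v estar adj (p 0) 0 = estar adj (p 0) 2"
    "ws 0 ! 3 *v estar adj (p 0) 0 = estar adj (p 0) 3" "ws 0 ! 4 *v estar adj (p 0) 0 = estar adj (p 0) 4"
    unfolding ws_def by (simp_all add: coordinates estar_p)
  then show "[estar adj (p 0) 0, estar adj (p 0) 1, estar adj (p 0) 2, estar adj (p 0) 3, estar adj (p 0) 4]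
    = map (\<lambda>w. w *v (ss 0 ! 0)) (ws 0)"
    by (simp add: ws_def words_def ss_def)
qed (simp_all add: supports_def action_rows_def eigenvalues_def ss_def upt_rec)

lemma seed_step:
  "seed_pattern 1 s \<Longrightarrow> A *v s = E 2 *v (A *v s)"
  "seed_pattern 2 s \<Longrightarrow> A *v s = E 3 *v (A *v s)"
  "seed_pattern 3 s \<Longrightarrow> A *v s = E 3 *v (A *v s)"
  by (simp_all add: coordinates)

lemmas summand_simps = supports_def action_rows_def eigenvalues_def ss_def ws_def words_def upt_rec

lemma type_II:
  assumes "(V, cs) \<in> {(W 1 (ss 1 ! 0), [1, -1, 0]), (W 1 (ss 1 ! 1), [1, 1, -2])}"
  shows "\<exists>\<nu>. seed adj (p 0) V 1 u 3 \<nu> cs \<and> A *v \<nu> = E 2 *v (A *v \<nu>) \<and>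
    summand_data adj (p 0) V 1 2 5 3 [1, 1, 2, 1]
      [\<nu>, A *v \<nu>, E 3 *v (A *v (A *v \<nu>)), E 3 *v (A *v (A *v (A *v \<nu>))), E 4 *v (A *v (A *v (A *v \<nu>)))]
      [[0, 2, 0, 0, 0],
       [1, 0, 2, -1, 0],
       [0, 1, 0, 1, 0],
       [0, 0, 1, 0, -1],
       [0, 0, 1, -2, 1]]
      [2, 2, -1 + sqrt2, -1, -1 - sqrt2]"
proof -
  define \<nu> where "\<nu> = place u cs"
  have V: "V = W 1 \<nu>" "\<nu> \<in> set (ss 1)" "length cs = 3" using assms by (auto simp: ss_def \<nu>_def)
  show ?thesis
    unfolding V(1)
  proof (intro exI[of _ \<nu>] conjI, goal_cases)
    case 1
    show ?case by (rule seed_of_W) (use V(2) map_place[OF u V(3)] in \<open>simp_all add: supports_def \<nu>_def\<close>)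
  next
    case 2
    show ?case using seed_step(1) seeds_pattern V(2) by simp
  next
    case 3
    show ?case by (rule summand) (use V(2) in \<open>simp_all add: summand_simps\<close>)
  qed
qed

lemma type_III:
  "\<exists>\<nu>. seed adj (p 0) (W 2 (ss 2 ! 0)) 2 y 6 \<nu> [1, -1, -1, 1, -1, 1] \<and> A *v \<nu> = E 3 *v (A *v \<nu>) \<and>
    summand_data adj (p 0) (W 2 (ss 2 ! 0)) 2 1 2 1 [1, 1]
      [\<nu>, A *v \<nu>]
      [[0, 2],
       [1, 1]]
      [2, -1]"
proof -
  have \<nu>: "ss 2 ! 0 \<in> set (ss 2)" "ss 2 ! 0 = place y [1, -1, -1, 1, -1, 1]" by (simp_all add: ss_def)
  show ?thesis
  proof (intro exI[of _ "ss 2 ! 0"] conjI, goal_cases)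
    case 1
    show ?case by (rule seed_of_W) (use \<nu> map_place[OF y(1), of "[1, -1, -1, 1, -1, 1]"] in \<open>simp_all add: supports_def\<close>)
  next
    case 2
    show ?case using seed_step(2) seeds_pattern \<nu>(1) by simp
  next
    case 3
    show ?case by (rule summand) (use \<nu>(1) in \<open>simp_all add: summand_simps\<close>)
  qed
qed

lemma type_IV:
  assumes "(V, cs) \<in> {(W 3 (ss 3 ! 0), [1, -1, 0, 0, 1, -1]), (W 3 (ss 3 ! 1), [1, -1, 2, -2, -1, 1])}"
  shows "\<exists>\<nu>. seed adj (p 0) V 2 y 6 \<nu> cs \<and> A *v \<nu> = E 3 *v (A *v \<nu>) \<and>
    summand_data adj (p 0) V 2 2 4 2 [1, 2, 1]
      [\<nu>, A *v \<nu>, E 3 *v (A *v (A *v \<nu>)), E 4 *v (A *v (A *v \<nu>))]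
      [[0, 2, -1, 0],
       [1, 0, 1, 2],
       [0, 1, 0, 1],
       [0, 1, 0, -1]]
      [2, -1 + sqrt2, -1, -1 - sqrt2]"
proof -
  define \<nu> where "\<nu> = place y cs"
  have V: "V = W 3 \<nu>" "\<nu> \<in> set (ss 3)" "length cs = 6" using assms by (auto simp: ss_def \<nu>_def)
  show ?thesis
    unfolding V(1)
  proof (intro exI[of _ \<nu>] conjI, goal_cases)
    case 1
    show ?case by (rule seed_of_W) (use V(2) map_place[OF y(1) V(3)] in \<open>simp_all add: supports_def \<nu>_def\<close>)
  next
    case 2
    show ?case using seed_step(3) seeds_pattern V(2) by simp
  next
    case 3
    show ?case by (rule summand) (use V(2) in \<open>simp_all add: summand_simps\<close>)
  qed
qed

lemma type_V:
  "\<exists>\<nu>. seed adj (p 0) (W 4 (ss 4 ! 0)) 3 z 12 \<nu> [-1, 1, -1, 1, -1, 1, -1, 1, 1, -1, 1, -1] \<and>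
    summand_data adj (p 0) (W 4 (ss 4 ! 0)) 3 1 1 0 [1]
      [\<nu>]
      [[-1]]
      [-1]"
proof -
  have \<nu>: "ss 4 ! 0 \<in> set (ss 4)" "ss 4 ! 0 = place z [-1, 1, -1, 1, -1, 1, -1, 1, 1, -1, 1, -1]" by (simp_all add: ss_def)
  show ?thesis
  proof (intro exI[of _ "ss 4 ! 0"] conjI, goal_cases)
    case 1
    show ?case by (rule seed_of_W) (use \<nu> map_place[OF z(1), of "[-1, 1, -1, 1, -1, 1, -1, 1, 1, -1, 1, -1]"] in \<open>simp_all add: supports_def\<close>)
  next
    case 2
    show ?case by (rule summand) (use \<nu>(1) in \<open>simp_all add: summand_simps\<close>)
  qed
qed

lemma type_VI:
  "\<exists>\<nu>. seed adj (p 0) (W 5 (ss 5 ! 0)) 3 z 12 \<nu> [-1, 1, 1, -1, 1, -1, -1, 1, -1, 1, 1, -1] \<and>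
    summand_data adj (p 0) (W 5 (ss 5 ! 0)) 3 1 2 1 [1, 1]
      [\<nu>, E 4 *v (A *v \<nu>)]
      [[-1, 2],
       [1, -1]]
      [-1 + sqrt2, -1 - sqrt2]"
proof -
  have \<nu>: "ss 5 ! 0 \<in> set (ss 5)" "ss 5 ! 0 = place z [-1, 1, 1, -1, 1, -1, -1, 1, -1, 1, 1, -1]" by (simp_all add: ss_def)
  show ?thesis
  proof (intro exI[of _ "ss 5 ! 0"] conjI, goal_cases)
    case 1
    show ?case by (rule seed_of_W) (use \<nu> map_place[OF z(1), of "[-1, 1, 1, -1, 1, -1, -1, 1, -1, 1, 1, -1]"] in \<open>simp_all add: supports_def\<close>)
  next
    case 2
    show ?case by (rule summand) (use \<nu>(1) in \<open>simp_all add: summand_simps\<close>)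
  qed
qed

lemma lessThan_6: "{..<6::nat} = {0, 1, 2, 3, 4, 5}"
  by auto

lemma dim_T: "cmat.dim T = 75"
  using dim_algebra word_lengths[unfolded all_less_6] by (simp add: lessThan_6 supports_def power2_eq_square)

lemma dim_eigenspace_A: "vec.dim (eigenspace A \<theta>) = (\<Sum>k<6. count_list (eigenvalues k) \<theta> * length (ss k))"
proof (rule dim_eigenspace)
  fix k :: nat assume k: "k < 6"
  show "diagonalization (eigenvalues k) (action_matrix k)
     (mat_of_rows_list (length (action_rows k)) (right_eigenvectors k))
     (mat_of_rows_list (length (action_rows k)) (left_eigenvectors k))"
    using diagonalization_of_action k by blast
  have "\<forall>k<6. length (eigenvalues k) = length (supports k)"
    unfolding all_less_6 by (simp add: eigenvalues_def supports_def)
  then show "length (eigenvalues k) = length (ws k)" using word_lengths k by simp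
  show "A *v (ws k ! i *v s) = (\<Sum>j<length (ws k). action_matrix k $$ (j, i) *s (ws k ! j *v s))"
    if "i < length (ws k)" "s \<in> S k" for i s
    using A_action[of s] S_pattern[OF k that(2)] word_lengths k that by simp
qed

lemma eigenvalues_distinct: "distinct [3, 2, -1 + sqrt2, -1, -1 - sqrt2]"
proof -
  have "- sqrt 2 \<noteq> 3" "- sqrt 2 \<noteq> 4" "sqrt 2 \<noteq> 3" "sqrt 2 \<noteq> 4"
    using real_sqrt_ge_zero[of 2] sqrt2_less_2 by linarith+
  then show ?thesis by (auto simp: complex_eq_iff)
qed

text \<open>Each multiplicity is a sum over the types; the eigenvalue 2, for instance, gets 1 + 4 +
  1 + 2 = 8 from types I to IV, type II contributing a double eigenvalue in two copies.\<close>

lemma spectrum: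
  "{\<theta>. eigenspace A \<theta> \<noteq> {0}} = {3, 2, -1 + sqrt2, -1, -1 - sqrt2}"
  "vec.dim (eigenspace A 3) = 1" "vec.dim (eigenspace A 2) = 8" "vec.dim (eigenspace A (-1 + sqrt2)) = 6"
  "vec.dim (eigenspace A (-1)) = 7" "vec.dim (eigenspace A (-1 - sqrt2)) = 6"
proof -
  show "{\<theta>. eigenspace A \<theta> \<noteq> {0}} = {3, 2, -1 + sqrt2, -1, -1 - sqrt2}"
    unfolding eigenspace_nonzero_iff dim_eigenspace_A
    by (auto simp: lessThan_6 count_list_0_iff eigenvalues_def ss_def)
  show "vec.dim (eigenspace A 3) = 1" "vec.dim (eigenspace A 2) = 8" "vec.dim (eigenspace A (-1 + sqrt2)) = 6"
    "vec.dim (eigenspace A (-1)) = 7" "vec.dim (eigenspace A (-1 - sqrt2)) = 6"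
    unfolding dim_eigenspace_A using eigenvalues_distinct
    by (auto simp: lessThan_6 eigenvalues_def ss_def)
qed

end

section \<open>Existence of the orders and the final statement\<close>

context coxeter
begin

lemma ordered_coxeter_exists:
  assumes u: "order1 adj x u" and y: "order2 adj x y" and z: "order3 adj x y z"
  shows "\<exists>p. ordered_coxeter adj p u y z \<and> p 0 = x"
proof -
  obtain p where p: "labelling adj p" "p 0 = x" "\<forall>j\<in>{1..6}. y j = p (3 + j)"
    using order2_labelling[OF y] by blast
  interpret labelled_coxeter adj p by unfold_locales (rule p(1))
  have "ordered_coxeter adj p u y z"
    by unfold_locales
      (use u y z order3_cases[OF p(3)] p in \<open>simp_all add: order1_def order2_def order3_def\<close>)
  then show ?thesis using p(2) by blast
qed

lemma orders_exist:
  "\<exists>u. order1 adj x u" "\<exists>y. order2 adj x y" "order2 adj x y \<Longrightarrow> \<exists>z. order3 adj x y z"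
proof -
  obtain p where p: "labelling adj p" "p 0 = x" using labelling_at by blast
  interpret labelled_coxeter adj p by unfold_locales (rule p(1))
  show "\<exists>u. order1 adj x u" "\<exists>y. order2 adj x y"
    using order1_exists order2_exists p(2) by auto
next
  assume "order2 adj x y"
  then obtain p where p: "labelling adj p" "p 0 = x" "\<forall>j\<in>{1..6}. y j = p (3 + j)"
    using order2_labelling by blast
  interpret labelled_coxeter adj p by unfold_locales (rule p(1))
  show "\<exists>z. order3 adj x y z" using order3_exists[OF p(3)] p(2) by auto
qed

end

theorem mainTheorem7:
  fixes adj :: "'v::finite graph" and x :: 'v
    and A :: "complex^'v^'v" and E :: "nat \<Rightarrow> complex^'v^'v" and T :: "(complex^'v^'v) set"
    and rt2 :: complex
  assumes coxeter: "coxeter_graph adj"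
    and A: "A = adjacency_matrix adj"
    and E: "E = Estar adj x"
    and T: "T = terwilliger_algebra adj x"
    and rt2: "rt2 = complex_of_real (sqrt 2)"
  shows
    "{\<theta>. eigenspace A \<theta> \<noteq> {0}} = {3, 2, -1 + rt2, -1, -1 - rt2} \<and>
     vec.dim (eigenspace A 3) = 1 \<and>
     vec.dim (eigenspace A 2) = 8 \<and>
     vec.dim (eigenspace A (-1 + rt2)) = 6 \<and>
     vec.dim (eigenspace A (-1)) = 7 \<and>
     vec.dim (eigenspace A (-1 - rt2)) = 6 \<and>
     (\<exists>u. order1 adj x u) \<and> (\<exists>y. order2 adj x y) \<and>
     (\<forall>y. order2 adj x y \<longrightarrow> (\<exists>z. order3 adj x y z)) \<and>
     (\<forall>u y z. order1 adj x u \<and> order2 adj x y \<and> order3 adj x y z \<longrightarrow>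
       (\<exists>W0 W1a W1b W2a W2b W2c W3a W3b.
          irreducible_decomposition T [W0, W1a, W1b, W2a, W2b, W2c, W3a, W3b] \<and>
          (\<forall>j<8. \<forall>k<8.
             isomorphic_modules T ([W0, W1a, W1b, W2a, W2b, W2c, W3a, W3b] ! j)
                                  ([W0, W1a, W1b, W2a, W2b, W2c, W3a, W3b] ! k) \<longleftrightarrow>
             [1, 2, 2, 3, 4, 4, 5, 6 :: nat] ! j = [1, 2, 2, 3, 4, 4, 5, 6] ! k) \<and>
          summand_data adj x W0 0 1 5 4 [1, 1, 1, 1, 1]
            [estar adj x 0, estar adj x 1, estar adj x 2, estar adj x 3, estar adj x 4]
            [[0, 3, 0, 0, 0],
             [1, 0, 2, 0, 0],
             [0, 1, 0, 2, 0],
             [0, 0, 1, 1, 1],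
             [0, 0, 0, 2, 1]]
            [3, 2, -1 + rt2, -1, -1 - rt2] \<and>
          (\<forall>(W, cs) \<in> {(W1a, [1, -1, 0]), (W1b, [1, 1, -2])}.
             \<exists>\<nu>. seed adj x W 1 u 3 \<nu> cs \<and> A *v \<nu> = E 2 *v (A *v \<nu>) \<and>
               summand_data adj x W 1 2 5 3 [1, 1, 2, 1]
                 [\<nu>, A *v \<nu>, E 3 *v (A *v (A *v \<nu>)), E 3 *v (A *v (A *v (A *v \<nu>))),
                  E 4 *v (A *v (A *v (A *v \<nu>)))]
                 [[0, 2, 0, 0, 0],
                  [1, 0, 2, -1, 0],
                  [0, 1, 0, 1, 0],
                  [0, 0, 1, 0, -1],
                  [0, 0, 1, -2, 1]]
                 [2, 2, -1 + rt2, -1, -1 - rt2]) \<and>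
          (\<exists>\<nu>. seed adj x W2a 2 y 6 \<nu> [1, -1, -1, 1, -1, 1] \<and> A *v \<nu> = E 3 *v (A *v \<nu>) \<and>
             summand_data adj x W2a 2 1 2 1 [1, 1]
               [\<nu>, A *v \<nu>]
               [[0, 2],
                [1, 1]]
               [2, -1]) \<and>
          (\<forall>(W, cs) \<in> {(W2b, [1, -1, 0, 0, 1, -1]), (W2c, [1, -1, 2, -2, -1, 1])}.
             \<exists>\<nu>. seed adj x W 2 y 6 \<nu> cs \<and> A *v \<nu> = E 3 *v (A *v \<nu>) \<and>
               summand_data adj x W 2 2 4 2 [1, 2, 1]
                 [\<nu>, A *v \<nu>, E 3 *v (A *v (A *v \<nu>)), E 4 *v (A *v (A *v \<nu>))]
                 [[0, 2, -1, 0],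
                  [1, 0, 1, 2],
                  [0, 1, 0, 1],
                  [0, 1, 0, -1]]
                 [2, -1 + rt2, -1, -1 - rt2]) \<and>
          (\<exists>\<nu>. seed adj x W3a 3 z 12 \<nu> [-1, 1, -1, 1, -1, 1, -1, 1, 1, -1, 1, -1] \<and>
             summand_data adj x W3a 3 1 1 0 [1]
               [\<nu>]
               [[-1]]
               [-1]) \<and>
          (\<exists>\<nu>. seed adj x W3b 3 z 12 \<nu> [-1, 1, 1, -1, 1, -1, -1, 1, -1, 1, 1, -1] \<and>
             summand_data adj x W3b 3 1 2 1 [1, 1]
               [\<nu>, E 4 *v (A *v \<nu>)]
               [[-1, 2],
                [1, -1]]
               [-1 + rt2, -1 - rt2]))) \<and>
     cmat.dim T = 5^2 + 5^2 + 2^2 + 4^2 + 1^2 + 2^2 \<and> cmat.dim T = 75"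
proof -
  interpret coxeter adj by unfold_locales (rule coxeter)
  \<comment> \<open>The spectrum and the dimension of T do not refer to orders but are derived from
    the seeds, so one admissible choice of orders is fixed for them.\<close>
  obtain u0 y0 z0 p0 where o0: "ordered_coxeter adj p0 u0 y0 z0" "p0 0 = x"
    using orders_exist[of x] ordered_coxeter_exists[of x] by metis
  note spectrum = ordered_coxeter.spectrum[OF o0(1), folded rt2 A]
  have dim_T: "cmat.dim T = 75" using ordered_coxeter.dim_T[OF o0(1)] o0(2) T by simp
  show ?thesis
  proof (intro conjI allI impI, goal_cases)
    case (10 u y z)
    obtain p where p: "ordered_coxeter adj p u y z" "p 0 = x"
      using ordered_coxeter_exists 10 by blast
    interpret ordered_coxeter adj p u y z by (rule p(1))
    note eqs = assms(2-5) p(2)[symmetric]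
    show ?case
      unfolding eqs
    proof (rule exI[of _ "W 0 (ss 0 ! 0)"], rule exI[of _ "W 1 (ss 1 ! 0)"], rule exI[of _ "W 1 (ss 1 ! 1)"],
        rule exI[of _ "W 2 (ss 2 ! 0)"], rule exI[of _ "W 3 (ss 3 ! 0)"], rule exI[of _ "W 3 (ss 3 ! 1)"],
        rule exI[of _ "W 4 (ss 4 ! 0)"], rule exI[of _ "W 5 (ss 5 ! 0)"], intro conjI, goal_cases)
      case 1
      show ?case using decomposition_seeds by (simp add: seed_indices_def)
    next
      case 2
      have "map (\<lambda>(k, a). Suc k) seed_indices = [1, 2, 2, 3, 4, 4, 5, 6]"
        by (simp add: seed_indices_def)
      note isomorphic_seeds[unfolded this]
      then show ?case by (simp add: seed_indices_def)
    next
      case 3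
      show ?case by (rule type_I)
    next
      case 4
      show ?case by (rule ballI, rule case_prodI2, rule type_II, simp)
    next
      case 5
      show ?case by (rule type_III)
    next
      case 6
      show ?case by (rule ballI, rule case_prodI2, rule type_IV, simp)
    next
      case 7
      show ?case by (rule type_V)
    next
      case 8
      show ?case by (rule type_VI)
    qed
  qed (use spectrum orders_exist[of x] dim_T in simp_all)
qed

end
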